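(* Let $X$ be a discrete random variable taking values in $\mathbb{N}\cup\{0\}$, with $P(X=n)=p_n$ for $n\ge 0$, and moment-generating function $M_X$. Let $\mathcal{X}$ be a compact Hausdorff space with a Borel measure $\mu$, let $\alpha:\mathcal{X}\to\mathcal{X}$ be a continuous map preserving $\mu$, let $1\le p<\infty$, and for $\varphi\in C(\mathcal{X})$ let $\lambda(\varphi)=\ln r(e^{\varphi}C_\alpha)$, where $r(e^{\varphi}C_\alpha)$ is the spectral radius of the weighted composition operator $e^\varphi C_\alpha$ on $L^p(\mathcal{X},\mu)$. Let $\tau_\alpha$ be the $\mathbf{t}$-entropy. Define $\widehat{\lambda}_X:C(\mathcal{X})\to(-\infty,+\infty]$ by $$\widehat{\lambda}_X(\varphi)=\begin{cases}(\ln M_X)(\lambda(\varphi)) & \text{if }\varphi\in\lambda^{-1}(\mathcal{D}(\ln M_X)),\\ +\infty&\text{otherwise.}\end{cases}$$ Then for all $\varphi\in C(\mathcal{X})$ the following variational principle holds: $$\widehat{\lambda}_X(\varphi)=\sup_{\widehat{\nu}\in\widehat{\mathcal{M}}}\Big\{\int_{\mathcal{X}}\varphi\,d\widehat{\nu}-\widehat{\lambda}_X^{\ast}(\widehat{\nu})\Big\},$$ where $\widehat{\mathcal{M}}=\{\widehat{\nu}=a\nu:\ \nu\in\mathcal{M}^1_\alpha\text{ and }a\in\mathcal{D}((\ln M_X)^{\ast})\}$, and the convex conjugate $\widehat{\lambda}_X^{\ast}$ of $\widehat{\lambda}_X$ is given, for $\widehat{\nu}\in\widehat{\mathcal{M}}$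 with $\widehat{\nu}(\mathcal{X})>0$, by $$\widehat{\lambda}_X^{\ast}(\widehat{\nu})=\frac{1}{p}\,\widehat{\nu}(\mathcal{X})\,\tau_\alpha\Big(\frac{\widehat{\nu}}{\widehat{\nu}(\mathcal{X})}\Big)+(\ln M_X)^{\ast}(\widehat{\nu}(\mathcal{X})).$$ If $\widehat{\nu}(\mathcal{X})=0$ (that is, $\widehat{\nu}=\mathbf{0}$), then $\widehat{\lambda}_X^{\ast}(\mathbf{0})=-\ln p_0$.
   Context: Random variables: $M_X(t)=E e^{tX}=\sum_{n\ge0}p_n e^{nt}\in(0,+\infty]$ for $t\in\mathbb{R}$, and $\ln(+\infty)=+\infty$, $-\ln 0=+\infty$. (The exponent $p$ of $L^p$ is unrelated to the probabilities $p_n$.) Convex conjugates: for a functional $f$ on a real locally convex Hausdorff space $L$ with values in $[-\infty,+\infty]$, the effective domain is $\mathcal{D}(f)=\{\varphi\in L: f(\varphi)<+\infty\}$ and the convex conjugate (Legendre-Fenchel transform) is $f^{\ast}(\mu)=\sup_{\varphi\in L}\{\langle\mu,\varphi\rangle-f(\varphi)\}$ for $\mu\in L^{\ast}$. For $L=\mathbb{R}$, $f^\ast(a)=\sup_{t\in\mathbb{R}}\{at-f(t)\}$; $(\ln M_X)^\ast$ is the Cramér transform of $X$. Weighted composition operators: $C(\mathcal{X})$ is the space of real continuous functions on $\mathcal{X}$ with the sup norm; its dual is identified with finite signed (regular) Borel measures. "$\alpha$ preserves $\mu$" means $\mu\circ\alpha^{-1}=\mu$. For $g\in C(\mathcal{X})$,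 $(gC_\alpha)u(x)=g(x)u(\alpha(x))$, acting on $L^p(\mathcal{X},\mu)$. $\mathcal{M}^1_\alpha$ is the set of $\alpha$-invariant Borel probability measures on $\mathcal{X}$. $\mathbf{t}$-entropy: $\tau_\alpha:\mathcal{M}^1_\alpha\to[0,+\infty]$ is the convex, lower semicontinuous (weak-$\ast$) functional (depending on $\mu$ and $\alpha$, not on $p$) constructed by Antonevich, Bakhtin and Lebedev, for which the following known variational principle holds for all $1\le p<\infty$ and $g\in C(\mathcal{X})$: $$\ln r(gC_\alpha)=\max_{\nu\in\mathcal{M}^1_\alpha}\Big\{\int_{\mathcal{X}}\ln|g|\,d\nu-\frac{\tau_\alpha(\nu)}{p}\Big\}.$$ Equivalently, the functional $\lambda$ is convex and continuous on $C(\mathcal{X})$, its convex conjugate satisfies $\lambda^{\ast}(\nu)=\tau_\alpha(\nu)/p$ for $\nu\in\mathcal{M}^1_\alpha$, and $\lambda^{\ast}=+\infty$ off $\mathcal{M}^1_\alpha$; this determines $\tau_\alpha$ uniquely, via $\tau_\alpha(\nu)=p\sup_{\varphi\in C(\mathcal{X})}\{\int_{\mathcal{X}}\varphi\,d\nu-\lambda(\varphi)\}$. *)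

theory Defs
  imports "HOL-Probability.Probability"
begin

section \<open>Convex conjugates and the cumulant generating function\<close>

definition effective_domain :: "('l \<Rightarrow> ereal) \<Rightarrow> 'l set" where
  "effective_domain f = {\<phi>. f \<phi> < \<infinity>}"

text \<open>
  The pairing between the dual and the space is a parameter: it is multiplication for the real
  line and \<^const>\<open>blinfun_apply\<close> for a normed space and its dual of bounded linear functionals.
\<close>

definition convex_conjugate :: "('d \<Rightarrow> 'l \<Rightarrow> real) \<Rightarrow> ('l \<Rightarrow> ereal) \<Rightarrow> 'd \<Rightarrow> ereal" where
  "convex_conjugate pairing f \<mu> = (SUP \<phi>. ereal (pairing \<mu> \<phi>) - f \<phi>)"

definition ext_ln :: "ennreal \<Rightarrow> ereal" where
  "ext_ln x = (if x = \<infinity> then \<infinity> else if x = 0 then - \<infinity> else ereal (ln (enn2real x)))"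

definition mgf :: "'b measure \<Rightarrow> ('b \<Rightarrow> nat) \<Rightarrow> real \<Rightarrow> ennreal" where
  "mgf \<Omega> X t = (\<integral>\<^sup>+ \<omega>. ennreal (exp (t * real (X \<omega>))) \<partial>\<Omega>)"

definition ln_mgf :: "'b measure \<Rightarrow> ('b \<Rightarrow> nat) \<Rightarrow> real \<Rightarrow> ereal" where
  "ln_mgf \<Omega> X t = ext_ln (mgf \<Omega> X t)"

definition cramer_transform :: "'b measure \<Rightarrow> ('b \<Rightarrow> nat) \<Rightarrow> real \<Rightarrow> ereal" where
  "cramer_transform \<Omega> X = convex_conjugate (*) (ln_mgf \<Omega> X)"


section \<open>Operators on complex Lebesgue spaces and their spectral radius\<close>

text \<open>
  Elements of the complex space $L^p$ are represented by functions, and equality in $L^p$ is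
  almost everywhere equality. An operator is a map on representatives that is linear up to
  null sets and bounded; in particular it respects almost everywhere equality.
\<close>

definition lp_space :: "real \<Rightarrow> 'a measure \<Rightarrow> ('a \<Rightarrow> complex) set" where
  "lp_space p M = {u \<in> borel_measurable M. integrable M (\<lambda>x. norm (u x) powr p)}"

definition lp_norm :: "real \<Rightarrow> 'a measure \<Rightarrow> ('a \<Rightarrow> complex) \<Rightarrow> real" where
  "lp_norm p M u = (LINT x|M. norm (u x) powr p) powr (1 / p)"

definition lp_operator :: "real \<Rightarrow> 'a measure \<Rightarrow> (('a \<Rightarrow> complex) \<Rightarrow> ('a \<Rightarrow> complex)) \<Rightarrow> bool" where
  "lp_operator p M T \<longleftrightarrow>
     (\<forall>u\<in>lp_space p M. T u \<in> lp_space p M) \<and>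
     (\<forall>u\<in>lp_space p M. \<forall>v\<in>lp_space p M. \<forall>a b.
        AE x in M. T (\<lambda>y. a * u y + b * v y) x = a * T u x + b * T v x) \<and>
     (\<exists>C. \<forall>u\<in>lp_space p M. lp_norm p M (T u) \<le> C * lp_norm p M u)"

text \<open>The complex numbers \<open>z\<close> for which \<open>z I - T\<close> has no two-sided bounded inverse on $L^p$.\<close>

definition lp_spectrum ::
  "real \<Rightarrow> 'a measure \<Rightarrow> (('a \<Rightarrow> complex) \<Rightarrow> ('a \<Rightarrow> complex)) \<Rightarrow> complex set" where
  "lp_spectrum p M T = {z. \<not> (\<exists>S. lp_operator p M S \<and>
     (\<forall>u\<in>lp_space p M.
        (AE x in M. S (\<lambda>y. z * u y - T u y) x = u x) \<and>
        (AE x in M. z * S u x - T (S u) x = u x)))}"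

definition lp_spectral_radius ::
  "real \<Rightarrow> 'a measure \<Rightarrow> (('a \<Rightarrow> complex) \<Rightarrow> ('a \<Rightarrow> complex)) \<Rightarrow> real" where
  "lp_spectral_radius p M T = (SUP z\<in>lp_spectrum p M T. norm z)"

definition weighted_composition ::
  "('a \<Rightarrow> real) \<Rightarrow> ('a \<Rightarrow> 'a) \<Rightarrow> ('a \<Rightarrow> complex) \<Rightarrow> ('a \<Rightarrow> complex)" where
  "weighted_composition g \<alpha> u = (\<lambda>x. complex_of_real (g x) * u (\<alpha> x))"

text \<open>
  On a compact space the bounded continuous functions \<open>'a \<Rightarrow>\<^sub>C real\<close> are all the continuous
  functions, with the supremum norm.
\<close>

definition log_spectral_radius ::
  "real \<Rightarrow> 'a::topological_space measure \<Rightarrow> ('a \<Rightarrow> 'a) \<Rightarrow> ('a \<Rightarrow>\<^sub>C real) \<Rightarrow> real" where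
  "log_spectral_radius p \<mu> \<alpha> \<phi> =
     ln (lp_spectral_radius p \<mu> (weighted_composition (\<lambda>x. exp (apply_bcontfun \<phi> x)) \<alpha>))"


section \<open>Invariant measures in the dual space and t-entropy\<close>

text \<open>
  The dual of $C(\mathcal{X})$ is the normed space \<open>('a \<Rightarrow>\<^sub>C real) \<Rightarrow>\<^sub>L real\<close>. A finite signed regular
  Borel measure is identified, as in the Riesz representation theorem, with the functional given
  by integration against it.
\<close>

definition regular_borel_measure :: "'a::topological_space measure \<Rightarrow> bool" where
  "regular_borel_measure \<nu> \<longleftrightarrow> sets \<nu> = sets borel \<and>
     (\<forall>A\<in>sets borel.
        emeasure \<nu> A = (SUP K\<in>{K. compact K \<and> K \<in> sets borel \<and> K \<subseteq> A}. emeasure \<nu> K) \<and>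
        emeasure \<nu> A = (INF U\<in>{U. open U \<and> A \<subseteq> U}. emeasure \<nu> U))"

definition invariant_prob_measures :: "('a::topological_space \<Rightarrow> 'a) \<Rightarrow> 'a measure set" where
  "invariant_prob_measures \<alpha> =
     {\<nu>. prob_space \<nu> \<and> regular_borel_measure \<nu> \<and> distr \<nu> borel \<alpha> = \<nu>}"

definition dual_of_measure :: "'a::topological_space measure \<Rightarrow> ('a \<Rightarrow>\<^sub>C real) \<Rightarrow>\<^sub>L real" where
  "dual_of_measure \<nu> = Blinfun (\<lambda>\<phi>. LINT x|\<nu>. apply_bcontfun \<phi> x)"

lemma dual_of_measure_apply:
  fixes \<nu> :: "'a::topological_space measure"
  assumes "finite_measure \<nu>" and sets: "sets \<nu> = sets borel"
  shows "blinfun_apply (dual_of_measure \<nu>) \<phi> = (LINT x|\<nu>. apply_bcontfun \<phi> x)"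
proof -
  interpret finite_measure \<nu> by fact
  have int: "integrable \<nu> (apply_bcontfun \<psi>)" for \<psi> :: "'a \<Rightarrow>\<^sub>C real"
  proof (rule integrable_const_bound)
    show "AE x in \<nu>. norm (apply_bcontfun \<psi> x) \<le> norm \<psi>"
      by (simp only: norm_bounded AE_I2)
    show "apply_bcontfun \<psi> \<in> borel_measurable \<nu>"
      unfolding measurable_cong_sets[OF sets refl]
      by (rule borel_measurable_continuous_onI) simp
  qed
  have "bounded_linear (\<lambda>\<psi> :: 'a \<Rightarrow>\<^sub>C real. LINT x|\<nu>. apply_bcontfun \<psi> x)"
  proof (rule bounded_linear_intro)
    fix \<psi> :: "'a \<Rightarrow>\<^sub>C real"
    have "norm (LINT x|\<nu>. apply_bcontfun \<psi> x) \<le> (LINT x|\<nu>. norm (apply_bcontfun \<psi> x))"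
      by (rule integral_norm_bound)
    also have "\<dots> \<le> (LINT x|\<nu>. norm \<psi>)"
      by (rule integral_mono) (use int norm_bounded[of \<psi>] in auto)
    finally show "norm (LINT x|\<nu>. apply_bcontfun \<psi> x) \<le> norm \<psi> * measure \<nu> (space \<nu>)"
      by (simp add: mult.commute)
  qed (use int in auto)
  then show ?thesis
    by (simp add: dual_of_measure_def bounded_linear_Blinfun_apply)
qed

definition invariant_probs :: "('a::topological_space \<Rightarrow> 'a) \<Rightarrow> (('a \<Rightarrow>\<^sub>C real) \<Rightarrow>\<^sub>L real) set" where
  "invariant_probs \<alpha> = dual_of_measure ` invariant_prob_measures \<alpha>"

text \<open>The value $\widehat\nu(\mathcal{X})$ for $\widehat\nu$ in the dual of $C(\mathcal{X})$.\<close>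

definition total_mass :: "(('a::topological_space \<Rightarrow>\<^sub>C real) \<Rightarrow>\<^sub>L real) \<Rightarrow> real" where
  "total_mass \<nu> = blinfun_apply \<nu> (const_bcontfun 1)"

text \<open>
  The t-entropy is characterised by $\tau_\alpha(\nu) = p \sup_\varphi (\int \varphi\,d\nu -
  \lambda(\varphi))$ for every $p \ge 1$, where $\lambda$ is taken on $L^p$. Since it does not
  depend on \<open>p\<close>, the instance $p = 1$ serves as its definition. It is of interest only for
  \<open>\<nu> \<in> invariant_probs \<alpha>\<close>.
\<close>

definition t_entropy ::
  "'a::topological_space measure \<Rightarrow> ('a \<Rightarrow> 'a) \<Rightarrow> (('a \<Rightarrow>\<^sub>C real) \<Rightarrow>\<^sub>L real) \<Rightarrow> ereal" where
  "t_entropy \<mu> \<alpha> \<nu> =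
     convex_conjugate blinfun_apply (\<lambda>\<phi>. ereal (log_spectral_radius 1 \<mu> \<alpha> \<phi>)) \<nu>"


section \<open>The functional obtained by composing with the cumulant generating function\<close>

definition lambda_hat ::
  "'b measure \<Rightarrow> ('b \<Rightarrow> nat) \<Rightarrow> real \<Rightarrow> 'a::topological_space measure \<Rightarrow> ('a \<Rightarrow> 'a)
    \<Rightarrow> ('a \<Rightarrow>\<^sub>C real) \<Rightarrow> ereal" where
  "lambda_hat \<Omega> X p \<mu> \<alpha> \<phi> =
     (if \<phi> \<in> log_spectral_radius p \<mu> \<alpha> -` effective_domain (ln_mgf \<Omega> X)
      then ln_mgf \<Omega> X (log_spectral_radius p \<mu> \<alpha> \<phi>) else \<infinity>)"

definition lambda_hat_conj ::
  "'b measure \<Rightarrow> ('b \<Rightarrow> nat) \<Rightarrow> real \<Rightarrow> 'a::topological_space measure \<Rightarrow> ('a \<Rightarrow> 'a)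
    \<Rightarrow> (('a \<Rightarrow>\<^sub>C real) \<Rightarrow>\<^sub>L real) \<Rightarrow> ereal" where
  "lambda_hat_conj \<Omega> X p \<mu> \<alpha> = convex_conjugate blinfun_apply (lambda_hat \<Omega> X p \<mu> \<alpha>)"

definition M_hat ::
  "'b measure \<Rightarrow> ('b \<Rightarrow> nat) \<Rightarrow> ('a::topological_space \<Rightarrow> 'a) \<Rightarrow> (('a \<Rightarrow>\<^sub>C real) \<Rightarrow>\<^sub>L real) set" where
  "M_hat \<Omega> X \<alpha> =
     {a *\<^sub>R \<nu> |a \<nu>. \<nu> \<in> invariant_probs \<alpha> \<and> a \<in> effective_domain (cramer_transform \<Omega> X)}"

end

theory Submission
  imports Defs
begin

text \<open>
  Write \<open>\<lambda>\<close> for the logarithm of the spectral radius and \<open>L\<close> for the cumulant generating function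
  of \<open>X\<close>, so that the functional in question is \<open>L \<circ> \<lambda>\<close>.

  The formula for the conjugate rests on \<open>\<lambda>(\<phi> + c) = \<lambda>(\<phi>) + c\<close>. For a functional \<open>\<nu>\<close> of mass one this
  lets \<open>\<lambda>(\<phi>)\<close> and \<open>\<nu>(\<phi>) - \<lambda>(\<phi>)\<close> vary independently, so that the supremum of \<open>a \<nu>(\<phi>) - L(\<lambda>(\<phi>))\<close> is
  the sum of \<open>a \<lambda>\<^sup>*(\<nu>)\<close> and \<open>L\<^sup>*(a)\<close> (\<open>lambda_hat_conj_scaleR\<close>).

  For the variational principle, \<open>L\<close> is the supremum of its affine minorants, whose slopes lie in
  the effective domain of \<open>L\<^sup>*\<close> and are nonnegative (\<open>ln_mgf_le_biconjugate\<close>), and at every \<open>\<phi>\<close> the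
  functional \<open>\<lambda>\<close> has a subgradient that is an invariant probability measure. Composing an affine
  minorant of \<open>L\<close> of slope \<open>a\<close> with the subgradient \<open>\<nu>\<close> gives an affine minorant of \<open>L \<circ> \<lambda>\<close> with
  linear part \<open>a \<nu>\<close>.

  The existence of invariant subgradients (\<open>growth_rate_ex_invariant_subgradient\<close>) follows from the
  Hahn--Banach theorem and the Riesz representation theorem once \<open>\<lambda>\<close> is known to be convex,
  monotone, compatible with constants and insensitive to coboundaries. These properties are clear
  for the exponential growth rate of the integrals of \<open>exp (S\<^sub>n \<phi>) f \<circ> \<alpha>\<^sup>n\<close>, where \<open>S\<^sub>n \<phi>\<close> denotes the
  Birkhoff sums and \<open>f\<close> ranges over nonnegative functions. The remaining point is that the spectral radius,
  defined through the spectrum on \<open>L\<^sup>p\<close>, is given by this growth rate, taken at \<open>p \<phi>\<close> and divided by \<open>p\<close>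
  (\<open>log_spectral_radius_eq_growth_rate\<close>). That
  the spectrum is not larger is the Neumann series. That it reaches the growth rate \<open>\<rho>\<close> uses
  positivity of the operator \<open>T\<close>: if \<open>\<rho> - T\<close> had a bounded inverse, this inverse would be positive, and
  would dominate \<open>T\<^sup>m / \<rho>\<^sup>m\<^sup>+\<^sup>1\<close> for all \<open>m\<close>; its square would dominate multiples of \<open>T\<^sup>n / \<rho>\<^sup>n\<close>
  growing linearly in \<open>n\<close>, so that the powers of \<open>T\<close> would grow more slowly than \<open>\<rho>\<close>.
\<close>

section \<open>Subgradients of convex functions\<close>

definition sublinear :: "('v::real_vector \<Rightarrow> real) \<Rightarrow> bool" where
  "sublinear q \<longleftrightarrow> (\<forall>x y. q (x + y) \<le> q x + q y) \<and> (\<forall>c x. 0 \<le> c \<longrightarrow> q (c *\<^sub>R x) = c * q x)"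

lemma sublinear_0: "sublinear q \<Longrightarrow> q 0 = 0"
  unfolding sublinear_def by (metis mult_zero_left order_refl scaleR_zero_left)

lemma sublinear_minus_le: "sublinear q \<Longrightarrow> - q (- x) \<le> q x"
  using sublinear_0[of q] unfolding sublinear_def
  by (metis add.right_inverse add.commute le_add_same_cancel1 minus_le_iff diff_le_eq diff_0)

text \<open>
  Sublinearity survives infima over chains, because finitely many members of a chain have a
  smallest one; the bound by the reflected majorant keeps the infimum finite.
\<close>

lemma sublinear_chain_Inf:
  fixes q :: "'v::real_vector \<Rightarrow> real"
  assumes C: "C \<noteq> {}" "\<And>f. f \<in> C \<Longrightarrow> sublinear f" "\<And>f x. f \<in> C \<Longrightarrow> f x \<le> q x"
    and chain: "\<And>f g. f \<in> C \<Longrightarrow> g \<in> C \<Longrightarrow> f \<le> g \<or> g \<le> f"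
  shows "sublinear (\<lambda>x. INF f\<in>C. f x)" and "f \<in> C \<Longrightarrow> (INF f\<in>C. f x) \<le> f x"
proof -
  have lower: "- q (- x) \<le> f x" if "f \<in> C" for f x
    using sublinear_minus_le[OF C(2)[OF that], of x] C(3)[OF that, of "- x"] by linarith
  have bdd: "bdd_below ((\<lambda>f. f x) ` C)" for x
    by (rule bdd_belowI2) (rule lower)
  show le: "(INF f\<in>C. f x) \<le> f x" if "f \<in> C" for f x
    using cINF_lower[OF bdd that] .
  have "(INF f\<in>C. f (x + y)) \<le> (INF f\<in>C. f x) + (INF f\<in>C. f y)" for x y
  proof -
    have *: "(INF f\<in>C. f (x + y)) \<le> f x + g y" if fg: "f \<in> C" "g \<in> C" for f g
    proof -
      obtain h where h: "h \<in> C" "h \<le> f" "h \<le> g"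
        using chain[OF fg] fg by auto
      have "(INF f\<in>C. f (x + y)) \<le> h (x + y)" by (rule le[OF h(1)])
      also have "\<dots> \<le> h x + h y" using C(2)[OF h(1)] by (simp add: sublinear_def)
      also have "\<dots> \<le> f x + g y" using h(2,3) by (intro add_mono) (auto simp: le_fun_def)
      finally show ?thesis .
    qed
    have "(INF f\<in>C. f (x + y)) - (INF g\<in>C. g y) \<le> f x" if f: "f \<in> C" for f
    proof -
      have "(INF f\<in>C. f (x + y)) - f x \<le> (INF g\<in>C. g y)"
        using *[OF f] by (intro cINF_greatest C(1)) (simp add: algebra_simps)
      then show ?thesis by simp
    qed
    then have "(INF f\<in>C. f (x + y)) - (INF g\<in>C. g y) \<le> (INF f\<in>C. f x)"
      by (intro cINF_greatest C(1))
    then show ?thesis by simp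
  qed
  moreover have "(INF f\<in>C. f (c *\<^sub>R x)) = c * (INF f\<in>C. f x)" if c: "0 \<le> c" for c x
  proof (cases "c = 0")
    case True
    then show ?thesis using C(1) by (simp add: sublinear_0 C(2) cong: INF_cong)
  next
    case False
    then have c: "c > 0" using c by simp
    have eq: "f (c *\<^sub>R x) = c * f x" if "f \<in> C" for f
      using C(2)[OF that] c by (simp add: sublinear_def)
    show ?thesis
    proof (rule antisym)
      have "(INF f\<in>C. f (c *\<^sub>R x)) / c \<le> (INF f\<in>C. f x)"
      proof (intro cINF_greatest C(1))
        fix f assume f: "f \<in> C"
        show "(INF f\<in>C. f (c *\<^sub>R x)) / c \<le> f x"
          using le[OF f, of "c *\<^sub>R x"] c by (simp add: eq[OF f] field_simps)
      qed
      then show "(INF f\<in>C. f (c *\<^sub>R x)) \<le> c * (INF f\<in>C. f x)" using c by (simp add: field_simps)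
      show "c * (INF f\<in>C. f x) \<le> (INF f\<in>C. f (c *\<^sub>R x))"
        using c by (intro cINF_greatest C(1)) (simp add: eq le)
    qed
  qed
  ultimately show "sublinear (\<lambda>x. INF f\<in>C. f x)"
    by (auto simp: sublinear_def)
qed

text \<open>
  Pulling a sublinear \<open>q\<close> down along the direction \<open>y\<close> leaves it sublinear; a minimal one is
  therefore not changed by this, which says that it is additive.
\<close>

lemma minimal_sublinear_linear:
  fixes q :: "'v::real_vector \<Rightarrow> real"
  assumes q: "sublinear q" and minimal: "\<And>f. sublinear f \<Longrightarrow> f \<le> q \<Longrightarrow> f = q"
  shows "linear q"
proof -
  have sub: "q (x + y) \<le> q x + q y" and hom: "0 \<le> c \<Longrightarrow> q (c *\<^sub>R x) = c * q x" for x y c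
    using q by (auto simp: sublinear_def)
  have super: "q x + q y \<le> q (x + y)" for x y
  proof -
    define f where "f z = (INF t\<in>{0::real..}. q (z + t *\<^sub>R y) - t * q y)" for z
    have lower: "- q (- z) \<le> q (z + t *\<^sub>R y) - t * q y" if "t \<ge> 0" for z t
    proof -
      have "t * q y \<le> q (z + t *\<^sub>R y) + q (- z)"
        using sub[of "z + t *\<^sub>R y" "- z"] that by (simp add: hom)
      then show ?thesis by linarith
    qed
    have bdd: "bdd_below ((\<lambda>t. q (z + t *\<^sub>R y) - t * q y) ` {0::real..})" for z
      by (rule bdd_belowI2[where m = "- q (- z)"]) (simp add: lower)
    have le: "f z \<le> q (z + t *\<^sub>R y) - t * q y" if "t \<ge> 0" for z t
      unfolding f_def using that by (intro cINF_lower bdd) auto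
    have ge: "b \<le> f z" if "\<And>t. t \<ge> 0 \<Longrightarrow> b \<le> q (z + t *\<^sub>R y) - t * q y" for b z
      unfolding f_def using that by (intro cINF_greatest) auto
    have "f (z + w) \<le> f z + f w" for z w
    proof -
      have *: "f (z + w) \<le> (q (z + s *\<^sub>R y) - s * q y) + (q (w + t *\<^sub>R y) - t * q y)"
        if "s \<ge> 0" "t \<ge> 0" for s t
        using le[of "s + t" "z + w"] sub[of "z + s *\<^sub>R y" "w + t *\<^sub>R y"] that
        by (simp add: algebra_simps)
      have "f (z + w) - f w \<le> q (z + s *\<^sub>R y) - s * q y" if s: "s \<ge> 0" for s
      proof -
        have "f (z + w) - (q (z + s *\<^sub>R y) - s * q y) \<le> f w"
          by (rule ge) (use *[OF s] in \<open>simp add: algebra_simps\<close>)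
        then show ?thesis by simp
      qed
      then have "f (z + w) - f w \<le> f z" by (rule ge)
      then show ?thesis by simp
    qed
    moreover have f_le: "f z \<le> q z" for z
      using le[of 0 z] by simp
    moreover have "f (c *\<^sub>R z) = c * f z" if "c \<ge> 0" for c z
    proof (cases "c = 0")
      case True
      have "0 \<le> f 0" by (rule ge) (simp add: hom)
      moreover have "f 0 \<le> 0" using le[of 0 0] sublinear_0[OF q] by simp
      ultimately show ?thesis using True by simp
    next
      case False
      then have c: "c > 0" using that by simp
      have scale: "q (c *\<^sub>R z + (c * t) *\<^sub>R y) - (c * t) * q y = c * (q (z + t *\<^sub>R y) - t * q y)" for t
        using hom[of c "z + t *\<^sub>R y"] c by (simp add: algebra_simps)
      show ?thesis
      proof (rule antisym)
        have "f (c *\<^sub>R z) / c \<le> f z"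
        proof (rule ge)
          fix t :: real assume "t \<ge> 0"
          then show "f (c *\<^sub>R z) / c \<le> q (z + t *\<^sub>R y) - t * q y"
            using le[of "c * t" "c *\<^sub>R z"] c by (simp only: scale) (simp add: field_simps)
        qed
        then show "f (c *\<^sub>R z) \<le> c * f z" using c by (simp add: field_simps)
        show "c * f z \<le> f (c *\<^sub>R z)"
        proof (rule ge)
          fix t :: real assume t: "t \<ge> 0"
          have "c * f z \<le> c * (q (z + (t / c) *\<^sub>R y) - (t / c) * q y)"
            using le[of "t / c" z] c t by simp
          also have "\<dots> = q (c *\<^sub>R z + t *\<^sub>R y) - t * q y"
            using scale[of "t / c"] c by simp
          finally show "c * f z \<le> q (c *\<^sub>R z + t *\<^sub>R y) - t * q y" .
        qed
      qed
    qed
    ultimately have "f = q"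
      by (intro minimal) (auto simp: sublinear_def le_fun_def)
    then show ?thesis
      using le[of 1 x] by simp
  qed
  have add: "q (x + y) = q x + q y" for x y
    using sub super by (rule antisym)
  have neg: "q (- x) = - q x" for x
    using add[of x "- x"] sublinear_0[OF q] by simp
  show ?thesis
  proof (rule linearI)
    show "q (c *\<^sub>R x) = c *\<^sub>R q x" for c x
      using hom[of c x] hom[of "- c" x] neg[of "c *\<^sub>R x"] by (cases "c \<ge> 0") auto
  qed (rule add)
qed

text \<open>
  The Hahn--Banach theorem in the form needed for subgradients: Zorn's lemma provides a minimal
  sublinear functional below the given one.
\<close>

lemma ex_linear_le_sublinear:
  fixes q :: "'v::real_vector \<Rightarrow> real"
  assumes q: "sublinear q"
  shows "\<exists>l. linear l \<and> (\<forall>x. l x \<le> q x)"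
proof -
  define A where "A = {f. sublinear f \<and> f \<le> q}"
  have "\<exists>m\<in>A. \<forall>a\<in>A. m \<ge> a \<longrightarrow> a = m"
  proof (rule predicate_Zorn)
    show "partial_order_on A (relation_of (\<ge>) A)"
      by (rule partial_order_on_relation_ofI) auto
    fix C assume C: "C \<in> Chains (relation_of (\<ge>) A)"
    then have sub: "C \<subseteq> A" and chain: "\<And>f g. f \<in> C \<Longrightarrow> g \<in> C \<Longrightarrow> f \<le> g \<or> g \<le> f"
      by (auto simp: Chains_def relation_of_def)
    show "\<exists>u\<in>A. \<forall>a\<in>C. a \<ge> u"
    proof (cases "C = {}")
      case True
      then show ?thesis using q by (auto simp: A_def)
    next
      case False
      have *: "\<And>f. f \<in> C \<Longrightarrow> sublinear f" "\<And>f x. f \<in> C \<Longrightarrow> f x \<le> q x"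
        using sub by (auto simp: A_def le_fun_def)
      have Inf: "sublinear (\<lambda>x. INF f\<in>C. f x)" "\<And>f x. f \<in> C \<Longrightarrow> (INF f\<in>C. f x) \<le> f x"
        using sublinear_chain_Inf[of C q] False * chain by blast+
      obtain f0 where "f0 \<in> C" using False by auto
      then have "(\<lambda>x. INF f\<in>C. f x) \<le> q"
        using Inf(2)[of f0] *(2)[of f0] by (auto simp: le_fun_def intro: order_trans)
      then show ?thesis
        using Inf by (intro bexI[of _ "\<lambda>x. INF f\<in>C. f x"]) (auto simp: A_def le_fun_def)
    qed
  qed
  then obtain m where m: "m \<in> A" "\<And>a. a \<in> A \<Longrightarrow> a \<le> m \<Longrightarrow> a = m" by blast
  then have "linear m"
    by (intro minimal_sublinear_linear) (auto simp: A_def)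
  then show ?thesis using m(1) by (auto simp: A_def le_fun_def)
qed

text \<open>
  The directional derivative of a convex function is sublinear, and a linear functional below it
  is a subgradient.
\<close>

lemma convex_ex_subgradient:
  fixes F :: "'v::real_vector \<Rightarrow> real"
  assumes F: "convex_on UNIV F"
  shows "\<exists>l. linear l \<and> (\<forall>h. F x + l h \<le> F (x + h))"
proof -
  define D where "D h t = (F (x + t *\<^sub>R h) - F x) / t" for h t
  define q where "q h = (INF t\<in>{0<..}. D h t)" for h
  have conv: "F (u *\<^sub>R y + v *\<^sub>R z) \<le> u * F y + v * F z" if "u \<ge> 0" "v \<ge> 0" "u + v = 1" for u v y z
    using F that by (simp add: convex_on_def)
  have combine: "D (h + k) (s * t / (s + t)) \<le> D h s + D k t" if "s > 0" "t > 0" for h k s t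
  proof -
    have st: "s + t > 0" using that by simp
    have pt: "(t / (s + t)) *\<^sub>R (x + s *\<^sub>R h) + (s / (s + t)) *\<^sub>R (x + t *\<^sub>R k)
        = x + (s * t / (s + t)) *\<^sub>R (h + k)"
    proof -
      have "(t / (s + t)) *\<^sub>R x + (s / (s + t)) *\<^sub>R x = x"
        using st by (simp flip: scaleR_add_left add_divide_distrib add: add.commute)
      then show ?thesis
        by (simp add: scaleR_add_right algebra_simps)
    qed
    have "F (x + (s * t / (s + t)) *\<^sub>R (h + k))
        \<le> (t / (s + t)) * F (x + s *\<^sub>R h) + (s / (s + t)) * F (x + t *\<^sub>R k)"
      unfolding pt[symmetric] using that
      by (intro conv) (auto simp flip: add_divide_distrib)
    also have "\<dots> = (t * (F (x + s *\<^sub>R h) - F x) + s * (F (x + t *\<^sub>R k) - F x)) / (s + t) + F x"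
      using st by (simp add: divide_simps) (simp add: algebra_simps)
    finally have "F (x + (s * t / (s + t)) *\<^sub>R (h + k)) - F x
       \<le> (t * (F (x + s *\<^sub>R h) - F x) + s * (F (x + t *\<^sub>R k) - F x)) / (s + t)"
      by simp
    then have "D (h + k) (s * t / (s + t))
        \<le> ((t * (F (x + s *\<^sub>R h) - F x) + s * (F (x + t *\<^sub>R k) - F x)) / (s + t)) / (s * t / (s + t))"
      unfolding D_def using that by (intro divide_right_mono) auto
    also have "\<dots> = D h s + D k t"
    proof -
      have "((t * a + s * b) / (s + t)) / (s * t / (s + t)) = a / s + b / t" for a b
        using that st by (simp, simp add: add_divide_distrib)
      then show ?thesis unfolding D_def .
    qed
    finally show ?thesis .
  qed
  have D0: "D 0 t = 0" for t by (simp add: D_def)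
  have bdd: "bdd_below (D h ` {0<..})" for h
  proof (rule bdd_belowI2)
    fix t :: real assume "t \<in> {0<..}"
    then show "- D (- h) 1 \<le> D h t"
      using combine[of 1 t "- h" h] by (simp add: D0)
  qed
  have le: "q h \<le> D h t" if "t > 0" for h t
    unfolding q_def using that by (intro cINF_lower bdd) auto
  have ge: "b \<le> q h" if "\<And>t. t > 0 \<Longrightarrow> b \<le> D h t" for b h
    unfolding q_def using that by (intro cINF_greatest) auto
  have "q (h + k) \<le> q h + q k" for h k
  proof -
    have *: "q (h + k) \<le> D h s + D k t" if "s > 0" "t > 0" for s t
      using le[of "s * t / (s + t)" "h + k"] combine[OF that, of h k] that by simp
    have "q (h + k) - q k \<le> D h s" if s: "s > 0" for s
    proof -
      have "q (h + k) - D h s \<le> q k"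
        by (rule ge) (use *[OF s] in \<open>simp add: algebra_simps\<close>)
      then show ?thesis by simp
    qed
    then have "q (h + k) - q k \<le> q h" by (rule ge)
    then show ?thesis by simp
  qed
  moreover have "q (c *\<^sub>R h) = c * q h" if "c \<ge> 0" for c h
  proof (cases "c = 0")
    case True
    then show ?thesis by (simp add: q_def D0)
  next
    case False
    then have c: "c > 0" using that by simp
    have scale: "D (c *\<^sub>R h) t = c * D h (c * t)" for t
      using c by (simp add: D_def mult.commute)
    show ?thesis
    proof (rule antisym)
      have "q (c *\<^sub>R h) / c \<le> q h"
      proof (rule ge)
        fix t :: real assume "t > 0"
        then show "q (c *\<^sub>R h) / c \<le> D h t"
          using le[of "t / c" "c *\<^sub>R h"] c by (simp add: scale field_simps)
      qed
      then show "q (c *\<^sub>R h) \<le> c * q h" using c by (simp add: field_simps)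
      show "c * q h \<le> q (c *\<^sub>R h)"
        by (rule ge) (use c le in \<open>simp add: scale\<close>)
    qed
  qed
  ultimately have "sublinear q" by (simp add: sublinear_def)
  from ex_linear_le_sublinear[OF this] obtain l where l: "linear l" "\<And>h. l h \<le> q h" by blast
  have "F x + l h \<le> F (x + h)" for h
    using l(2)[of h] le[of 1 h] by (simp add: D_def)
  then show ?thesis using l(1) by blast
qed

section \<open>The Riesz representation on compact Hausdorff spaces\<close>

lemma compact_Urysohn:
  fixes A B :: "'a::t2_space set"
  assumes "compact (UNIV :: 'a set)" "closed A" "closed B" "A \<inter> B = {}"
  obtains h :: "'a \<Rightarrow> real" where "continuous_on UNIV h" "\<And>x. 0 \<le> h x \<and> h x \<le> 1"
    "\<And>x. x \<in> A \<Longrightarrow> h x = 1" "\<And>x. x \<in> B \<Longrightarrow> h x = 0"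
proof -
  have "normal_space (euclidean :: 'a topology)"
    using assms(1) by (intro compact_Hausdorff_or_regular_imp_normal_space) (auto simp: compact_space_def Hausdorff_space_def separation_t2 disjnt_def)
  then obtain h where h: "continuous_map euclidean (top_of_set {0..1::real}) h"
      "h ` B \<subseteq> {0}" "h ` A \<subseteq> {1}"
    using Urysohn_lemma[of "euclidean :: 'a topology" B A 0 1] assms by (auto simp: disjnt_def)
  show ?thesis
    by (rule that[of h]) (use h in \<open>auto simp: continuous_map_in_subtopology\<close>)
qed

locale positive_functional =
  fixes I :: "('a::t2_space \<Rightarrow> real) \<Rightarrow> real"
  assumes compact_space: "compact (UNIV :: 'a set)"
    and add: "continuous_on UNIV f \<Longrightarrow> continuous_on UNIV g \<Longrightarrow> I (\<lambda>x. f x + g x) = I f + I g"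
    and scale: "continuous_on UNIV f \<Longrightarrow> I (\<lambda>x. c * f x) = c * I f"
    and nonneg: "continuous_on UNIV f \<Longrightarrow> (\<And>x. 0 \<le> f x) \<Longrightarrow> 0 \<le> I f"
begin

text \<open>
  Vanishing off \<open>U\<close> is easier to check than compact support inside \<open>U\<close>, and it leads to the same
  content, since functions can be shrunk to compact support at a small cost.
\<close>

definition subordinate :: "'a set \<Rightarrow> ('a \<Rightarrow> real) set" where
  "subordinate U = {f. continuous_on UNIV f \<and> (\<forall>x. 0 \<le> f x \<and> f x \<le> 1) \<and> (\<forall>x. x \<notin> U \<longrightarrow> f x = 0)}"

definition open_content :: "'a set \<Rightarrow> ennreal" where
  "open_content U = (SUP f\<in>subordinate U. ennreal (I f))"

definition outer_content :: "'a set \<Rightarrow> ennreal" where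
  "outer_content A = (INF U\<in>{U. open U \<and> A \<subseteq> U}. open_content U)"

definition representing_measure :: "'a measure" where
  "representing_measure = measure_of UNIV (sets borel) outer_content"

lemma mono:
  assumes "continuous_on UNIV f" "continuous_on UNIV g" "\<And>x. f x \<le> g x"
  shows "I f \<le> I g"
proof -
  have "I (\<lambda>x. f x + (g x - f x)) = I f + I (\<lambda>x. g x - f x)"
    using assms by (intro add continuous_intros)
  moreover have "0 \<le> I (\<lambda>x. g x - f x)"
    using assms by (intro nonneg continuous_intros) auto
  ultimately show ?thesis by simp
qed

lemma const: "I (\<lambda>x. c) = c * I (\<lambda>x. 1)"
  using scale[of "\<lambda>x. 1" c] by simp

lemma subordinate_mono: "U \<subseteq> V \<Longrightarrow> subordinate U \<subseteq> subordinate V"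
  by (auto simp: subordinate_def)

lemma zero_subordinate: "(\<lambda>x. 0) \<in> subordinate U"
  by (auto simp: subordinate_def)

lemma subordinate_nonneg: "f \<in> subordinate U \<Longrightarrow> 0 \<le> I f"
  by (auto simp: subordinate_def intro: nonneg)

lemma subordinate_le_content: "f \<in> subordinate U \<Longrightarrow> ennreal (I f) \<le> open_content U"
  by (auto simp: open_content_def intro: SUP_upper)

lemma open_content_mono: "U \<subseteq> V \<Longrightarrow> open_content U \<le> open_content V"
  unfolding open_content_def by (intro SUP_subset_mono subordinate_mono) auto

lemma open_content_empty: "open_content {} = 0"
proof -
  have "subordinate {} = {\<lambda>x. 0}" by (auto simp: subordinate_def)
  then show ?thesis using const[of 0] by (simp add: open_content_def)
qed

lemma open_content_UNIV: "open_content UNIV = ennreal (I (\<lambda>x. 1))"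
proof (rule antisym)
  show "open_content UNIV \<le> ennreal (I (\<lambda>x. 1))"
    unfolding open_content_def
    by (intro SUP_least ennreal_leI mono) (auto simp: subordinate_def)
  show "ennreal (I (\<lambda>x. 1)) \<le> open_content UNIV"
    by (intro subordinate_le_content) (auto simp: subordinate_def)
qed

text \<open>
  Subtracting a small constant and cutting off at zero pushes the support of \<open>f\<close> into a closed,
  hence compact, subset of the open set, at a small cost for the functional.
\<close>

lemma subordinate_shrink:
  assumes f: "f \<in> subordinate U" and e: "0 < e"
  obtains g K where "g \<in> subordinate K" "closed K" "K \<subseteq> U" "I f \<le> I g + e"
proof -
  define d where "d = e / (I (\<lambda>x. 1) + 1)"
  have I1: "0 \<le> I (\<lambda>x. 1)" by (intro nonneg) auto
  then have d: "0 < d" "d * I (\<lambda>x. 1) \<le> e"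
    using e by (auto simp: d_def field_simps)
  define g where "g x = max (f x - d) 0" for x
  define K where "K = {x. d \<le> f x}"
  have cf: "continuous_on UNIV f" using f by (simp add: subordinate_def)
  have cg: "continuous_on UNIV g" unfolding g_def by (intro continuous_intros cf)
  show ?thesis
  proof (rule that[of g K])
    show "g \<in> subordinate K"
      using f cg d by (auto simp: subordinate_def g_def K_def max_def) (smt (verit))
    show "closed K" unfolding K_def using cf by (intro closed_Collect_le) auto
    show "K \<subseteq> U" using f d by (force simp: subordinate_def K_def)
    have "I f \<le> I (\<lambda>x. g x + d)"
      using cf cg by (intro mono continuous_intros) (auto simp: g_def)
    also have "\<dots> = I g + d * I (\<lambda>x. 1)"
      using cg by (subst add) (auto simp: const[of d])
    finally show "I f \<le> I g + e" using d by simp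
  qed
qed

text \<open>
  After shrinking the support to a closed set \<open>K\<close>, a Urysohn function that is one on \<open>K - V\<close> and zero
  off \<open>U\<close> splits the function into a part subordinate to \<open>U\<close> and a part subordinate to \<open>V\<close>.
\<close>

lemma open_content_Un:
  assumes U: "open U" and V: "open V"
  shows "open_content (U \<union> V) \<le> open_content U + open_content V"
  unfolding open_content_def[of "U \<union> V"]
proof (rule SUP_least)
  fix f assume f: "f \<in> subordinate (U \<union> V)"
  show "ennreal (I f) \<le> open_content U + open_content V"
  proof (rule ennreal_le_epsilon)
    fix e :: real assume "0 < e"
    with f obtain g K where g: "g \<in> subordinate K" "closed K" "K \<subseteq> U \<union> V" "I f \<le> I g + e"
      by (rule subordinate_shrink)
    obtain h :: "'a \<Rightarrow> real" where h: "continuous_on UNIV h" "\<And>x. 0 \<le> h x \<and> h x \<le> 1"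
        "\<And>x. x \<in> K - V \<Longrightarrow> h x = 1" "\<And>x. x \<in> - U \<Longrightarrow> h x = 0"
      by (rule compact_Urysohn[OF compact_space, of "K - V" "- U"]) (use g U V in auto)
    have cg: "continuous_on UNIV g" and bg: "0 \<le> g x" "g x \<le> 1" and gK: "x \<notin> K \<Longrightarrow> g x = 0" for x
      using g(1) by (auto simp: subordinate_def)
    have hg: "(\<lambda>x. h x * g x) \<in> subordinate U"
      using h cg bg by (auto simp: subordinate_def intro!: continuous_intros mult_le_one)
    have "(1 - h x) * g x = 0" if "x \<notin> V" for x
      using gK[of x] h(3)[of x] that by (cases "x \<in> K") auto
    then have hg': "(\<lambda>x. (1 - h x) * g x) \<in> subordinate V"
      using h cg bg by (auto simp: subordinate_def intro!: continuous_intros mult_le_one)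
    have "I g = I (\<lambda>x. h x * g x + (1 - h x) * g x)" by (simp add: algebra_simps)
    also have "\<dots> = I (\<lambda>x. h x * g x) + I (\<lambda>x. (1 - h x) * g x)"
      by (intro add continuous_intros h cg)
    finally have "ennreal (I f) \<le> ennreal (I (\<lambda>x. h x * g x) + I (\<lambda>x. (1 - h x) * g x) + e)"
      using g(4) by (intro ennreal_leI) simp
    also have "\<dots> = ennreal (I (\<lambda>x. h x * g x)) + ennreal (I (\<lambda>x. (1 - h x) * g x)) + ennreal e"
      using subordinate_nonneg[OF hg] subordinate_nonneg[OF hg'] \<open>0 < e\<close> by simp
    also have "\<dots> \<le> open_content U + open_content V + ennreal e"
      by (intro add_mono subordinate_le_content hg hg' order_refl)
    finally show "ennreal (I f) \<le> open_content U + open_content V + ennreal e" .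
  qed
qed

lemma open_content_UN_lessThan:
  assumes "\<And>i. open (U i)"
  shows "open_content (\<Union>i<n::nat. U i) \<le> (\<Sum>i<n. open_content (U i))"
proof (induction n)
  case (Suc n)
  have "open_content (\<Union>i<Suc n. U i) \<le> open_content (U n) + open_content (\<Union>i<n. U i)"
    unfolding lessThan_Suc UN_insert using assms by (intro open_content_Un open_UN) auto
  also have "\<dots> \<le> open_content (U n) + (\<Sum>i<n. open_content (U i))"
    by (intro add_left_mono Suc)
  finally show ?case by (simp add: add.commute)
qed (simp add: open_content_empty)

lemma open_content_UN:
  fixes U :: "nat \<Rightarrow> 'a set"
  assumes U: "\<And>i. open (U i)"
  shows "open_content (\<Union>i. U i) \<le> (\<Sum>i. open_content (U i))"
  unfolding open_content_def[of "\<Union>i. U i"]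
proof (rule SUP_least)
  fix f assume f: "f \<in> subordinate (\<Union>i. U i)"
  show "ennreal (I f) \<le> (\<Sum>i. open_content (U i))"
  proof (rule ennreal_le_epsilon)
    fix e :: real assume e: "0 < e"
    with f obtain g K where g: "g \<in> subordinate K" "closed K" "K \<subseteq> (\<Union>i. U i)" "I f \<le> I g + e"
      by (rule subordinate_shrink)
    have "compact K" using compact_Int_closed[OF compact_space g(2)] by simp
    then obtain F where F: "finite F" "K \<subseteq> (\<Union>i\<in>F. U i)"
      using compactE_image[of K UNIV U] U g(3) by (metis (no_types))
    then obtain n where n: "F \<subseteq> {..<n}" using finite_nat_iff_bounded by blast
    have gn: "g \<in> subordinate (\<Union>i<n. U i)"
      using subordinate_mono[of K "\<Union>i<n. U i"] g(1) F n by blast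
    have "ennreal (I f) \<le> ennreal (I g + e)" using g(4) by (rule ennreal_leI)
    also have "\<dots> = ennreal (I g) + ennreal e"
      using subordinate_nonneg[OF g(1)] e by simp
    also have "ennreal (I g) \<le> open_content (\<Union>i<n. U i)" by (rule subordinate_le_content[OF gn])
    also have "\<dots> \<le> (\<Sum>i<n. open_content (U i))" by (rule open_content_UN_lessThan[OF U])
    also have "\<dots> \<le> (\<Sum>i. open_content (U i))" by (intro sum_le_suminf) auto
    finally show "ennreal (I f) \<le> (\<Sum>i. open_content (U i)) + ennreal e" by (simp add: add_right_mono)
  qed
qed

lemma outer_content_open: "open U \<Longrightarrow> outer_content U = open_content U"
  unfolding outer_content_def
  by (rule antisym) (auto intro: INF_lower INF_greatest open_content_mono)

lemma outer_content_mono: "A \<subseteq> B \<Longrightarrow> outer_content A \<le> outer_content B"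
  unfolding outer_content_def by (intro INF_superset_mono) auto

lemma outer_content_finite: "outer_content A < top"
proof -
  have "outer_content A \<le> open_content UNIV"
    using outer_content_mono[of A UNIV] by (simp add: outer_content_open)
  then show ?thesis by (simp add: open_content_UNIV le_less_trans)
qed

lemma outer_content_open_approx:
  assumes "0 < e"
  obtains U where "open U" "A \<subseteq> U" "open_content U \<le> outer_content A + ennreal e"
proof -
  have "outer_content A < outer_content A + ennreal e"
    using outer_content_finite[of A] assms by (simp add: ennreal_add_less_top less_top)
  then show ?thesis
    by (subst (asm) (1) outer_content_def) (auto simp: INF_less_iff intro: that less_imp_le)
qed

lemma outer_content_UN:
  fixes A :: "nat \<Rightarrow> 'a set"
  shows "outer_content (\<Union>i. A i) \<le> (\<Sum>i. outer_content (A i))"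
proof (rule ennreal_le_epsilon)
  fix e :: real assume e: "0 < e"
  have "\<exists>U. open U \<and> A i \<subseteq> U \<and> open_content U \<le> outer_content (A i) + ennreal (e * (1/2) ^ Suc i)" for i
    by (rule outer_content_open_approx[of "e * (1/2) ^ Suc i" "A i"]) (use e in auto)
  then obtain U where U: "\<And>i. open (U i)" "\<And>i. A i \<subseteq> U i"
      "\<And>i. open_content (U i) \<le> outer_content (A i) + ennreal (e * (1/2) ^ Suc i)"
    by metis
  have "outer_content (\<Union>i. A i) \<le> outer_content (\<Union>i. U i)"
    using U(2) by (intro outer_content_mono) blast
  also have "\<dots> = open_content (\<Union>i. U i)" using U(1) by (intro outer_content_open) auto
  also have "\<dots> \<le> (\<Sum>i. open_content (U i))" by (rule open_content_UN[OF U(1)])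
  also have "\<dots> \<le> (\<Sum>i. outer_content (A i) + ennreal (e * (1/2) ^ Suc i))"
    by (intro suminf_le U(3)) auto
  also have "\<dots> = (\<Sum>i. outer_content (A i)) + (\<Sum>i. ennreal (e * (1/2) ^ Suc i))"
    by (intro suminf_add[symmetric]) auto
  also have "(\<Sum>i. ennreal (e * (1/2) ^ Suc i)) = ennreal e"
    using sums_mult[OF power_half_series, of e] e by (intro suminf_ennreal_eq) auto
  finally show "outer_content (\<Union>i. A i) \<le> (\<Sum>i. outer_content (A i)) + ennreal e" .
qed

lemma outer_measure_space_outer_content: "outer_measure_space (Pow UNIV) outer_content"
  unfolding outer_measure_space_def positive_def increasing_def countably_subadditive_def
  by (auto simp: outer_content_open open_content_empty outer_content_mono outer_content_UN)

text \<open>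
  A function subordinate to \<open>U \<inter> V\<close>, once shrunk to a compact set \<open>K\<close>, can be added to any function
  subordinate to \<open>U - K\<close> without exceeding one.
\<close>

lemma open_content_split:
  assumes U: "open U" and V: "open V"
  shows "open_content (U \<inter> V) + outer_content (U - V) \<le> open_content U"
proof -
  have "ennreal (I f) + outer_content (U - V) \<le> open_content U" if f: "f \<in> subordinate (U \<inter> V)" for f
  proof (rule ennreal_le_epsilon)
    fix e :: real assume e: "0 < e"
    with f obtain g K where g: "g \<in> subordinate K" "closed K" "K \<subseteq> U \<inter> V" "I f \<le> I g + e"
      by (rule subordinate_shrink)
    have "ennreal (I g) + ennreal (I h) \<le> open_content U" if h: "h \<in> subordinate (U - K)" for h
    proof -
      have "(\<lambda>x. g x + h x) \<in> subordinate U"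
      proof -
        have "0 \<le> g x + h x \<and> g x + h x \<le> 1 \<and> (x \<notin> U \<longrightarrow> g x + h x = 0)" for x
          using g(1,3) h by (cases "x \<in> K") (auto simp: subordinate_def)
        then show ?thesis
          using g(1) h by (auto simp: subordinate_def intro!: continuous_intros)
      qed
      then have "ennreal (I (\<lambda>x. g x + h x)) \<le> open_content U" by (rule subordinate_le_content)
      moreover have "I (\<lambda>x. g x + h x) = I g + I h"
        using g(1) h by (intro add) (auto simp: subordinate_def)
      ultimately show ?thesis
        using subordinate_nonneg[OF g(1)] subordinate_nonneg[OF h] by simp
    qed
    then have "(SUP h\<in>subordinate (U - K). ennreal (I g) + ennreal (I h)) \<le> open_content U"
      by (rule SUP_least)
    then have "ennreal (I g) + open_content (U - K) \<le> open_content U"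
      unfolding open_content_def[of "U - K"] using zero_subordinate[of "U - K"]
      by (subst ennreal_SUP_add_right) auto
    moreover have "outer_content (U - V) \<le> open_content (U - K)"
      using outer_content_mono[of "U - V" "U - K"] outer_content_open[OF open_Diff[OF U g(2)]] g(3)
      by (simp add: Diff_mono)
    ultimately have *: "ennreal (I g) + outer_content (U - V) \<le> open_content U"
      by (meson add_left_mono order_trans)
    have "ennreal (I f) \<le> ennreal (I g + e)" using g(4) by (rule ennreal_leI)
    also have "\<dots> = ennreal (I g) + ennreal e"
      using subordinate_nonneg[OF g(1)] e by simp
    finally have "ennreal (I f) + outer_content (U - V)
        \<le> (ennreal (I g) + outer_content (U - V)) + ennreal e"
      by (simp add: add_right_mono ac_simps)
    also have "\<dots> \<le> open_content U + ennreal e" using * by (rule add_right_mono)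
    finally show "ennreal (I f) + outer_content (U - V) \<le> open_content U + ennreal e" .
  qed
  then show ?thesis
    unfolding open_content_def[of "U \<inter> V"] using zero_subordinate[of "U \<inter> V"]
    by (subst ennreal_SUP_add_left[symmetric]) (auto intro!: SUP_least)
qed

lemma open_in_lambda_system:
  assumes V: "open V"
  shows "V \<in> lambda_system UNIV (Pow UNIV) outer_content"
proof -
  have "outer_content (V \<inter> E) + outer_content ((UNIV - V) \<inter> E) = outer_content E" for E
  proof (rule antisym)
    have "outer_content (V \<inter> E) + outer_content ((UNIV - V) \<inter> E) \<le> open_content U" if U: "open U" "E \<subseteq> U" for U
    proof -
      have "outer_content (V \<inter> E) \<le> open_content (U \<inter> V)"
        using outer_content_mono[of "V \<inter> E" "U \<inter> V"] outer_content_open[OF open_Int[OF U(1) V]] U(2)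
        by fastforce
      moreover have "outer_content ((UNIV - V) \<inter> E) \<le> outer_content (U - V)"
        using U by (intro outer_content_mono) auto
      ultimately show ?thesis
        using open_content_split[OF U(1) V] by (meson add_mono order_trans)
    qed
    then show "outer_content (V \<inter> E) + outer_content ((UNIV - V) \<inter> E) \<le> outer_content E"
      unfolding outer_content_def[of E] by (auto intro: INF_greatest)
    have "subadditive (Pow UNIV) outer_content"
      using outer_measure_space_outer_content
      by (intro ring_of_sets.countably_subadditive_subadditive[OF algebra.axioms(1), of UNIV] algebra_Pow)
        (auto simp: outer_measure_space_def)
    then have union: "outer_content (A \<union> B) \<le> outer_content A + outer_content B" if "A \<inter> B = {}" for A B
      using that by (simp add: subadditive_def)
    have "outer_content ((V \<inter> E) \<union> ((UNIV - V) \<inter> E))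
        \<le> outer_content (V \<inter> E) + outer_content ((UNIV - V) \<inter> E)"
      by (rule union) blast
    moreover have "(V \<inter> E) \<union> ((UNIV - V) \<inter> E) = E" by blast
    ultimately show "outer_content E \<le> outer_content (V \<inter> E) + outer_content ((UNIV - V) \<inter> E)"
      by simp
  qed
  then show ?thesis by (simp add: lambda_system_def)
qed

lemma sets_representing_measure [simp]: "sets representing_measure = sets borel"
  using sets.sigma_sets_eq[of borel] by (simp add: representing_measure_def)

lemma space_representing_measure [simp]: "space representing_measure = UNIV"
  by (simp add: representing_measure_def)

lemma emeasure_representing_measure:
  assumes A: "A \<in> sets borel"
  shows "emeasure representing_measure A = outer_content A"
  unfolding representing_measure_def
proof (rule emeasure_measure_of_sigma)
  interpret P: sigma_algebra "UNIV :: 'a set" "Pow UNIV" by (rule sigma_algebra_Pow)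
  let ?L = "lambda_system UNIV (Pow UNIV) outer_content"
  have ms: "measure_space UNIV ?L outer_content"
    by (rule P.caratheodory_lemma[OF outer_measure_space_outer_content])
  then interpret L: sigma_algebra UNIV ?L by (simp add: measure_space_def)
  have sub: "sets borel \<subseteq> ?L"
    unfolding sets_borel by (rule L.sigma_sets_subset) (use open_in_lambda_system in auto)
  show "sigma_algebra UNIV (sets borel :: 'a set set)"
    using sets.sigma_algebra_axioms[of "borel :: 'a measure"] by simp
  show "positive (sets borel) outer_content" "countably_additive (sets borel) outer_content"
    using ms sub unfolding measure_space_def positive_def countably_additive_def by blast+
qed (rule A)

lemma emeasure_open: "open U \<Longrightarrow> emeasure representing_measure U = open_content U"
  by (simp add: emeasure_representing_measure outer_content_open)

lemma finite_representing_measure: "finite_measure representing_measure"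
  by (rule finite_measureI) (simp add: emeasure_open open_content_UNIV)

lemma measure_space_representing: "measure representing_measure UNIV = I (\<lambda>x. 1)"
  by (simp add: measure_def emeasure_open open_content_UNIV nonneg)

lemma regular_representing_measure: "regular_borel_measure representing_measure"
proof -
  interpret finite_measure representing_measure by (rule finite_representing_measure)
  let ?m = "emeasure representing_measure"
  have outer: "?m A = (INF U\<in>{U. open U \<and> A \<subseteq> U}. ?m U)" if "A \<in> sets borel" for A
    unfolding emeasure_representing_measure[OF that] outer_content_def
    by (intro INF_cong) (auto simp: emeasure_open)
  have inner: "?m A = (SUP K\<in>{K. compact K \<and> K \<in> sets borel \<and> K \<subseteq> A}. ?m K)"
    if A: "A \<in> sets borel" for A
  proof (rule antisym)
    show "?m A \<le> (SUP K\<in>{K. compact K \<and> K \<in> sets borel \<and> K \<subseteq> A}. ?m K)" (is "_ \<le> ?s")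
    proof (rule ennreal_le_epsilon)
      fix e :: real assume "0 < e"
      then obtain U where U: "open U" "- A \<subseteq> U" "open_content U \<le> outer_content (- A) + ennreal e"
        by (rule outer_content_open_approx)
      have K: "compact (- U)" "- U \<in> sets borel" "- U \<subseteq> A"
        using compact_Int_closed[OF compact_space, of "- U"] U by auto
      have cA: "- A \<in> sets borel" using A by auto
      have "?m A + ?m (- A) = ?m UNIV" "?m (- U) + ?m U = ?m UNIV"
        using A cA K(2) U(1) by (subst plus_emeasure; auto simp: Un_commute)+
      then have "?m A + ?m (- A) = ?m (- U) + ?m U" by simp
      also have "?m U \<le> ?m (- A) + ennreal e"
        using U cA by (simp add: emeasure_open emeasure_representing_measure)
      finally have "?m (- A) + ?m A \<le> ?m (- A) + (?m (- U) + ennreal e)"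
        by (simp add: ac_simps)
      then have "?m A \<le> ?m (- U) + ennreal e"
        by (subst (asm) ennreal_add_left_cancel_le) (auto simp: emeasure_eq_measure)
      also have "?m (- U) \<le> ?s" using K by (intro SUP_upper) auto
      finally show "?m A \<le> ?s + ennreal e" by (simp add: add_right_mono)
    qed
    show "?s \<le> ?m A" using A by (intro SUP_least emeasure_mono) auto
  qed
  show ?thesis
    unfolding regular_borel_measure_def using inner outer by auto
qed

text \<open>
  The level-set decomposition \<open>n f = \<Sum>k<n. min (max (n f - k) 0) 1\<close> compares both sides with the
  measures of the sets \<open>{n f > k}\<close>; consecutive sets telescope, so that the error is a single
  \<open>1/n\<close> of the total mass.
\<close>

lemma functional_le_integral:
  assumes f: "continuous_on UNIV f" "\<And>x. 0 \<le> f x \<and> f x \<le> 1"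
  shows "I f \<le> (LINT x|representing_measure. f x)"
proof -
  let ?M = representing_measure
  interpret finite_measure ?M by (rule finite_representing_measure)
  have meas: "g \<in> borel_measurable ?M" if "continuous_on UNIV g" for g :: "'a \<Rightarrow> real"
    using that measurable_cong_sets[OF sets_representing_measure refl]
    by (auto intro: borel_measurable_continuous_onI)
  have int: "integrable ?M g" if "continuous_on UNIV g" "\<And>x. norm (g x) \<le> 1" for g :: "'a \<Rightarrow> real"
    using that meas by (intro integrable_const_bound[of _ 1]) auto
  have main: "real n * I f \<le> real n * (LINT x|?M. f x) + measure ?M UNIV" for n
  proof -
    define s where "s k x = min (max (real n * f x - real k) 0) 1" for k x
    define E where "E k = {x. real k < real n * f x}" for k
    have cs: "continuous_on UNIV (s k)" for k unfolding s_def by (intro continuous_intros f(1))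
    have openE: "open (E k)" for k unfolding E_def using f(1) by (intro open_Collect_less continuous_intros) auto
    have s_bd: "0 \<le> s k x" "s k x \<le> 1" for k x by (auto simp: s_def)
    have sum_s: "(\<Sum>k<m. s k x) = min (real m) (real n * f x)" for m x
      using f(2)[of x] by (induction m) (auto simp: s_def min_def max_def mult_nonneg_nonneg)
    have sum_n: "(\<Sum>k<n. s k x) = real n * f x" for x
      using f(2)[of x] by (simp add: sum_s mult_left_le min_absorb2)
    have Is: "I (s k) \<le> measure ?M (E k)" for k
    proof -
      have "s k \<in> subordinate (E k)"
        using cs s_bd by (auto simp: subordinate_def s_def E_def)
      from subordinate_le_content[OF this] show ?thesis
        by (simp add: emeasure_open[OF openE, symmetric] emeasure_eq_measure)
    qed
    have int_s: "measure ?M (E (Suc k)) \<le> (LINT x|?M. s k x)" for k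
    proof -
      have "measure ?M (E (Suc k)) = (LINT x|?M. indicator (E (Suc k)) x)"
        using openE by simp
      also have "\<dots> \<le> (LINT x|?M. s k x)"
      proof (rule integral_mono)
        show "integrable ?M (indicator (E (Suc k)) :: 'a \<Rightarrow> real)"
          using openE by (intro integrable_real_indicator) (auto simp: emeasure_eq_measure)
        show "integrable ?M (s k)" using s_bd cs by (intro int) auto
      qed (auto simp: indicator_def s_def E_def)
      finally show ?thesis .
    qed
    have I_sum: "I (\<lambda>x. \<Sum>k<m. s k x) = (\<Sum>k<m. I (s k))" for m
    proof (induction m)
      case (Suc m)
      have "I (\<lambda>x. (\<Sum>k<m. s k x) + s m x) = I (\<lambda>x. \<Sum>k<m. s k x) + I (s m)"
        by (intro add continuous_intros cs)
      then show ?case using Suc by simp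
    qed (simp add: const[of 0])
    have "real n * I f = (\<Sum>k<n. I (s k))"
      using I_sum[of n] scale[OF f(1), of "real n"] by (simp add: sum_n)
    also have "\<dots> \<le> (\<Sum>k<n. measure ?M (E k))" by (intro sum_mono Is)
    also have "\<dots> \<le> (\<Sum>k<Suc n. measure ?M (E k))" by simp
    also have "\<dots> = measure ?M (E 0) + (\<Sum>k<n. measure ?M (E (Suc k)))"
      by (rule sum.lessThan_Suc_shift)
    also have "\<dots> \<le> measure ?M UNIV + (\<Sum>k<n. LINT x|?M. s k x)"
      by (intro add_mono sum_mono int_s finite_measure_mono) auto
    also have "(\<Sum>k<n. LINT x|?M. s k x) = (LINT x|?M. (\<Sum>k<n. s k x))"
      using cs s_bd by (intro Bochner_Integration.integral_sum[symmetric] int) auto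
    also have "\<dots> = real n * (LINT x|?M. f x)" by (simp add: sum_n)
    finally show ?thesis by simp
  qed
  show ?thesis
  proof (rule ccontr)
    assume "\<not> I f \<le> (LINT x|?M. f x)"
    then have pos: "0 < I f - (LINT x|?M. f x)" by simp
    obtain n where "measure ?M UNIV < real n * (I f - (LINT x|?M. f x))"
      using reals_Archimedean3[OF pos] by blast
    with main[of n] show False by (simp add: algebra_simps)
  qed
qed

theorem integral_representing_measure:
  assumes f: "continuous_on UNIV f"
  shows "(LINT x|representing_measure. f x) = I f"
proof -
  let ?M = representing_measure
  interpret finite_measure ?M by (rule finite_representing_measure)
  have int: "integrable ?M g" if g: "continuous_on UNIV g" "\<And>x. 0 \<le> g x \<and> g x \<le> 1" for g :: "'a \<Rightarrow> real"
  proof (rule integrable_const_bound[of _ 1])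
    show "g \<in> borel_measurable ?M"
      using g measurable_cong_sets[OF sets_representing_measure refl]
      by (auto intro: borel_measurable_continuous_onI)
  qed (use g in auto)
  have unit: "(LINT x|?M. g x) = I g" if g: "continuous_on UNIV g" "\<And>x. 0 \<le> g x \<and> g x \<le> 1" for g
  proof (rule antisym)
    show "I g \<le> (LINT x|?M. g x)" by (rule functional_le_integral[OF g])
    have "I (\<lambda>x. 1 - g x) \<le> (LINT x|?M. 1 - g x)"
      by (rule functional_le_integral) (use g in \<open>auto intro!: continuous_intros\<close>)
    moreover have "I (\<lambda>x. 1 - g x) = I (\<lambda>x. 1) - I g"
      using add[of "\<lambda>x. 1 - g x" g] g(1) continuous_on_diff[OF continuous_on_const g(1), of 1] by simp
    moreover have "(LINT x|?M. 1 - g x) = I (\<lambda>x. 1) - (LINT x|?M. g x)"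
      using int[OF g] by (simp add: measure_space_representing)
    ultimately show "(LINT x|?M. g x) \<le> I g" by simp
  qed
  have "bounded (f ` UNIV)"
    using compact_continuous_image[OF f compact_space] by (rule compact_imp_bounded)
  then obtain b where b: "b > 0" "\<And>x. \<bar>f x\<bar> \<le> b"
    unfolding bounded_pos by auto
  define g where "g x = (f x + b) / (2 * b)" for x
  have g: "continuous_on UNIV g" "\<And>x. 0 \<le> g x \<and> g x \<le> 1"
    using b(1) b(2) unfolding g_def by (auto intro!: continuous_intros f simp: field_simps abs_le_iff)
      (smt (verit))+
  have f_eq: "f = (\<lambda>x. 2 * b * g x + (- b))" using b(1) by (auto simp: g_def)
  have "I f = I (\<lambda>x. 2 * b * g x) + I (\<lambda>x. - b)"
    by (subst f_eq) (intro add continuous_intros g)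
  also have "\<dots> = 2 * b * I g + (- b) * I (\<lambda>x. 1)"
    using scale[OF g(1)] const[of "- b"] by simp
  also have "\<dots> = (LINT x|?M. 2 * b * g x + (- b))"
    using int[OF g] by (simp add: unit[OF g] measure_space_representing)
  finally have "I f = (LINT x|?M. 2 * b * g x + (- b))" .
  moreover have "(LINT x|?M. f x) = (LINT x|?M. 2 * b * g x + (- b))"
    by (subst (1) f_eq) (rule refl)
  ultimately show ?thesis by simp
qed

text \<open>
  Since \<open>f \<circ> \<alpha>\<close> is subordinate to the preimage of \<open>U\<close> when \<open>f\<close> is subordinate to \<open>U\<close>, invariance of
  the functional makes preimages of open sets at least as large, and those of closed sets at most
  as large. Inner regularity of the measure on the preimage extends the latter to all Borel sets,
  and complementation gives equality.
\<close>

theorem distr_representing_measure: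
  assumes \<alpha>: "continuous_on UNIV \<alpha>"
    and inv: "\<And>f. continuous_on UNIV f \<Longrightarrow> I (\<lambda>x. f (\<alpha> x)) = I f"
  shows "distr representing_measure borel \<alpha> = representing_measure"
proof -
  let ?M = representing_measure
  interpret finite_measure ?M by (rule finite_representing_measure)
  have meas: "\<alpha> \<in> measurable ?M borel"
    using borel_measurable_continuous_onI[OF \<alpha>] measurable_cong_sets[OF sets_representing_measure refl]
    by blast
  have vimage: "\<alpha> -` A \<in> sets borel" if "A \<in> sets borel" for A
    using measurable_sets[OF meas that] by simp
  have le_open: "measure ?M U \<le> measure ?M (\<alpha> -` U)" if U: "open U" for U
  proof -
    have "open_content U \<le> open_content (\<alpha> -` U)"
      unfolding open_content_def[of U]
    proof (rule SUP_least)
      fix f assume f: "f \<in> subordinate U"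
      then have "(\<lambda>x. f (\<alpha> x)) \<in> subordinate (\<alpha> -` U)"
        using \<alpha> by (auto simp: subordinate_def intro: continuous_on_compose2)
      from subordinate_le_content[OF this] show "ennreal (I f) \<le> open_content (\<alpha> -` U)"
        using f inv by (simp add: subordinate_def)
    qed
    moreover have "open (\<alpha> -` U)" using \<alpha> U by (simp add: continuous_on_open_vimage)
    ultimately show ?thesis
      using U by (simp add: emeasure_open[symmetric] emeasure_eq_measure)
  qed
  have le_closed: "measure ?M (\<alpha> -` C) \<le> measure ?M C" if C: "closed C" for C
  proof -
    have "measure ?M (- C) \<le> measure ?M (\<alpha> -` (- C))" using C by (intro le_open) auto
    moreover have "measure ?M (- C) = measure ?M UNIV - measure ?M C"
      using finite_measure_compl[of C] C by (simp add: Compl_eq_Diff_UNIV)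
    moreover have "measure ?M (\<alpha> -` (- C)) = measure ?M UNIV - measure ?M (\<alpha> -` C)"
      using finite_measure_compl[of "\<alpha> -` C"] C vimage[of C] by (simp add: Compl_eq_Diff_UNIV vimage_Diff)
    ultimately show ?thesis by simp
  qed
  have le: "measure ?M (\<alpha> -` A) \<le> measure ?M A" if A: "A \<in> sets borel" for A
  proof -
    have "emeasure ?M (\<alpha> -` A) = (SUP K\<in>{K. compact K \<and> K \<in> sets borel \<and> K \<subseteq> \<alpha> -` A}. emeasure ?M K)"
      using regular_representing_measure vimage[OF A] by (auto simp: regular_borel_measure_def)
    also have "\<dots> \<le> emeasure ?M A"
    proof (rule SUP_least)
      fix K assume K: "K \<in> {K. compact K \<and> K \<in> sets borel \<and> K \<subseteq> \<alpha> -` A}"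
      have cl: "closed (\<alpha> ` K)"
        using K \<alpha> by (intro compact_imp_closed compact_continuous_image) (auto intro: continuous_on_subset)
      have "measure ?M K \<le> measure ?M (\<alpha> -` (\<alpha> ` K))"
        using vimage[of "\<alpha> ` K"] cl by (intro finite_measure_mono) auto
      also have "\<dots> \<le> measure ?M (\<alpha> ` K)" by (rule le_closed[OF cl])
      also have "\<dots> \<le> measure ?M A"
        using K A by (intro finite_measure_mono) auto
      finally show "emeasure ?M K \<le> emeasure ?M A" by (simp add: emeasure_eq_measure)
    qed
    finally show ?thesis by (simp add: emeasure_eq_measure)
  qed
  show ?thesis
  proof (rule measure_eqI)
    fix A assume "A \<in> sets (distr ?M borel \<alpha>)"
    then have A: "A \<in> sets borel" by simp
    have "measure ?M (\<alpha> -` (- A)) \<le> measure ?M (- A)" using A by (intro le) auto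
    moreover have "measure ?M (- A) = measure ?M UNIV - measure ?M A"
      using finite_measure_compl[of A] A by (simp add: Compl_eq_Diff_UNIV)
    moreover have "measure ?M (\<alpha> -` (- A)) = measure ?M UNIV - measure ?M (\<alpha> -` A)"
      using finite_measure_compl[of "\<alpha> -` A"] vimage[OF A] by (simp add: Compl_eq_Diff_UNIV vimage_Diff)
    ultimately have "measure ?M (\<alpha> -` A) = measure ?M A" using le[OF A] by simp
    then show "emeasure (distr ?M borel \<alpha>) A = emeasure ?M A"
      using meas A by (simp add: emeasure_distr emeasure_eq_measure)
  qed simp
qed

end

section \<open>Lebesgue spaces\<close>

lemma powr_convex_combination:
  fixes s t \<theta> p :: real
  assumes p: "1 \<le> p" and "0 \<le> s" "0 \<le> t" and \<theta>: "0 < \<theta>" "\<theta> < 1"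
  shows "(\<theta> * s + (1 - \<theta>) * t) powr p \<le> \<theta> * s powr p + (1 - \<theta>) * t powr p"
proof -
  have le: "c powr p \<le> c" if "0 < c" "c < 1" for c :: real
    using powr_mono'[of 1 p c] that p by simp
  consider "0 < s" "0 < t" | "s = 0" | "t = 0" using assms by linarith
  then show ?thesis
  proof cases
    case 1
    then show ?thesis
      using convex_onD[OF powr_convex[OF p], of "1 - \<theta>" s t] \<theta> by simp
  next
    case 2
    then show ?thesis
      using le[of "1 - \<theta>"] assms by (simp add: powr_mult mult_right_mono)
  next
    case 3
    then show ?thesis
      using le[of \<theta>] assms by (simp add: powr_mult mult_right_mono)
  qed
qed

lemma lp_space_measurable: "u \<in> lp_space p M \<Longrightarrow> u \<in> borel_measurable M"
  by (simp add: lp_space_def)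

lemma lp_norm_nonneg: "0 \<le> lp_norm p M u"
  by (simp add: lp_norm_def)

lemma nn_integral_lp_space:
  assumes "1 \<le> p" and u: "u \<in> lp_space p M"
  shows "(\<integral>\<^sup>+x. ennreal (norm (u x) powr p) \<partial>M) = ennreal (lp_norm p M u powr p)"
proof -
  have "(\<integral>\<^sup>+x. ennreal (norm (u x) powr p) \<partial>M) = ennreal (LINT x|M. norm (u x) powr p)"
    using u by (intro nn_integral_eq_integral) (auto simp: lp_space_def)
  then show ?thesis
    using assms(1) by (simp add: lp_norm_def powr_powr)
qed

lemma lp_space_normI:
  assumes p: "1 \<le> p" and u: "u \<in> borel_measurable M" and c: "0 \<le> c"
    and le: "(\<integral>\<^sup>+x. ennreal (norm (u x) powr p) \<partial>M) \<le> ennreal (c powr p)"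
  shows "u \<in> lp_space p M" and "lp_norm p M u \<le> c"
proof -
  have "integrable M (\<lambda>x. norm (u x) powr p)"
    using le u by (intro integrableI_nonneg) (auto intro: le_less_trans)
  then show lp: "u \<in> lp_space p M" using u by (simp add: lp_space_def)
  have "lp_norm p M u powr p \<le> c powr p"
    using le nn_integral_lp_space[OF p lp] by simp
  then show "lp_norm p M u \<le> c"
    using p c lp_norm_nonneg[of p M u] by (metis less_eq_real_def linorder_not_le powr_less_mono2 zero_less_one less_le_trans)
qed

lemma lp_space_dominated:
  assumes p: "1 \<le> p" and v: "v \<in> lp_space p M" and u: "u \<in> borel_measurable M"
    and le: "AE x in M. norm (u x) \<le> norm (v x)"
  shows "u \<in> lp_space p M" and "lp_norm p M u \<le> lp_norm p M v"
proof -
  have "(\<integral>\<^sup>+x. ennreal (norm (u x) powr p) \<partial>M) \<le> (\<integral>\<^sup>+x. ennreal (norm (v x) powr p) \<partial>M)"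
    using le p by (intro nn_integral_mono_AE) (auto elim!: eventually_mono intro!: ennreal_leI powr_mono2)
  then show "u \<in> lp_space p M" "lp_norm p M u \<le> lp_norm p M v"
    using lp_space_normI[OF p u lp_norm_nonneg[of p M v]] by (simp_all add: nn_integral_lp_space[OF p v])
qed

lemma lp_space_scale:
  assumes p: "1 \<le> p" and u: "u \<in> lp_space p M"
  shows "(\<lambda>x. c * u x) \<in> lp_space p M" and "lp_norm p M (\<lambda>x. c * u x) \<le> norm c * lp_norm p M u"
proof -
  note [measurable] = lp_space_measurable[OF u]
  have "(\<integral>\<^sup>+x. ennreal (norm (c * u x) powr p) \<partial>M)
      = (\<integral>\<^sup>+x. ennreal (norm c powr p) * ennreal (norm (u x) powr p) \<partial>M)"
    by (intro nn_integral_cong) (simp add: norm_mult powr_mult ennreal_mult)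
  also have "\<dots> = ennreal (norm c powr p) * ennreal (lp_norm p M u powr p)"
    by (subst nn_integral_cmult) (simp_all add: nn_integral_lp_space[OF p u])
  also have "\<dots> = ennreal ((norm c * lp_norm p M u) powr p)"
    using lp_norm_nonneg[of p M u] by (simp add: powr_mult ennreal_mult)
  finally have "(\<integral>\<^sup>+x. ennreal (norm (c * u x) powr p) \<partial>M) \<le> ennreal ((norm c * lp_norm p M u) powr p)"
    by simp
  from lp_space_normI[OF p _ _ this]
  show "(\<lambda>x. c * u x) \<in> lp_space p M" "lp_norm p M (\<lambda>x. c * u x) \<le> norm c * lp_norm p M u"
    using lp_norm_nonneg[of p M u] by simp_all
qed

text \<open>
  Minkowski's inequality: normalise both functions and apply convexity of the \<open>p\<close>-th power with
  weights proportional to the norms. The norms are enlarged slightly so that neither is zero.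
\<close>

lemma lp_space_add:
  assumes p: "1 \<le> p" and u: "u \<in> lp_space p M" and v: "v \<in> lp_space p M"
  shows "(\<lambda>x. u x + v x) \<in> lp_space p M"
    and "lp_norm p M (\<lambda>x. u x + v x) \<le> lp_norm p M u + lp_norm p M v"
proof -
  note [measurable] = lp_space_measurable[OF u] lp_space_measurable[OF v]
  have bound: "(\<lambda>x. u x + v x) \<in> lp_space p M \<and> lp_norm p M (\<lambda>x. u x + v x) \<le> a + b"
    if a: "0 < a" "lp_norm p M u \<le> a" and b: "0 < b" "lp_norm p M v \<le> b" for a b
  proof -
    define \<theta> where "\<theta> = a / (a + b)"
    have \<theta>: "0 < \<theta>" "\<theta> < 1" "1 - \<theta> = b / (a + b)" using a b by (auto simp: \<theta>_def field_simps)
    define A where "A = (a + b) powr p * (\<theta> / a powr p)"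
    define B where "B = (a + b) powr p * ((1 - \<theta>) / b powr p)"
    have AB: "0 \<le> A" "0 \<le> B" using \<theta> a b by (auto simp: A_def B_def)
    have pw: "norm (u x + v x) powr p \<le> A * norm (u x) powr p + B * norm (v x) powr p" for x
    proof -
      have "norm (u x + v x) \<le> (a + b) * (\<theta> * (norm (u x) / a) + (1 - \<theta>) * (norm (v x) / b))"
      proof -
        have "(a + b) * (\<theta> * (norm (u x) / a) + (1 - \<theta>) * (norm (v x) / b)) = norm (u x) + norm (v x)"
          using a(1) b(1) unfolding \<theta>(3) by (simp add: \<theta>_def distrib_left)
        then show ?thesis using norm_triangle_ineq[of "u x" "v x"] by simp
      qed
      then have "norm (u x + v x) powr p
          \<le> ((a + b) * (\<theta> * (norm (u x) / a) + (1 - \<theta>) * (norm (v x) / b))) powr p"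
        using p by (intro powr_mono2) auto
      also have "\<dots> = (a + b) powr p * (\<theta> * (norm (u x) / a) + (1 - \<theta>) * (norm (v x) / b)) powr p"
        using a b \<theta> by (intro powr_mult; simp)
      also have "\<dots> \<le> (a + b) powr p * (\<theta> * (norm (u x) / a) powr p + (1 - \<theta>) * (norm (v x) / b) powr p)"
        using a b \<theta> p by (intro mult_left_mono powr_convex_combination) auto
      also have "\<dots> = A * norm (u x) powr p + B * norm (v x) powr p"
        using a b by (simp add: A_def B_def powr_divide algebra_simps)
      finally show ?thesis .
    qed
    have "(\<integral>\<^sup>+x. ennreal (norm (u x + v x) powr p) \<partial>M)
        \<le> (\<integral>\<^sup>+x. ennreal A * ennreal (norm (u x) powr p) + ennreal B * ennreal (norm (v x) powr p) \<partial>M)"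
      using AB pw by (intro nn_integral_mono) (simp flip: ennreal_mult ennreal_plus)
    also have "\<dots> = ennreal A * ennreal (lp_norm p M u powr p) + ennreal B * ennreal (lp_norm p M v powr p)"
      by (subst nn_integral_add) (simp_all add: nn_integral_cmult nn_integral_lp_space[OF p u] nn_integral_lp_space[OF p v])
    also have "\<dots> \<le> ennreal A * ennreal (a powr p) + ennreal B * ennreal (b powr p)"
      using a b p lp_norm_nonneg[of p M] by (intro add_mono mult_left_mono ennreal_leI powr_mono2) auto
    also have "\<dots> = ennreal (A * a powr p + B * b powr p)"
      using AB by (simp add: ennreal_mult)
    also have "A * a powr p + B * b powr p = (a + b) powr p"
      using a(1) b(1) by (simp add: A_def B_def flip: distrib_left)
    finally show ?thesis
      using a b by (intro conjI lp_space_normI[OF p]) auto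
  qed
  have eps: "(\<lambda>x. u x + v x) \<in> lp_space p M \<and>
      lp_norm p M (\<lambda>x. u x + v x) \<le> lp_norm p M u + e / 2 + (lp_norm p M v + e / 2)" if "0 < e" for e
    using that lp_norm_nonneg[of p M u] lp_norm_nonneg[of p M v] by (intro bound) auto
  show "(\<lambda>x. u x + v x) \<in> lp_space p M" using eps[of 1] by simp
  show "lp_norm p M (\<lambda>x. u x + v x) \<le> lp_norm p M u + lp_norm p M v"
    by (rule field_le_epsilon) (use eps in \<open>simp add: algebra_simps\<close>)
qed

lemma lp_space_diff:
  assumes p: "1 \<le> p" and u: "u \<in> lp_space p M" and v: "v \<in> lp_space p M"
  shows "(\<lambda>x. u x - v x) \<in> lp_space p M"
    and "lp_norm p M (\<lambda>x. u x - v x) \<le> lp_norm p M u + lp_norm p M v"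
  using lp_space_add[OF p u lp_space_scale(1)[OF p v, of "-1"]] lp_space_scale(2)[OF p v, of "-1"]
  by (auto simp: add.commute)

lemma lp_norm_cong_AE:
  assumes p: "1 \<le> p" and u: "u \<in> lp_space p M" and v: "v \<in> lp_space p M"
    and "AE x in M. u x = v x"
  shows "lp_norm p M u = lp_norm p M v"
proof (rule antisym)
  show "lp_norm p M u \<le> lp_norm p M v"
    using assms(4) by (intro lp_space_dominated(2)[OF p v lp_space_measurable[OF u]]) (auto elim: eventually_mono)
  show "lp_norm p M v \<le> lp_norm p M u"
    using assms(4) by (intro lp_space_dominated(2)[OF p u lp_space_measurable[OF v]]) (auto elim: eventually_mono)
qed

lemma lp_norm_zero_AE:
  assumes p: "1 \<le> p" and u: "u \<in> lp_space p M" and "lp_norm p M u = 0"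
  shows "AE x in M. u x = 0"
proof -
  note [measurable] = lp_space_measurable[OF u]
  have "(\<integral>\<^sup>+x. ennreal (norm (u x) powr p) \<partial>M) = 0"
    using nn_integral_lp_space[OF p u] assms(3) by simp
  then have "AE x in M. ennreal (norm (u x) powr p) = 0"
    by (subst (asm) nn_integral_0_iff_AE) auto
  then show ?thesis by (auto elim: eventually_mono simp: ennreal_eq_0_iff)
qed

lemma lp_space_sum:
  assumes p: "1 \<le> p" and u: "\<And>n. u n \<in> lp_space p M"
  shows "(\<lambda>x. \<Sum>n<N::nat. u n x) \<in> lp_space p M"
    and "lp_norm p M (\<lambda>x. \<Sum>n<N. u n x) \<le> (\<Sum>n<N. lp_norm p M (u n))"
proof -
  have "(\<lambda>x. \<Sum>n<N::nat. u n x) \<in> lp_space p M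
      \<and> lp_norm p M (\<lambda>x. \<Sum>n<N. u n x) \<le> (\<Sum>n<N. lp_norm p M (u n))"
  proof (induction N)
    case 0
    show ?case
      using p lp_space_normI[OF p, of "\<lambda>x. 0" M 0] by simp
  next
    case (Suc N)
    then show ?case using lp_space_add[OF p conjunct1[OF Suc] u[of N]] by simp
  qed
  then show "(\<lambda>x. \<Sum>n<N. u n x) \<in> lp_space p M"
    "lp_norm p M (\<lambda>x. \<Sum>n<N. u n x) \<le> (\<Sum>n<N. lp_norm p M (u n))" by auto
qed

text \<open>
  Absolutely convergent series in \<open>L^p\<close> converge pointwise almost everywhere: monotone convergence
  applied to the \<open>p\<close>-th powers of the partial sums of the norms.
\<close>

lemma lp_space_suminf:
  fixes u :: "nat \<Rightarrow> 'a \<Rightarrow> complex"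
  assumes p: "1 \<le> p" and u: "\<And>n. u n \<in> lp_space p M" and sm: "summable (\<lambda>n. lp_norm p M (u n))"
  shows "AE x in M. summable (\<lambda>n. norm (u n x))"
    and "(\<lambda>x. \<Sum>n. u n x) \<in> lp_space p M"
    and "lp_norm p M (\<lambda>x. \<Sum>n. u n x) \<le> (\<Sum>n. lp_norm p M (u n))"
proof -
  note [measurable] = lp_space_measurable[OF u]
  define c where "c = (\<Sum>n. lp_norm p M (u n))"
  have c: "0 \<le> c" unfolding c_def by (intro suminf_nonneg sm lp_norm_nonneg)
  define V where "V N x = (\<Sum>n<N. norm (u n x))" for N x
  have V0: "0 \<le> V N x" for N x unfolding V_def by (intro sum_nonneg) auto
  have Vmono: "V i x \<le> V j x" if "i \<le> j" for i j x
    unfolding V_def using that by (intro sum_mono2) auto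
  define G where "G x = (SUP N. ennreal (V N x powr p))" for x
  have [measurable]: "V N \<in> borel_measurable M" for N unfolding V_def by measurable
  have [measurable]: "G \<in> borel_measurable M" unfolding G_def by measurable
  have norm_lp: "(\<lambda>x. of_real (norm (u n x))) \<in> lp_space p M"
    and norm_le: "lp_norm p M (\<lambda>x. of_real (norm (u n x))) \<le> lp_norm p M (u n)" for n
    using lp_space_dominated[OF p u, of "\<lambda>x. of_real (norm (u n x))" n] by auto
  have VN: "(\<integral>\<^sup>+x. ennreal (V N x powr p) \<partial>M) \<le> ennreal (c powr p)" for N
  proof -
    let ?v = "\<lambda>x. \<Sum>n<N. complex_of_real (norm (u n x))"
    have "norm (?v x) = V N x" for x
      using V0[of N x] by (simp add: V_def flip: of_real_sum)
    then have "(\<integral>\<^sup>+x. ennreal (V N x powr p) \<partial>M) = ennreal (lp_norm p M ?v powr p)"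
      using nn_integral_lp_space[OF p lp_space_sum(1)[where u = "\<lambda>n x. of_real (norm (u n x))" and N = N, OF p norm_lp]] by simp
    moreover have "lp_norm p M ?v \<le> c"
    proof -
      have "lp_norm p M ?v \<le> (\<Sum>n<N. lp_norm p M (u n))"
        using lp_space_sum(2)[where u = "\<lambda>n x. of_real (norm (u n x))" and N = N, OF p norm_lp]
        by (rule order_trans) (intro sum_mono norm_le)
      also have "\<dots> \<le> c" unfolding c_def by (intro sum_le_suminf sm lp_norm_nonneg) auto
      finally show ?thesis .
    qed
    ultimately show ?thesis
      using p lp_norm_nonneg[of p M ?v] by (simp add: powr_mono2 ennreal_leI)
  qed
  have "(\<integral>\<^sup>+x. G x \<partial>M) = (SUP N. \<integral>\<^sup>+x. ennreal (V N x powr p) \<partial>M)"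
    unfolding G_def using V0 Vmono p
    by (intro nn_integral_monotone_convergence_SUP)
      (auto simp: incseq_def le_fun_def intro!: ennreal_leI powr_mono2)
  also have "\<dots> \<le> ennreal (c powr p)" by (intro SUP_least VN)
  finally have intG: "(\<integral>\<^sup>+x. G x \<partial>M) \<le> ennreal (c powr p)" .
  then have "AE x in M. G x \<noteq> \<infinity>"
    by (intro nn_integral_PInf_AE) (auto simp: top_unique)
  moreover have fin: "summable (\<lambda>n. norm (u n x)) \<and> ennreal (norm (\<Sum>n. u n x) powr p) \<le> G x"
    if "G x \<noteq> \<infinity>" for x
  proof -
    define r where "r = enn2real (G x) powr (1 / p)"
    have le: "V N x \<le> r" for N
    proof -
      have "ennreal (V N x powr p) \<le> G x" unfolding G_def by (rule SUP_upper) simp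
      also have "G x = ennreal (enn2real (G x))" using that by (simp add: less_top)
      finally have "V N x powr p \<le> enn2real (G x)" by simp
      then have "(V N x powr p) powr (1 / p) \<le> r"
        unfolding r_def using p by (intro powr_mono2) auto
      then show ?thesis using p V0[of N x] by (simp add: powr_powr)
    qed
    have sm: "summable (\<lambda>n. norm (u n x))"
      by (rule summableI_nonneg_bounded[where x = r]) (use le in \<open>auto simp: V_def\<close>)
    have "norm (\<Sum>n. u n x) \<le> (\<Sum>n. norm (u n x))" by (rule summable_norm[OF sm])
    also have "\<dots> \<le> r" by (rule suminf_le_const[OF sm]) (use le in \<open>simp add: V_def\<close>)
    finally have "norm (\<Sum>n. u n x) powr p \<le> r powr p" using p by (intro powr_mono2) auto
    also have "r powr p = enn2real (G x)" using p by (simp add: r_def powr_powr)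
    finally have "ennreal (norm (\<Sum>n. u n x) powr p) \<le> ennreal (enn2real (G x))" by (rule ennreal_leI)
    also have "ennreal (enn2real (G x)) = G x" using that by (simp add: less_top)
    finally show ?thesis using sm by simp
  qed
  ultimately show "AE x in M. summable (\<lambda>n. norm (u n x))" by (auto elim: eventually_mono)
  have "(\<integral>\<^sup>+x. ennreal (norm (\<Sum>n. u n x) powr p) \<partial>M) \<le> (\<integral>\<^sup>+x. G x \<partial>M)"
    using \<open>AE x in M. G x \<noteq> \<infinity>\<close> fin by (intro nn_integral_mono_AE) (auto elim: eventually_mono)
  also note intG
  finally have le: "(\<integral>\<^sup>+x. ennreal (norm (\<Sum>n. u n x) powr p) \<partial>M) \<le> ennreal (c powr p)" .
  have meas: "(\<lambda>x. \<Sum>n. u n x) \<in> borel_measurable M" by measurable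
  show "(\<lambda>x. \<Sum>n. u n x) \<in> lp_space p M" "lp_norm p M (\<lambda>x. \<Sum>n. u n x) \<le> (\<Sum>n. lp_norm p M (u n))"
    using lp_space_normI[OF p meas c le] by (auto simp: c_def)
qed

section \<open>Growth rates of weighted composition operators\<close>

locale measure_preserving_map =
  fixes \<mu> :: "'a::topological_space measure" and \<alpha> :: "'a \<Rightarrow> 'a"
  assumes sets_eq: "sets \<mu> = sets borel"
    and nontrivial: "\<exists>A\<in>sets \<mu>. 0 < emeasure \<mu> A \<and> emeasure \<mu> A < \<infinity>"
    and continuous: "continuous_on UNIV \<alpha>"
    and preserves: "distr \<mu> borel \<alpha> = \<mu>"
begin

lemma measurable_eq: "measurable \<mu> N = measurable borel N"
  by (rule measurable_cong_sets[OF sets_eq refl])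

lemma measurable_map [measurable]: "\<alpha> \<in> measurable borel borel"
  using continuous by (rule borel_measurable_continuous_onI)

lemma measurable_funpow [measurable]: "(\<alpha> ^^ n) \<in> measurable borel borel"
  by (induction n) (auto intro: measurable_comp)

lemma measurable_bcontfun [measurable]: "apply_bcontfun \<phi> \<in> borel_measurable borel"
  for \<phi> :: "'a \<Rightarrow>\<^sub>C real"
  by (rule borel_measurable_continuous_onI) simp

lemma distr_funpow: "distr \<mu> borel (\<alpha> ^^ n) = \<mu>"
proof (induction n)
  case 0
  have "distr \<mu> borel id = distr \<mu> \<mu> id" by (intro distr_cong) (auto simp: sets_eq)
  then show ?case by (simp add: id_def distr_id)
next
  case (Suc n)
  have [measurable]: "\<alpha> \<in> measurable \<mu> borel" "(\<alpha> ^^ n) \<in> measurable \<mu> borel"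
    by (simp_all add: measurable_eq)
  have "distr \<mu> borel (\<alpha> ^^ Suc n) = distr (distr \<mu> borel (\<alpha> ^^ n)) borel \<alpha>"
    by (subst distr_distr) auto
  then show ?case by (simp only: Suc preserves)
qed

lemma nn_integral_funpow:
  assumes [measurable]: "f \<in> borel_measurable borel"
  shows "(\<integral>\<^sup>+x. f ((\<alpha> ^^ n) x) \<partial>\<mu>) = (\<integral>\<^sup>+x. f x \<partial>\<mu>)"
proof -
  have "(\<integral>\<^sup>+x. f x \<partial>\<mu>) = (\<integral>\<^sup>+x. f x \<partial>distr \<mu> borel (\<alpha> ^^ n))" by (simp add: distr_funpow)
  also have "\<dots> = (\<integral>\<^sup>+x. f ((\<alpha> ^^ n) x) \<partial>\<mu>)"
    by (intro nn_integral_distr) (simp_all add: measurable_eq)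
  finally show ?thesis by simp
qed

lemma AE_funpow:
  assumes "AE x in \<mu>. P x"
  shows "AE x in \<mu>. P ((\<alpha> ^^ n) x)"
proof -
  have "(\<alpha> ^^ n) \<in> measurable \<mu> borel" by (simp add: measurable_eq)
  moreover have "AE x in distr \<mu> borel (\<alpha> ^^ n). P x" unfolding distr_funpow by (rule assms)
  ultimately show ?thesis by (rule AE_distrD)
qed

definition birkhoff_sum :: "('a \<Rightarrow>\<^sub>C real) \<Rightarrow> nat \<Rightarrow> 'a \<Rightarrow> real" where
  "birkhoff_sum \<phi> n x = (\<Sum>k<n. apply_bcontfun \<phi> ((\<alpha> ^^ k) x))"

definition transfer :: "('a \<Rightarrow>\<^sub>C real) \<Rightarrow> nat \<Rightarrow> ('a \<Rightarrow> real) \<Rightarrow> ennreal" where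
  "transfer \<phi> n f = (\<integral>\<^sup>+x. ennreal (exp (birkhoff_sum \<phi> n x) * f ((\<alpha> ^^ n) x)) \<partial>\<mu>)"

text \<open>
  The bound says that the \<open>n\<close>-th power of the operator with weight \<open>exp \<phi>\<close> has norm at most \<open>C\<close>
  on \<open>L^1\<close>. Functions of infinite integral are included, which costs nothing for positive \<open>C\<close> and
  makes the bounds compose.
\<close>

definition step_bound :: "('a \<Rightarrow>\<^sub>C real) \<Rightarrow> nat \<Rightarrow> real \<Rightarrow> bool" where
  "step_bound \<phi> n C \<longleftrightarrow> (\<forall>f\<in>borel_measurable borel. (\<forall>x. 0 \<le> f x) \<longrightarrow>
     transfer \<phi> n f \<le> ennreal C * (\<integral>\<^sup>+x. ennreal (f x) \<partial>\<mu>))"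

definition growth_bound :: "('a \<Rightarrow>\<^sub>C real) \<Rightarrow> real \<Rightarrow> bool" where
  "growth_bound \<phi> s \<longleftrightarrow> (\<exists>C>0. \<forall>n. step_bound \<phi> n (C * exp (real n * s)))"

text \<open>
  The infimum of the admissible exponents is Gelfand's limit of \<open>ln (norm of the n-th power) / n\<close>.
  Stated through exponents, its properties follow from comparisons for each single \<open>n\<close>.
\<close>

definition growth_rate :: "('a \<Rightarrow>\<^sub>C real) \<Rightarrow> real" where
  "growth_rate \<phi> = Inf {s. growth_bound \<phi> s}"

lemma measurable_birkhoff_sum [measurable]: "birkhoff_sum \<phi> n \<in> borel_measurable borel"
  unfolding birkhoff_sum_def by measurable

lemma birkhoff_sum_Suc: "birkhoff_sum \<phi> (Suc n) x = birkhoff_sum \<phi> n (\<alpha> x) + apply_bcontfun \<phi> x"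
  unfolding birkhoff_sum_def by (subst sum.lessThan_Suc_shift) (simp add: funpow_swap1)

lemma birkhoff_sum_add: "birkhoff_sum \<phi> (n + m) x = birkhoff_sum \<phi> n x + birkhoff_sum \<phi> m ((\<alpha> ^^ n) x)"
  by (induction m) (simp_all add: birkhoff_sum_def funpow_add add.commute)

lemma birkhoff_sum_linear: "birkhoff_sum (a *\<^sub>R \<phi> + b *\<^sub>R \<psi>) n x = a * birkhoff_sum \<phi> n x + b * birkhoff_sum \<psi> n x"
  by (simp add: birkhoff_sum_def sum.distrib sum_distrib_left)

lemma birkhoff_sum_scale: "birkhoff_sum (a *\<^sub>R \<phi>) n x = a * birkhoff_sum \<phi> n x"
  by (simp add: birkhoff_sum_def sum_distrib_left)

lemma birkhoff_sum_bound: "\<bar>birkhoff_sum \<phi> n x\<bar> \<le> real n * norm \<phi>"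
proof -
  have "\<bar>birkhoff_sum \<phi> n x\<bar> \<le> (\<Sum>k<n. norm \<phi>)"
    unfolding birkhoff_sum_def using norm_bounded[of \<phi>] by (intro sum_abs[THEN order_trans] sum_mono) auto
  then show ?thesis by simp
qed

lemma measurable_transfer:
  assumes [measurable]: "f \<in> borel_measurable borel"
  shows "(\<lambda>x. exp (birkhoff_sum \<phi> n x) * f ((\<alpha> ^^ n) x)) \<in> borel_measurable borel"
  by measurable

lemma transfer_add:
  "transfer \<phi> (n + m) f = transfer \<phi> n (\<lambda>x. exp (birkhoff_sum \<phi> m x) * f ((\<alpha> ^^ m) x))"
proof -
  have "(\<alpha> ^^ (n + m)) x = (\<alpha> ^^ m) ((\<alpha> ^^ n) x)" for x
    by (simp add: add.commute[of n m] funpow_add)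
  then show ?thesis by (simp add: transfer_def birkhoff_sum_add exp_add mult.assoc)
qed

lemma step_bound_add:
  assumes n: "step_bound \<phi> n C" and m: "step_bound \<phi> m D" and "0 \<le> C" "0 \<le> D"
  shows "step_bound \<phi> (n + m) (C * D)"
  unfolding step_bound_def
proof (intro ballI impI)
  fix f :: "'a \<Rightarrow> real" assume f: "f \<in> borel_measurable borel" "\<forall>x. 0 \<le> f x"
  have "transfer \<phi> (n + m) f \<le> ennreal C * transfer \<phi> m f"
    using n f measurable_transfer[OF f(1), of \<phi> m] unfolding transfer_add
    by (subst (2) transfer_def) (auto simp: step_bound_def)
  also have "\<dots> \<le> ennreal C * (ennreal D * (\<integral>\<^sup>+x. ennreal (f x) \<partial>\<mu>))"
    using m f by (intro mult_left_mono) (auto simp: step_bound_def)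
  finally show "transfer \<phi> (n + m) f \<le> ennreal (C * D) * (\<integral>\<^sup>+x. ennreal (f x) \<partial>\<mu>)"
    using assms(3,4) by (simp add: ennreal_mult mult.assoc)
qed

lemma step_bound_mono: "step_bound \<phi> n C \<Longrightarrow> C \<le> D \<Longrightarrow> step_bound \<phi> n D"
  unfolding step_bound_def by (meson ennreal_leI mult_right_mono order_trans zero_le)

lemma step_bound_compare:
  assumes "\<And>x. birkhoff_sum \<phi> n x \<le> birkhoff_sum \<psi> n x + c" and \<psi>: "step_bound \<psi> n C" and C: "0 \<le> C"
  shows "step_bound \<phi> n (exp c * C)"
  unfolding step_bound_def
proof (intro ballI impI)
  fix f :: "'a \<Rightarrow> real" assume f: "f \<in> borel_measurable borel" "\<forall>x. 0 \<le> f x"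
  note [measurable] = measurable_transfer[OF f(1), of \<psi> n]
  have "transfer \<phi> n f \<le> (\<integral>\<^sup>+x. ennreal (exp c) * ennreal (exp (birkhoff_sum \<psi> n x) * f ((\<alpha> ^^ n) x)) \<partial>\<mu>)"
    unfolding transfer_def
  proof (rule nn_integral_mono)
    fix x
    have "exp (birkhoff_sum \<phi> n x) * f ((\<alpha> ^^ n) x) \<le> exp (birkhoff_sum \<psi> n x + c) * f ((\<alpha> ^^ n) x)"
      using assms(1) f(2) by (intro mult_right_mono) auto
    then show "ennreal (exp (birkhoff_sum \<phi> n x) * f ((\<alpha> ^^ n) x))
        \<le> ennreal (exp c) * ennreal (exp (birkhoff_sum \<psi> n x) * f ((\<alpha> ^^ n) x))"
      using f(2) by (simp add: exp_add mult_ac ennreal_leI flip: ennreal_mult)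
  qed
  also have "\<dots> = ennreal (exp c) * transfer \<psi> n f"
    unfolding transfer_def by (intro nn_integral_cmult) (simp add: measurable_eq)
  also have "\<dots> \<le> ennreal (exp c) * (ennreal C * (\<integral>\<^sup>+x. ennreal (f x) \<partial>\<mu>))"
    using \<psi> f by (intro mult_left_mono) (auto simp: step_bound_def)
  finally show "transfer \<phi> n f \<le> ennreal (exp c * C) * (\<integral>\<^sup>+x. ennreal (f x) \<partial>\<mu>)"
    using C by (simp add: ennreal_mult mult.assoc)
qed

lemma step_bound_zero: "step_bound 0 n 1"
  unfolding step_bound_def transfer_def
  by (auto simp: birkhoff_sum_def nn_integral_funpow[of "\<lambda>x. ennreal (_ x)"])

lemma step_bound_norm: "step_bound \<phi> n (exp (real n * norm \<phi>))"
  using step_bound_compare[OF _ step_bound_zero, of \<phi> n "real n * norm \<phi>"] birkhoff_sum_bound[of \<phi> n]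
  by (auto simp: birkhoff_sum_def abs_le_iff)

lemma growth_bound_norm: "growth_bound \<phi> (norm \<phi>)"
  unfolding growth_bound_def using step_bound_norm by (intro exI[of _ 1]) auto

lemma step_bound_lower:
  assumes "step_bound \<phi> n C" and C: "0 \<le> C"
  shows "exp (- (real n * norm \<phi>)) \<le> C"
proof -
  obtain A where A: "A \<in> sets borel" "0 < emeasure \<mu> A" "emeasure \<mu> A < \<infinity>"
    using nontrivial sets_eq by auto
  have "ennreal (exp (- (real n * norm \<phi>))) * emeasure \<mu> A
      = ennreal (exp (- (real n * norm \<phi>))) * (\<integral>\<^sup>+x. ennreal (indicator A ((\<alpha> ^^ n) x)) \<partial>\<mu>)"
    using A(1) sets_eq by (subst nn_integral_funpow) (auto simp: ennreal_indicator)
  also have "\<dots> = (\<integral>\<^sup>+x. ennreal (exp (- (real n * norm \<phi>)) * indicator A ((\<alpha> ^^ n) x)) \<partial>\<mu>)"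
    using A(1) by (subst nn_integral_cmult[symmetric]) (auto simp: ennreal_mult measurable_eq)
  also have "\<dots> \<le> transfer \<phi> n (indicator A)"
    unfolding transfer_def using birkhoff_sum_bound[of \<phi> n]
    by (intro nn_integral_mono ennreal_leI mult_right_mono) (auto simp: abs_le_iff minus_le_iff)
  also have "\<dots> \<le> ennreal C * (\<integral>\<^sup>+x. ennreal (indicator A x) \<partial>\<mu>)"
    using assms(1) A(1) by (auto simp: step_bound_def)
  also have "\<dots> = ennreal C * emeasure \<mu> A" using A(1) sets_eq by (simp add: ennreal_indicator)
  finally have "ennreal (exp (- (real n * norm \<phi>)) * measure \<mu> A) \<le> ennreal (C * measure \<mu> A)"
    using A C by (simp add: emeasure_eq_ennreal_measure ennreal_mult)
  moreover have "0 < measure \<mu> A" using A by (simp add: measure_def enn2real_positive_iff)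
  ultimately show ?thesis using C by (subst (asm) ennreal_le_iff) auto
qed

lemma growth_bound_lower:
  assumes "growth_bound \<phi> s"
  shows "- norm \<phi> \<le> s"
proof (rule ccontr)
  assume "\<not> - norm \<phi> \<le> s"
  then have d: "0 < - norm \<phi> - s" by simp
  from assms obtain C where C: "0 < C" "\<And>n. step_bound \<phi> n (C * exp (real n * s))"
    by (auto simp: growth_bound_def)
  have "exp (real n * (- norm \<phi> - s)) \<le> C" for n
    using step_bound_lower[OF C(2)[of n]] C(1)
    by (simp add: algebra_simps exp_diff exp_minus field_simps)
  then have "real n * (- norm \<phi> - s) \<le> ln C" for n
    using C(1) by (metis exp_le_cancel_iff exp_ln)
  moreover obtain n where "ln C < real n * (- norm \<phi> - s)"
    using reals_Archimedean3[OF d] by blast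
  ultimately show False by (meson not_le)
qed

lemma growth_rate_le: "growth_bound \<phi> s \<Longrightarrow> growth_rate \<phi> \<le> s"
  unfolding growth_rate_def using growth_bound_lower by (intro cInf_lower bdd_belowI) auto

lemma growth_bound_mono:
  assumes "growth_bound \<phi> s" "s \<le> t"
  shows "growth_bound \<phi> t"
proof -
  from assms(1) obtain C where C: "0 < C" "\<And>n. step_bound \<phi> n (C * exp (real n * s))"
    by (auto simp: growth_bound_def)
  have "step_bound \<phi> n (C * exp (real n * t))" for n
    using C(1) assms(2) by (intro step_bound_mono[OF C(2)]) (auto simp: mult_left_mono)
  then show ?thesis using C(1) by (auto simp: growth_bound_def)
qed

lemma growth_bound_above:
  assumes "growth_rate \<phi> < s"
  shows "growth_bound \<phi> s"
proof -
  have "{s. growth_bound \<phi> s} \<noteq> {}" using growth_bound_norm by auto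
  from cInf_lessD[OF this assms[unfolded growth_rate_def]] show ?thesis
    by (auto intro: growth_bound_mono)
qed

text \<open>
  The submultiplicativity of the norms of the powers enters here, as in Fekete's lemma: a good
  bound for a single power propagates to all multiples, and the remainder costs a constant.
\<close>

lemma growth_bound_from_step:
  assumes m: "0 < m" and step: "step_bound \<phi> m (exp (real m * s))"
  shows "growth_bound \<phi> s"
proof -
  have mult: "step_bound \<phi> (q * m) (exp (real (q * m) * s))" for q
  proof (induction q)
    case 0
    then show ?case using step_bound_norm[of \<phi> 0] by simp
  next
    case (Suc q)
    then show ?case using step_bound_add[OF step Suc] by (simp add: algebra_simps flip: exp_add)
  qed
  have "step_bound \<phi> n (exp (real m * (norm \<phi> + \<bar>s\<bar>)) * exp (real n * s))" for n
  proof -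
    define q r where "q = n div m" and "r = n mod m"
    have n: "n = q * m + r" and r: "r \<le> m" using m by (auto simp: q_def r_def less_imp_le)
    have "step_bound \<phi> (q * m + r) (exp (real (q * m) * s) * exp (real r * norm \<phi>))"
      by (intro step_bound_add mult step_bound_norm) auto
    moreover have "exp (real (q * m) * s) * exp (real r * norm \<phi>)
        \<le> exp (real m * (norm \<phi> + \<bar>s\<bar>)) * exp (real n * s)"
    proof -
      have "real r * norm \<phi> \<le> real m * norm \<phi>" using r by (intro mult_right_mono) auto
      moreover have "- (real r * s) \<le> real m * \<bar>s\<bar>"
        using r mult_mono[of "real r" "real m" "- s" "\<bar>s\<bar>"]
          mult_mono[of "real r" "real m" "\<bar>s\<bar>" "\<bar>s\<bar>"] abs_ge_minus_self[of "real r * s"]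
        by (simp add: abs_mult) 
      ultimately show ?thesis
        unfolding n by (simp add: algebra_simps flip: exp_add)
    qed
    ultimately show ?thesis using n step_bound_mono by simp
  qed
  then show ?thesis unfolding growth_bound_def by (intro exI[of _ "exp (real m * (norm \<phi> + \<bar>s\<bar>))"]) auto
qed

lemma growth_rate_le_if_growth_bounds:
  assumes "\<And>s. growth_bound \<psi> s \<Longrightarrow> growth_bound \<phi> (s + c)"
  shows "growth_rate \<phi> \<le> growth_rate \<psi> + c"
proof (rule field_le_epsilon)
  fix e :: real assume "0 < e"
  then have "growth_bound \<psi> (growth_rate \<psi> + e)" by (intro growth_bound_above) simp
  from growth_rate_le[OF assms[OF this]] show "growth_rate \<phi> \<le> growth_rate \<psi> + c + e" by simp
qed

lemma growth_rate_compare: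
  assumes "\<And>n x. birkhoff_sum \<phi> n x \<le> birkhoff_sum \<psi> n x + real n * c + d"
  shows "growth_rate \<phi> \<le> growth_rate \<psi> + c"
proof (rule growth_rate_le_if_growth_bounds)
  fix s assume "growth_bound \<psi> s"
  then obtain C where C: "0 < C" "\<And>n. step_bound \<psi> n (C * exp (real n * s))"
    by (auto simp: growth_bound_def)
  have "step_bound \<phi> n (exp d * C * exp (real n * (s + c)))" for n
    using step_bound_compare[OF _ C(2), of \<phi> n "real n * c + d"] assms[of n] C(1)
    by (simp add: algebra_simps exp_add)
  then show "growth_bound \<phi> (s + c)"
    unfolding growth_bound_def using C(1) by (intro exI[of _ "exp d * C"]) auto
qed

lemma growth_rate_mono:
  assumes "\<And>x. apply_bcontfun \<phi> x \<le> apply_bcontfun \<psi> x"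
  shows "growth_rate \<phi> \<le> growth_rate \<psi>"
  using growth_rate_compare[of \<phi> \<psi> 0 0] assms by (simp add: birkhoff_sum_def sum_mono)

lemma growth_rate_add_const: "growth_rate (\<phi> + const_bcontfun c) = growth_rate \<phi> + c"
proof (rule antisym)
  have eq: "birkhoff_sum (\<phi> + const_bcontfun c) n x = birkhoff_sum \<phi> n x + real n * c" for n x
    by (simp add: birkhoff_sum_def sum.distrib)
  show "growth_rate (\<phi> + const_bcontfun c) \<le> growth_rate \<phi> + c"
    using growth_rate_compare[of "\<phi> + const_bcontfun c" \<phi> c 0] by (simp add: eq)
  show "growth_rate \<phi> + c \<le> growth_rate (\<phi> + const_bcontfun c)"
    using growth_rate_compare[of \<phi> "\<phi> + const_bcontfun c" "- c" 0] by (simp add: eq)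
qed

text \<open>The Birkhoff sums of a coboundary telescope, hence stay bounded.\<close>

lemma growth_rate_add_coboundary:
  assumes h: "\<And>x. apply_bcontfun h x = apply_bcontfun \<psi> (\<alpha> x) - apply_bcontfun \<psi> x"
  shows "growth_rate (\<phi> + h) \<le> growth_rate \<phi>"
proof -
  have "birkhoff_sum h n x = apply_bcontfun \<psi> ((\<alpha> ^^ n) x) - apply_bcontfun \<psi> x" for n x
    by (induction n) (simp_all add: birkhoff_sum_def h)
  moreover have "birkhoff_sum (\<phi> + h) n x = birkhoff_sum \<phi> n x + birkhoff_sum h n x" for n x
    by (simp add: birkhoff_sum_def sum.distrib)
  ultimately have "birkhoff_sum (\<phi> + h) n x \<le> birkhoff_sum \<phi> n x + real n * 0 + 2 * norm \<psi>" for n x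
    using norm_bounded[of \<psi> x] norm_bounded[of \<psi> "(\<alpha> ^^ n) x"] by (simp add: abs_le_iff)
  from growth_rate_compare[OF this] show ?thesis by simp
qed

text \<open>
  Convexity of the exponential, applied after normalising both weights by their growth, replaces
  Hoelder's inequality.
\<close>

lemma growth_rate_convex: "convex_on UNIV growth_rate"
proof (rule convex_onI)
  fix t :: real and \<phi> \<psi> :: "'a \<Rightarrow>\<^sub>C real" assume t: "0 < t" "t < 1"
  have bound: "growth_bound ((1 - t) *\<^sub>R \<phi> + t *\<^sub>R \<psi>) ((1 - t) * a + t * b)"
    if "growth_bound \<phi> a" "growth_bound \<psi> b" for a b
  proof -
    from that obtain C D where C: "0 < C" "\<And>n. step_bound \<phi> n (C * exp (real n * a))"
      and D: "0 < D" "\<And>n. step_bound \<psi> n (D * exp (real n * b))"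
      by (auto simp: growth_bound_def)
    define \<omega> :: "'a \<Rightarrow>\<^sub>C real" where "\<omega> = (1 - t) *\<^sub>R \<phi> + t *\<^sub>R \<psi>"
    define c where "c = (1 - t) * a + t * b"
    have "step_bound \<omega> n (((1 - t) * C + t * D) * exp (real n * c))" for n
      unfolding step_bound_def
    proof (intro ballI impI)
      fix f :: "'a \<Rightarrow> real" assume f: "f \<in> borel_measurable borel" "\<forall>x. 0 \<le> f x"
      note [measurable] = measurable_transfer[OF f(1)]
      define A B where "A = (1 - t) * exp (real n * (c - a))" and "B = t * exp (real n * (c - b))"
      have AB: "0 \<le> A" "0 \<le> B" using t by (auto simp: A_def B_def)
      have pw: "exp (birkhoff_sum \<omega> n x) \<le> A * exp (birkhoff_sum \<phi> n x) + B * exp (birkhoff_sum \<psi> n x)" for x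
      proof -
        have eq: "birkhoff_sum \<omega> n x
            = (1 - t) * (birkhoff_sum \<phi> n x - real n * a) + t * (birkhoff_sum \<psi> n x - real n * b) + real n * c"
          by (unfold \<omega>_def birkhoff_sum_linear c_def, simp add: algebra_simps)
        have "exp ((1 - t) * (birkhoff_sum \<phi> n x - real n * a) + t * (birkhoff_sum \<psi> n x - real n * b))
            \<le> (1 - t) * exp (birkhoff_sum \<phi> n x - real n * a) + t * exp (birkhoff_sum \<psi> n x - real n * b)"
          using convex_onD[OF exp_convex, of t] t by simp
        then have "exp (birkhoff_sum \<omega> n x) \<le> ((1 - t) * exp (birkhoff_sum \<phi> n x - real n * a)
            + t * exp (birkhoff_sum \<psi> n x - real n * b)) * exp (real n * c)"
          unfolding eq exp_add[of _ "real n * c"] by (rule mult_right_mono) simp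
        also have "\<dots> = A * exp (birkhoff_sum \<phi> n x) + B * exp (birkhoff_sum \<psi> n x)"
          by (simp add: A_def B_def algebra_simps flip: exp_add)
        finally show ?thesis .
      qed
      have "transfer \<omega> n f \<le> (\<integral>\<^sup>+x. ennreal A * ennreal (exp (birkhoff_sum \<phi> n x) * f ((\<alpha> ^^ n) x))
          + ennreal B * ennreal (exp (birkhoff_sum \<psi> n x) * f ((\<alpha> ^^ n) x)) \<partial>\<mu>)"
        unfolding transfer_def
      proof (rule nn_integral_mono)
        fix x
        have "exp (birkhoff_sum \<omega> n x) * f ((\<alpha> ^^ n) x)
            \<le> A * (exp (birkhoff_sum \<phi> n x) * f ((\<alpha> ^^ n) x)) + B * (exp (birkhoff_sum \<psi> n x) * f ((\<alpha> ^^ n) x))"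
          using mult_right_mono[OF pw[of x], of "f ((\<alpha> ^^ n) x)"] f(2) by (simp add: algebra_simps)
        then show "ennreal (exp (birkhoff_sum \<omega> n x) * f ((\<alpha> ^^ n) x))
          \<le> ennreal A * ennreal (exp (birkhoff_sum \<phi> n x) * f ((\<alpha> ^^ n) x))
            + ennreal B * ennreal (exp (birkhoff_sum \<psi> n x) * f ((\<alpha> ^^ n) x))"
          using AB f(2) by (simp flip: ennreal_mult ennreal_plus)
      qed
      also have "\<dots> = ennreal A * transfer \<phi> n f + ennreal B * transfer \<psi> n f"
        unfolding transfer_def by (simp add: nn_integral_add nn_integral_cmult measurable_eq)
      also have "\<dots> \<le> ennreal A * (ennreal (C * exp (real n * a)) * (\<integral>\<^sup>+x. ennreal (f x) \<partial>\<mu>))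
          + ennreal B * (ennreal (D * exp (real n * b)) * (\<integral>\<^sup>+x. ennreal (f x) \<partial>\<mu>))"
        using C(2)[of n] D(2)[of n] f by (intro add_mono mult_left_mono) (auto simp: step_bound_def)
      also have "\<dots> = ennreal (A * (C * exp (real n * a)) + B * (D * exp (real n * b))) * (\<integral>\<^sup>+x. ennreal (f x) \<partial>\<mu>)"
        using AB C(1) D(1) by (simp add: ennreal_mult distrib_right mult.assoc)
      also have "A * (C * exp (real n * a)) + B * (D * exp (real n * b)) = ((1 - t) * C + t * D) * exp (real n * c)"
        by (simp add: A_def B_def algebra_simps flip: exp_add)
      finally show "transfer \<omega> n f
          \<le> ennreal (((1 - t) * C + t * D) * exp (real n * c)) * (\<integral>\<^sup>+x. ennreal (f x) \<partial>\<mu>)" .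
    qed
    moreover have "0 < (1 - t) * C + t * D" using t C D by (simp add: add_pos_pos)
    ultimately show ?thesis unfolding growth_bound_def \<omega>_def c_def by blast
  qed
  show "growth_rate ((1 - t) *\<^sub>R \<phi> + t *\<^sub>R \<psi>) \<le> (1 - t) * growth_rate \<phi> + t * growth_rate \<psi>"
  proof (rule field_le_epsilon)
    fix e :: real assume "0 < e"
    then have "growth_bound \<phi> (growth_rate \<phi> + e)" "growth_bound \<psi> (growth_rate \<psi> + e)"
      by (auto intro: growth_bound_above)
    from growth_rate_le[OF bound[OF this]]
    show "growth_rate ((1 - t) *\<^sub>R \<phi> + t *\<^sub>R \<psi>) \<le> (1 - t) * growth_rate \<phi> + t * growth_rate \<psi> + e"
      by (simp add: algebra_simps)
  qed
qed simp

end

section \<open>The spectral radius as a growth rate\<close>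

context measure_preserving_map
begin

context
  fixes p :: real and \<phi> :: "'a \<Rightarrow>\<^sub>C real"
  assumes p: "1 \<le> p"
begin

abbreviation T :: "('a \<Rightarrow> complex) \<Rightarrow> 'a \<Rightarrow> complex" where
  "T \<equiv> weighted_composition (\<lambda>x. exp (apply_bcontfun \<phi> x)) \<alpha>"

definition T_pow :: "nat \<Rightarrow> ('a \<Rightarrow> complex) \<Rightarrow> 'a \<Rightarrow> complex" where
  "T_pow n u x = of_real (exp (birkhoff_sum \<phi> n x)) * u ((\<alpha> ^^ n) x)"

lemma T_pow_0 [simp]: "T_pow 0 u x = u x"
  by (simp add: T_pow_def birkhoff_sum_def)

lemma T_T_pow: "T (T_pow n u) x = T_pow (Suc n) u x"
  by (simp add: T_pow_def weighted_composition_def birkhoff_sum_Suc exp_add funpow_swap1)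

lemma T_pow_T: "T_pow n (T u) x = T_pow (Suc n) u x"
  by (simp add: T_pow_def weighted_composition_def birkhoff_sum_def exp_add)

lemma T_pow_linear: "T_pow n (\<lambda>y. a * u y + b * v y) x = a * T_pow n u x + b * T_pow n v x"
  by (simp add: T_pow_def algebra_simps)

lemma T_pow_measurable:
  assumes [measurable]: "u \<in> borel_measurable borel"
  shows "T_pow n u \<in> borel_measurable borel"
  unfolding T_pow_def[abs_def] by measurable

text \<open>
  This identity reduces \<open>L^p\<close> to \<open>L^1\<close>, with the weight \<open>exp \<phi>\<close> replaced by its \<open>p\<close>-th power.
\<close>

lemma nn_integral_T_pow:
  "(\<integral>\<^sup>+x. ennreal (norm (T_pow n u x) powr p) \<partial>\<mu>) = transfer (p *\<^sub>R \<phi>) n (\<lambda>x. norm (u x) powr p)"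
  unfolding transfer_def
  by (intro nn_integral_cong) (simp add: T_pow_def norm_mult powr_mult birkhoff_sum_scale exp_powr_real mult.commute[of p])

lemma T_pow_norm:
  assumes step: "step_bound (p *\<^sub>R \<phi>) n (C powr p)" and C: "0 \<le> C" and u: "u \<in> lp_space p \<mu>"
  shows "T_pow n u \<in> lp_space p \<mu>" and "lp_norm p \<mu> (T_pow n u) \<le> C * lp_norm p \<mu> u"
proof -
  have u_meas: "u \<in> borel_measurable borel"
    using lp_space_measurable[OF u] by (simp add: measurable_eq)
  have "(\<integral>\<^sup>+x. ennreal (norm (T_pow n u x) powr p) \<partial>\<mu>)
      \<le> ennreal (C powr p) * (\<integral>\<^sup>+x. ennreal (norm (u x) powr p) \<partial>\<mu>)"
    unfolding nn_integral_T_pow using step u_meas by (auto simp: step_bound_def)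
  also have "\<dots> = ennreal ((C * lp_norm p \<mu> u) powr p)"
    using C lp_norm_nonneg[of p \<mu> u] by (simp add: nn_integral_lp_space[OF p u] powr_mult ennreal_mult)
  finally have le: "(\<integral>\<^sup>+x. ennreal (norm (T_pow n u x) powr p) \<partial>\<mu>) \<le> ennreal ((C * lp_norm p \<mu> u) powr p)" .
  show "T_pow n u \<in> lp_space p \<mu>" "lp_norm p \<mu> (T_pow n u) \<le> C * lp_norm p \<mu> u"
    using lp_space_normI[OF p _ _ le] T_pow_measurable[OF u_meas] C lp_norm_nonneg[of p \<mu> u]
    by (simp_all add: measurable_eq)
qed

lemma T_pow_lp_space: "u \<in> lp_space p \<mu> \<Longrightarrow> T_pow n u \<in> lp_space p \<mu>"
  using T_pow_norm(1)[of n "exp (real n * norm (p *\<^sub>R \<phi>)) powr (1 / p)"] step_bound_norm[of "p *\<^sub>R \<phi>" n] p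
  by (simp add: powr_powr)

lemma T_lp_space: "u \<in> lp_space p \<mu> \<Longrightarrow> T u \<in> lp_space p \<mu>"
proof -
  assume "u \<in> lp_space p \<mu>"
  from T_pow_lp_space[OF this, of 1] show ?thesis
    using T_T_pow[of 0 u] by (simp add: T_pow_def[abs_def] weighted_composition_def birkhoff_sum_def)
qed

lemma T_pow_exponential_bound:
  assumes "growth_rate (p *\<^sub>R \<phi>) / p < s"
  obtains C where "0 < C" "\<And>n u. u \<in> lp_space p \<mu> \<Longrightarrow> lp_norm p \<mu> (T_pow n u) \<le> C * exp s ^ n * lp_norm p \<mu> u"
proof -
  have "growth_rate (p *\<^sub>R \<phi>) < p * s" using assms p by (simp add: field_simps)
  then have "growth_bound (p *\<^sub>R \<phi>) (p * s)" by (rule growth_bound_above)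
  then obtain D where D: "0 < D" "\<And>n. step_bound (p *\<^sub>R \<phi>) n (D * exp (real n * (p * s)))"
    by (auto simp: growth_bound_def)
  define C where "C = D powr (1 / p)"
  have "lp_norm p \<mu> (T_pow n u) \<le> C * exp s ^ n * lp_norm p \<mu> u" if u: "u \<in> lp_space p \<mu>" for n u
  proof (rule T_pow_norm(2)[OF _ _ u])
    have "(C * exp s ^ n) powr p = D * exp (real n * (p * s))"
      using D(1) p by (simp add: C_def powr_mult powr_powr exp_of_nat_mult[symmetric])
        (simp add: powr_def algebra_simps)
    then show "step_bound (p *\<^sub>R \<phi>) n ((C * exp s ^ n) powr p)" using D(2)[of n] by simp
    show "0 \<le> C * exp s ^ n" by (simp add: C_def)
  qed
  then show ?thesis using that[of C] D(1) by (simp add: C_def)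
qed

lemma T_pow_Neumann_telescope:
  assumes "z \<noteq> 0"
  shows "z * (\<Sum>n<N. T_pow n u x / z ^ Suc n) - T (\<lambda>y. \<Sum>n<N. T_pow n u y / z ^ Suc n) x
    = u x - T_pow N u x / z ^ N"
proof -
  have "z * (\<Sum>n<N. T_pow n u x / z ^ Suc n) - (\<Sum>n<N. T_pow (Suc n) u x / z ^ Suc n)
      = (\<Sum>n<N. T_pow n u x / z ^ n - T_pow (Suc n) u x / z ^ Suc n)"
    using assms by (simp add: sum_distrib_left sum_subtractf)
  also have "\<dots> = T_pow 0 u x / z ^ 0 - T_pow N u x / z ^ N"
    by (rule sum_lessThan_telescope')
  also have "(\<Sum>n<N. T_pow (Suc n) u x / z ^ Suc n) = T (\<lambda>y. \<Sum>n<N. T_pow n u y / z ^ Suc n) x"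
    by (simp add: weighted_composition_def sum_distrib_left times_divide_eq_right
        flip: T_T_pow)
  finally show ?thesis by simp
qed

text \<open>
  Outside the disc given by the growth rate the Neumann series converges, and it inverts
  \<open>z - T\<close> pointwise at every point where it converges absolutely, since \<open>T\<close> is evaluated pointwise.
\<close>

lemma lp_spectrum_norm_le:
  assumes z: "z \<in> lp_spectrum p \<mu> T"
  shows "norm z \<le> exp (growth_rate (p *\<^sub>R \<phi>) / p)"
proof (rule ccontr)
  assume "\<not> norm z \<le> exp (growth_rate (p *\<^sub>R \<phi>) / p)"
  then have big: "exp (growth_rate (p *\<^sub>R \<phi>) / p) < norm z" by simp
  then have z0: "0 < norm z" by (meson exp_gt_zero less_trans)
  have "growth_rate (p *\<^sub>R \<phi>) / p < ln (norm z)" using big z0 by (metis exp_less_cancel_iff exp_ln)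
  then obtain s where s: "growth_rate (p *\<^sub>R \<phi>) / p < s" "s < ln (norm z)" using dense by blast
  from s(1) obtain C where C: "0 < C"
    "\<And>n u. u \<in> lp_space p \<mu> \<Longrightarrow> lp_norm p \<mu> (T_pow n u) \<le> C * exp s ^ n * lp_norm p \<mu> u"
    by (rule T_pow_exponential_bound) blast
  define d where "d = exp s / norm z"
  have d: "0 < d" "d < 1"
    using exp_less_mono[OF s(2)] z0 unfolding exp_ln[OF z0] by (auto simp: d_def)
  define w where "w u n x = T_pow n u x / z ^ Suc n" for u n x
  define S where "S u x = (\<Sum>n. w u n x)" for u x
  define K where "K = (C / norm z) * (1 / (1 - d))"
  have w_lp: "w u n \<in> lp_space p \<mu>" and w_norm: "lp_norm p \<mu> (w u n) \<le> (C / norm z * lp_norm p \<mu> u) * d ^ n"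
    if u: "u \<in> lp_space p \<mu>" for u n
  proof -
    have eq: "w u n = (\<lambda>x. (1 / z ^ Suc n) * T_pow n u x)" by (simp add: w_def fun_eq_iff)
    show "w u n \<in> lp_space p \<mu>"
      unfolding eq by (rule lp_space_scale(1)[OF p T_pow_lp_space[OF u]])
    have "lp_norm p \<mu> (w u n) \<le> norm (1 / z ^ Suc n) * lp_norm p \<mu> (T_pow n u)"
      unfolding eq by (rule lp_space_scale(2)[OF p T_pow_lp_space[OF u]])
    also have "\<dots> \<le> norm (1 / z ^ Suc n) * (C * exp s ^ n * lp_norm p \<mu> u)"
      by (intro mult_left_mono C(2) u) auto
    also have "\<dots> = (C / norm z * lp_norm p \<mu> u) * d ^ n"
      by (simp add: d_def norm_divide norm_mult norm_power power_divide)
    finally show "lp_norm p \<mu> (w u n) \<le> (C / norm z * lp_norm p \<mu> u) * d ^ n" .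
  qed
  have geo: "(\<lambda>n. (C / norm z * l) * d ^ n) sums (K * l)" for l
    using sums_mult[OF geometric_sums[of d], of "C / norm z * l"] d by (simp add: K_def mult_ac)
  have sm: "summable (\<lambda>n. lp_norm p \<mu> (w u n))" if u: "u \<in> lp_space p \<mu>" for u
    by (rule summable_comparison_test'[OF sums_summable[OF geo[of "lp_norm p \<mu> u"]], of 0])
      (use w_norm[OF u] in \<open>simp add: lp_norm_nonneg abs_of_nonneg\<close>)
  note inf = lp_space_suminf[OF p w_lp sm]
  have sum_AE: "AE x in \<mu>. summable (\<lambda>n. norm (w u n x))" if "u \<in> lp_space p \<mu>" for u
    using inf(1)[OF that that] .
  have "lp_operator p \<mu> S"
    unfolding lp_operator_def
  proof (intro conjI ballI allI exI)
    show "S u \<in> lp_space p \<mu>" if "u \<in> lp_space p \<mu>" for u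
      using inf(2)[OF that that] unfolding S_def[abs_def] .
    show "lp_norm p \<mu> (S u) \<le> K * lp_norm p \<mu> u" if u: "u \<in> lp_space p \<mu>" for u
    proof -
      have "lp_norm p \<mu> (S u) \<le> (\<Sum>n. lp_norm p \<mu> (w u n))"
        using inf(3)[OF u u] unfolding S_def[abs_def] .
      also have "\<dots> \<le> (\<Sum>n. (C / norm z * lp_norm p \<mu> u) * d ^ n)"
        by (intro suminf_le w_norm u sm sums_summable[OF geo])
      also have "\<dots> = K * lp_norm p \<mu> u" using geo by (simp add: sums_iff)
      finally show ?thesis .
    qed
    show "AE x in \<mu>. S (\<lambda>y. a * u y + b * v y) x = a * S u x + b * S v x"
      if u: "u \<in> lp_space p \<mu>" and v: "v \<in> lp_space p \<mu>" for u v a b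
      using sum_AE[OF u] sum_AE[OF v]
    proof eventually_elim
      case (elim x)
      then have su: "summable (\<lambda>n. w u n x)" "summable (\<lambda>n. w v n x)"
        by (auto dest: summable_norm_cancel)
      have "w (\<lambda>y. a * u y + b * v y) n x = a * w u n x + b * w v n x" for n
        by (simp add: w_def T_pow_linear add_divide_distrib)
      then have "S (\<lambda>y. a * u y + b * v y) x = (\<Sum>n. a * w u n x + b * w v n x)"
        by (simp add: S_def)
      also have "\<dots> = (\<Sum>n. a * w u n x) + (\<Sum>n. b * w v n x)"
        using su by (intro suminf_add[symmetric] summable_mult)
      also have "\<dots> = a * S u x + b * S v x"
        unfolding S_def using su by (simp add: suminf_mult)
      finally show ?case .
    qed
  qed
  moreover have "(AE x in \<mu>. S (\<lambda>y. z * u y - T u y) x = u x) \<and> (AE x in \<mu>. z * S u x - T (S u) x = u x)"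
    if u: "u \<in> lp_space p \<mu>" for u
  proof -
    have zn: "z \<noteq> 0" using z0 by auto
    have telescope: "(\<lambda>n. z * w u n x - z * w u (Suc n) x) sums u x" if "summable (\<lambda>n. norm (w u n x))" for x
    proof -
      have "(\<lambda>n. z * w u n x) \<longlonglongrightarrow> z * 0"
        using summable_norm_cancel[OF that] by (intro tendsto_mult tendsto_const summable_LIMSEQ_zero)
      then have "(\<lambda>n. z * w u n x - z * w u (Suc n) x) sums (z * w u 0 x - 0)"
        by (intro telescope_sums') simp
      then show ?thesis using zn by (simp add: w_def)
    qed
    have T_w: "T (w u n) x = z * w u (Suc n) x" for n x
      using zn T_T_pow[of n u x] by (simp add: w_def weighted_composition_def)
    have "w (\<lambda>y. z * u y - T u y) n x = z * w u n x - z * w u (Suc n) x" for n x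
      using zn T_pow_linear[of n z u "-1" "T u" x] T_pow_T[of n u x]
      by (simp add: w_def diff_divide_distrib)
    then have "AE x in \<mu>. S (\<lambda>y. z * u y - T u y) x = u x"
      using sum_AE[OF u] telescope unfolding S_def sums_iff by (auto elim: eventually_mono)
    moreover have "AE x in \<mu>. z * S u x - T (S u) x = u x"
      using sum_AE[OF u] AE_funpow[OF sum_AE[OF u], of 1]
    proof eventually_elim
      case (elim x)
      then have su: "summable (\<lambda>n. w u n x)" "summable (\<lambda>n. w u n (\<alpha> x))"
        by (auto dest: summable_norm_cancel)
      have su': "summable (\<lambda>n. w u (Suc n) x)"
        using su(1) summable_Suc_iff[of "\<lambda>n. w u n x"] by simp
      have "T (S u) x = (\<Sum>n. T (w u n) x)"
        unfolding S_def weighted_composition_def using su(2) by (subst suminf_mult) auto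
      also have "\<dots> = (\<Sum>n. z * w u (Suc n) x)" by (simp add: T_w)
      finally have "z * S u x - T (S u) x = (\<Sum>n. z * w u n x) - (\<Sum>n. z * w u (Suc n) x)"
        using su(1) by (simp add: S_def suminf_mult)
      also have "\<dots> = (\<Sum>n. z * w u n x - z * w u (Suc n) x)"
        using su(1) su' by (intro suminf_diff summable_mult)
      also have "\<dots> = u x" using telescope[OF elim(1)] by (simp add: sums_iff)
      finally show ?case .
    qed
    ultimately show ?thesis ..
  qed
  ultimately have "z \<notin> lp_spectrum p \<mu> T" by (auto simp: lp_spectrum_def)
  with z show False by contradiction
qed


definition nonneg_AE :: "('a \<Rightarrow> complex) \<Rightarrow> bool" where
  "nonneg_AE u \<longleftrightarrow> (AE x in \<mu>. u x = of_real (norm (u x)))"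

lemma of_real_norm_lp_space:
  assumes "u \<in> lp_space p \<mu>"
  shows "(\<lambda>x. of_real (norm (u x))) \<in> lp_space p \<mu>"
    and "lp_norm p \<mu> (\<lambda>x. of_real (norm (u x))) \<le> lp_norm p \<mu> u"
  using lp_space_dominated[OF p assms, of "\<lambda>x. of_real (norm (u x))"] lp_space_measurable[OF assms] by auto

text \<open>
  The nearest point projection onto the nonnegative reals is pointwise closer than any nonnegative
  competitor, so that a limit of nonnegative functions is nonnegative.
\<close>

lemma nonneg_AE_approx:
  assumes w: "w \<in> lp_space p \<mu>"
    and approx: "\<And>e. 0 < e \<Longrightarrow> \<exists>v. (\<forall>x. v x = of_real (norm (v x))) \<and>
        (\<lambda>x. w x - v x) \<in> lp_space p \<mu> \<and> lp_norm p \<mu> (\<lambda>x. w x - v x) \<le> e"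
  shows "nonneg_AE w"
proof -
  define h where "h x = w x - of_real (max 0 (Re (w x)))" for x
  have [measurable]: "w \<in> borel_measurable \<mu>" using lp_space_measurable[OF w] .
  have h_meas: "h \<in> borel_measurable \<mu>" unfolding h_def[abs_def] by measurable
  have h: "h \<in> lp_space p \<mu> \<and> lp_norm p \<mu> h \<le> e" if "0 < e" for e
  proof -
    from approx[OF that] obtain v where v: "\<And>x. v x = of_real (norm (v x))"
        "(\<lambda>x. w x - v x) \<in> lp_space p \<mu>" "lp_norm p \<mu> (\<lambda>x. w x - v x) \<le> e" by blast
    have "norm (h x) \<le> norm (w x - v x)" for x
    proof -
      define r where "r = norm (v x)"
      have r: "0 \<le> r" "v x = of_real r" using v(1)[of x] by (auto simp: r_def)
      have "(Re (w x) - max 0 (Re (w x)))\<^sup>2 \<le> (Re (w x) - r)\<^sup>2"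
        using r(1) by (intro abs_le_square_iff[THEN iffD1]) (auto simp: max_def)
      then show ?thesis unfolding h_def r(2) cmod_def by simp
    qed
    then show ?thesis
      using lp_space_dominated[OF p v(2) h_meas] v(3) by auto
  qed
  have "lp_norm p \<mu> h \<le> 0" by (rule field_le_epsilon) (use h in auto)
  then have "AE x in \<mu>. h x = 0"
    using h[of 1] lp_norm_nonneg[of p \<mu> h] by (intro lp_norm_zero_AE[OF p]) auto
  then show ?thesis
    unfolding nonneg_AE_def
  proof eventually_elim
    case (elim x)
    then have "w x = of_real (max 0 (Re (w x)))" by (simp add: h_def)
    then show ?case by (metis abs_of_nonneg max.cobounded1 norm_of_real)
  qed
qed

text \<open>
  It remains to refute that \<open>\<rho> - T\<close> has a bounded inverse \<open>S\<close> when \<open>\<rho>\<close> is the growth rate.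
\<close>

context
  fixes S :: "('a \<Rightarrow> complex) \<Rightarrow> 'a \<Rightarrow> complex" and C \<rho> :: real
  assumes rho: "\<rho> = exp (growth_rate (p *\<^sub>R \<phi>) / p)"
    and S_lp: "\<And>u. u \<in> lp_space p \<mu> \<Longrightarrow> S u \<in> lp_space p \<mu>"
    and S_bound: "\<And>u. u \<in> lp_space p \<mu> \<Longrightarrow> lp_norm p \<mu> (S u) \<le> C * lp_norm p \<mu> u"
    and C: "0 < C"
    and left: "\<And>u. u \<in> lp_space p \<mu> \<Longrightarrow> AE x in \<mu>. S (\<lambda>y. of_real \<rho> * u y - T u y) x = u x"
    and right: "\<And>u. u \<in> lp_space p \<mu> \<Longrightarrow> AE x in \<mu>. of_real \<rho> * S u x - T (S u) x = u x"
begin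

lemma rho_pos: "0 < \<rho>" by (simp add: rho)

text \<open>
  For \<open>z > \<rho>\<close> the truncated Neumann series \<open>v\<close> is nonnegative. Its difference \<open>d\<close> to \<open>S u\<close>
  satisfies \<open>(\<rho> - T) d = T^N u / z^N + (z - \<rho>) v\<close>, and boundedness of \<open>S\<close> makes \<open>d\<close> small when \<open>z\<close>
  is close to \<open>\<rho>\<close> and \<open>N\<close> is large.
\<close>

lemma inverse_at_growth_rate_nonneg:
  assumes u: "u \<in> lp_space p \<mu>" and pos: "\<And>x. u x = of_real (norm (u x))"
  shows "nonneg_AE (S u)"
proof (rule nonneg_AE_approx[OF S_lp[OF u]])
  fix e :: real assume e: "0 < e"
  define l where "l = lp_norm p \<mu> (S u)"
  have l: "0 \<le> l" by (simp add: l_def lp_norm_nonneg)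
  \<comment> \<open>The first bound absorbs the multiple of the norm of \<open>d\<close> below, the second controls that of \<open>S u\<close>.\<close>
  define \<delta> where "\<delta> = min (1 / (2 * C)) (e / (4 * C * (l + 1)))"
  have "C * \<delta> \<le> C * (1 / (2 * C))" using C by (intro mult_left_mono) (auto simp: \<delta>_def)
  then have \<delta>: "0 < \<delta>" "C * \<delta> \<le> 1 / 2"
    using C e l by (auto simp: \<delta>_def)
  have "C * \<delta> * l \<le> C * (e / (4 * C * (l + 1))) * l"
    using C l by (intro mult_right_mono mult_left_mono) (auto simp: \<delta>_def)
  also have "\<dots> = (e / 4) * (l / (l + 1))" using C by simp
  also have "\<dots> \<le> (e / 4) * 1" using e l by (intro mult_left_mono) auto
  finally have \<delta>_l: "C * \<delta> * l \<le> e / 4" by simp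
  define z where "z = \<rho> + \<delta>"
  have z: "0 < z" "\<rho> < z" using rho_pos \<delta> by (auto simp: z_def)
  have "growth_rate (p *\<^sub>R \<phi>) / p < ln z"
    using z rho by (metis exp_less_cancel_iff exp_ln)
  then obtain s where s: "growth_rate (p *\<^sub>R \<phi>) / p < s" "s < ln z" using dense by blast
  from s(1) obtain D where D: "0 < D"
    "\<And>n u. u \<in> lp_space p \<mu> \<Longrightarrow> lp_norm p \<mu> (T_pow n u) \<le> D * exp s ^ n * lp_norm p \<mu> u"
    by (rule T_pow_exponential_bound) blast
  have "exp s / z < 1" using exp_less_mono[OF s(2)] z(1) by (simp del: exp_less_cancel_iff)
  then have "(\<lambda>N. (D * lp_norm p \<mu> u) * (exp s / z) ^ N) \<longlonglongrightarrow> (D * lp_norm p \<mu> u) * 0"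
    using z(1) by (intro tendsto_mult tendsto_const LIMSEQ_power_zero) auto
  then have "eventually (\<lambda>N. (D * lp_norm p \<mu> u) * (exp s / z) ^ N < e / (4 * C)) sequentially"
    using e C by (intro order_tendstoD) auto
  then obtain N where N: "(D * lp_norm p \<mu> u) * (exp s / z) ^ N < e / (4 * C)"
    by (auto simp: eventually_sequentially)
  define E where "E x = T_pow N u x / of_real z ^ N" for x
  have E_eq: "E = (\<lambda>x. (1 / of_real z ^ N) * T_pow N u x)" by (simp add: E_def fun_eq_iff)
  have E_lp: "E \<in> lp_space p \<mu>" unfolding E_eq by (rule lp_space_scale(1)[OF p T_pow_lp_space[OF u]])
  have "lp_norm p \<mu> E \<le> (1 / z ^ N) * lp_norm p \<mu> (T_pow N u)"
    using lp_space_scale(2)[OF p T_pow_lp_space[OF u], of "1 / of_real z ^ N" N] z(1)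
    unfolding E_eq by (simp add: norm_divide norm_power)
  also have "\<dots> \<le> (1 / z ^ N) * (D * exp s ^ N * lp_norm p \<mu> u)"
    using z(1) by (intro mult_left_mono D(2) u) auto
  also have "\<dots> = (D * lp_norm p \<mu> u) * (exp s / z) ^ N" by (simp add: power_divide)
  also note N
  finally have E_norm: "C * lp_norm p \<mu> E \<le> e / 4" using C by (simp add: field_simps)
  define v where "v x = (\<Sum>n<N. T_pow n u x / of_real z ^ Suc n)" for x
  define d where "d x = S u x - v x" for x
  have v_lp: "v \<in> lp_space p \<mu>"
  proof -
    have "v = (\<lambda>x. \<Sum>n<N. (1 / of_real z ^ Suc n) * T_pow n u x)" by (simp add: v_def fun_eq_iff)
    then show ?thesis by (simp only: lp_space_sum(1)[OF p lp_space_scale(1)[OF p T_pow_lp_space[OF u]]])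
  qed
  have v_pos: "v x = of_real (norm (v x))" for x
  proof -
    have "T_pow n u x / of_real z ^ Suc n
        = of_real (exp (birkhoff_sum \<phi> n x) * norm (u ((\<alpha> ^^ n) x)) / z ^ Suc n)" for n
      by (subst T_pow_def, subst pos) simp
    then have "v x = of_real (\<Sum>n<N. exp (birkhoff_sum \<phi> n x) * norm (u ((\<alpha> ^^ n) x)) / z ^ Suc n)"
      by (simp only: v_def of_real_sum)
    moreover have "0 \<le> (\<Sum>n<N. exp (birkhoff_sum \<phi> n x) * norm (u ((\<alpha> ^^ n) x)) / z ^ Suc n)"
      using z(1) by (intro sum_nonneg) auto
    ultimately show ?thesis by (metis abs_of_nonneg norm_of_real)
  qed
  have d_lp: "d \<in> lp_space p \<mu>" unfolding d_def[abs_def] by (rule lp_space_diff(1)[OF p S_lp[OF u] v_lp])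
  \<comment> \<open>\<open>b\<close> is what the left inverse \<open>S\<close> maps back to \<open>d\<close>, and \<open>b'\<close> is its explicit small representative.\<close>
  define b where "b x = of_real \<rho> * d x - T d x" for x
  define b' where "b' x = E x + of_real \<delta> * v x" for x
  have b_lp: "b \<in> lp_space p \<mu>" unfolding b_def[abs_def]
    by (intro lp_space_diff(1)[OF p] lp_space_scale(1)[OF p] T_lp_space d_lp)
  have b'_lp: "b' \<in> lp_space p \<mu>" unfolding b'_def[abs_def]
    by (intro lp_space_add(1)[OF p] lp_space_scale(1)[OF p] E_lp v_lp)
  have "AE x in \<mu>. b x = b' x"
    using right[OF u]
  proof eventually_elim
    case (elim x)
    have "of_real z * v x - T v x = u x - E x"
      using T_pow_Neumann_telescope[where z = "of_real z" and N = N and u = u and x = x] z(1) unfolding v_def[abs_def] E_def by simp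
    moreover have "T d x = T (S u) x - T v x"
      by (simp add: weighted_composition_def d_def right_diff_distrib)
    ultimately show ?case
      using elim unfolding b_def b'_def d_def[of x] z_def of_real_add by algebra
  qed
  then have b_norm: "lp_norm p \<mu> b = lp_norm p \<mu> b'" by (rule lp_norm_cong_AE[OF p b_lp b'_lp])
  have "lp_norm p \<mu> v = lp_norm p \<mu> (\<lambda>x. S u x - d x)" by (simp add: d_def)
  also have "\<dots> \<le> l + lp_norm p \<mu> d"
    unfolding l_def by (rule lp_space_diff(2)[OF p S_lp[OF u] d_lp])
  finally have v_norm: "lp_norm p \<mu> v \<le> l + lp_norm p \<mu> d" .
  have "lp_norm p \<mu> d = lp_norm p \<mu> (S b)"
    using left[OF d_lp] unfolding b_def[abs_def, symmetric]
    by (intro lp_norm_cong_AE[OF p d_lp S_lp[OF b_lp]]) (auto elim: eventually_mono)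
  also have "\<dots> \<le> C * lp_norm p \<mu> b'" using S_bound[OF b_lp] by (simp add: b_norm)
  also have "\<dots> \<le> C * (lp_norm p \<mu> E + \<delta> * lp_norm p \<mu> v)"
    using lp_space_add(2)[OF p E_lp lp_space_scale(1)[OF p v_lp, of "of_real \<delta>"]]
      lp_space_scale(2)[OF p v_lp, of "of_real \<delta>"] C \<delta> unfolding b'_def[abs_def] by simp
  also have "\<dots> \<le> C * (lp_norm p \<mu> E + \<delta> * (l + lp_norm p \<mu> d))"
    using v_norm C \<delta> by (intro mult_left_mono add_left_mono) auto
  also have "\<dots> = C * lp_norm p \<mu> E + C * \<delta> * l + C * \<delta> * lp_norm p \<mu> d"
    by (simp add: algebra_simps)
  also have "\<dots> \<le> e / 4 + e / 4 + (1 / 2) * lp_norm p \<mu> d"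
    using E_norm \<delta>_l \<delta>(2) lp_norm_nonneg[of p \<mu> d] by (intro add_mono mult_right_mono)
  finally have "lp_norm p \<mu> d \<le> e" by simp
  then show "\<exists>v. (\<forall>x. v x = of_real (norm (v x))) \<and> (\<lambda>x. S u x - v x) \<in> lp_space p \<mu>
      \<and> lp_norm p \<mu> (\<lambda>x. S u x - v x) \<le> e"
    using v_pos d_lp unfolding d_def[abs_def] by blast
qed

text \<open>
  In terms of \<open>A = T / \<rho>\<close> and \<open>R = \<rho> S\<close>, positivity of \<open>R u\<close> for \<open>u \<ge> 0\<close> turns \<open>R u = u + A (R u)\<close> into
  \<open>R u \<ge> A^m u\<close> for all \<open>m\<close>. Applying \<open>R\<close> once more adds up \<open>n\<close> such lower bounds.
\<close>

lemma inverse_at_growth_rate_step: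
  assumes u: "u \<in> lp_space p \<mu>"
  shows "real n * (lp_norm p \<mu> (\<lambda>x. T_pow n u x / of_real \<rho> ^ n)) \<le> (\<rho> * C)\<^sup>2 * lp_norm p \<mu> u"
proof -
  define R :: "('a \<Rightarrow> complex) \<Rightarrow> 'a \<Rightarrow> complex" where "R w x = of_real (norm (of_real \<rho> * S w x))" for w x
  have norm_R: "norm (R w x) = \<rho> * norm (S w x)" for w x
    using rho_pos by (simp add: R_def norm_mult)
  have R_lp: "R w \<in> lp_space p \<mu>" and R_norm: "lp_norm p \<mu> (R w) \<le> \<rho> * C * lp_norm p \<mu> w"
    if w: "w \<in> lp_space p \<mu>" for w
  proof -
    note S = S_lp[OF w]
    note lp = lp_space_scale[OF p S, of "of_real \<rho>"]
    show "R w \<in> lp_space p \<mu>" unfolding R_def[abs_def] by (rule of_real_norm_lp_space(1)[OF lp(1)])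
    have "lp_norm p \<mu> (R w) \<le> \<rho> * lp_norm p \<mu> (S w)"
      using order_trans[OF of_real_norm_lp_space(2)[OF lp(1)] lp(2)] rho_pos unfolding R_def[abs_def] by simp
    also have "\<dots> \<le> \<rho> * (C * lp_norm p \<mu> w)" using rho_pos by (intro mult_left_mono S_bound w) auto
    finally show "lp_norm p \<mu> (R w) \<le> \<rho> * C * lp_norm p \<mu> w" by (simp add: mult.assoc)
  qed
  have R_rec: "AE x in \<mu>. norm (R w x) = norm (w x) + exp (apply_bcontfun \<phi> x) / \<rho> * norm (R w (\<alpha> x))"
    if w: "w \<in> lp_space p \<mu>" "\<And>x. w x = of_real (norm (w x))" for w
  proof -
    have nn: "AE x in \<mu>. S w x = of_real (norm (S w x))"
      using inverse_at_growth_rate_nonneg[OF w] by (simp add: nonneg_AE_def)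
    show ?thesis
      using right[OF w(1)] nn AE_funpow[OF nn, of 1]
    proof eventually_elim
      case (elim x)
      have "of_real \<rho> * of_real (norm (S w x))
          = (of_real (norm (w x)) + of_real (exp (apply_bcontfun \<phi> x)) * of_real (norm (S w (\<alpha> x))) :: complex)"
        using elim w(2)[of x] by (simp add: weighted_composition_def algebra_simps)
      then have "\<rho> * norm (S w x) = norm (w x) + exp (apply_bcontfun \<phi> x) * norm (S w (\<alpha> x))"
        by (metis of_real_add of_real_eq_iff of_real_mult)
      then show ?case
        unfolding norm_R using rho_pos by (simp add: add_divide_distrib)
    qed
  qed
  define f where "f x = complex_of_real (norm (u x))" for x
  have f_lp: "f \<in> lp_space p \<mu>" and f_norm: "lp_norm p \<mu> f \<le> lp_norm p \<mu> u"
    using of_real_norm_lp_space[OF u] by (simp_all add: f_def[abs_def])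
  have f_pos: "f x = of_real (norm (f x))" for x by (simp add: f_def)
  have R_pos: "R w x = of_real (norm (R w x))" for w x by (simp add: R_def)
  define a where "a n x = exp (birkhoff_sum \<phi> n x) / \<rho> ^ n * norm (u ((\<alpha> ^^ n) x))" for n x
  have a0: "0 \<le> a n x" for n x using rho_pos by (simp add: a_def)
  have a_Suc: "a (Suc n) x = exp (apply_bcontfun \<phi> x) / \<rho> * a n (\<alpha> x)" for n x
    by (simp add: a_def birkhoff_sum_Suc exp_add funpow_swap1)
  have once: "AE x in \<mu>. a n x \<le> norm (R f x)" for n
  proof (induction n)
    case 0
    show ?case using R_rec[OF f_lp f_pos]
      by eventually_elim (use rho_pos in \<open>simp add: a_def birkhoff_sum_def f_def\<close>)
  next
    case (Suc n)
    show ?case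
      using R_rec[OF f_lp f_pos] AE_funpow[OF Suc, of 1]
    proof eventually_elim
      case (elim x)
      have "exp (apply_bcontfun \<phi> x) / \<rho> * a n (\<alpha> x) \<le> exp (apply_bcontfun \<phi> x) / \<rho> * norm (R f (\<alpha> x))"
        using elim(2) rho_pos by (intro mult_left_mono) auto
      then show ?case using elim(1) norm_ge_zero[of "f x"] unfolding a_Suc by linarith
    qed
  qed
  have twice: "AE x in \<mu>. real n * a n x \<le> norm (R (R f) x)"
  proof (induction n)
    case 0
    show ?case by simp
  next
    case (Suc n)
    show ?case
      using R_rec[OF R_lp[OF f_lp] R_pos] once[of "Suc n"] AE_funpow[OF Suc, of 1]
    proof eventually_elim
      case (elim x)
      have "exp (apply_bcontfun \<phi> x) / \<rho> * (real n * a n (\<alpha> x))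
          \<le> exp (apply_bcontfun \<phi> x) / \<rho> * norm (R (R f) (\<alpha> x))"
        using elim(3) rho_pos by (intro mult_left_mono) auto
      then have "real n * a (Suc n) x + a (Suc n) x \<le> norm (R (R f) x)"
        using elim(1,2) unfolding a_Suc by (simp add: mult_ac)
      then show ?case by (simp add: algebra_simps)
    qed
  qed
  have An_lp: "(\<lambda>x. T_pow n u x / of_real \<rho> ^ n) \<in> lp_space p \<mu>"
    using lp_space_scale(1)[OF p T_pow_lp_space[OF u], of "1 / of_real \<rho> ^ n"] by simp
  have An_norm: "norm (T_pow n u x / of_real \<rho> ^ n) = a n x" for x
    using rho_pos by (simp add: a_def T_pow_def norm_mult norm_divide norm_power)
  show ?thesis
  proof (cases "n = 0")
    case True
    then show ?thesis using lp_norm_nonneg[of p \<mu> u] by simp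
  next
    case False
    have RR: "(\<lambda>x. of_real (1 / real n) * R (R f) x) \<in> lp_space p \<mu>"
      by (intro lp_space_scale(1)[OF p] R_lp f_lp)
    have "lp_norm p \<mu> (\<lambda>x. T_pow n u x / of_real \<rho> ^ n)
        \<le> lp_norm p \<mu> (\<lambda>x. of_real (1 / real n) * R (R f) x)"
    proof (rule lp_space_dominated(2)[OF p RR lp_space_measurable[OF An_lp]])
      show "AE x in \<mu>. norm (T_pow n u x / of_real \<rho> ^ n) \<le> norm (of_real (1 / real n) * R (R f) x)"
        using twice unfolding An_norm
        by eventually_elim (use False in \<open>simp add: norm_mult norm_divide field_simps\<close>)
    qed
    also have "\<dots> \<le> (1 / real n) * lp_norm p \<mu> (R (R f))"
      using lp_space_scale(2)[OF p R_lp[OF R_lp[OF f_lp]], of "of_real (1 / real n)"] by (simp add: norm_divide)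
    finally have "real n * lp_norm p \<mu> (\<lambda>x. T_pow n u x / of_real \<rho> ^ n) \<le> lp_norm p \<mu> (R (R f))"
      using False by (simp add: field_simps)
    also have "\<dots> \<le> \<rho> * C * lp_norm p \<mu> (R f)" by (rule R_norm[OF R_lp[OF f_lp]])
    also have "\<dots> \<le> \<rho> * C * (\<rho> * C * lp_norm p \<mu> f)"
      using rho_pos C by (intro mult_left_mono R_norm f_lp) auto
    also have "\<dots> \<le> \<rho> * C * (\<rho> * C * lp_norm p \<mu> u)"
      using rho_pos C by (intro mult_left_mono f_norm) auto
    finally show ?thesis by (simp add: power2_eq_square mult_ac)
  qed
qed

text \<open>
  The preceding bound makes the norm of \<open>T^n / \<rho>^n\<close> smaller than one half for some \<open>n\<close>, so that the
  powers of \<open>T\<close> grow at a strictly smaller rate than \<open>\<rho>\<close>.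
\<close>

lemma inverse_at_growth_rate_False: False
proof -
  define K where "K = (\<rho> * C)\<^sup>2"
  have K: "0 < K" using rho_pos C by (simp add: K_def)
  obtain n where n: "2 * K < real n" using reals_Archimedean2 by blast
  then have n0: "0 < n" using K by (cases n) auto
  have step: "step_bound (p *\<^sub>R \<phi>) n ((1/2 * \<rho> ^ n) powr p)"
    unfolding step_bound_def
  proof (intro ballI impI)
    fix f :: "'a \<Rightarrow> real" assume f: "f \<in> borel_measurable borel" "\<forall>x. 0 \<le> f x"
    note [measurable] = f(1)
    define u where "u x = complex_of_real (f x powr (1 / p))" for x
    have u_norm: "norm (u x) powr p = f x" for x
      using f(2) p by (simp add: u_def powr_powr)
    have u_meas: "u \<in> borel_measurable \<mu>" unfolding measurable_eq u_def[abs_def] by measurable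
    show "transfer (p *\<^sub>R \<phi>) n f \<le> ennreal ((1/2 * \<rho> ^ n) powr p) * (\<integral>\<^sup>+x. ennreal (f x) \<partial>\<mu>)"
    proof (cases "(\<integral>\<^sup>+x. ennreal (f x) \<partial>\<mu>) = \<infinity>")
      case True
      then show ?thesis using rho_pos by (simp add: ennreal_mult_top)
    next
      case False
      have u: "u \<in> lp_space p \<mu>"
        using False u_meas f(2) unfolding lp_space_def
        by (auto simp: u_norm less_top measurable_eq intro!: integrableI_nonneg)
      have T_eq: "T_pow n u = (\<lambda>x. of_real \<rho> ^ n * (T_pow n u x / of_real \<rho> ^ n))"
        using rho_pos by (simp add: fun_eq_iff)
      have An_lp: "(\<lambda>x. T_pow n u x / of_real \<rho> ^ n) \<in> lp_space p \<mu>"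
        using lp_space_scale(1)[OF p T_pow_lp_space[OF u], of "1 / of_real \<rho> ^ n"] by simp
      have "real n * lp_norm p \<mu> (T_pow n u) \<le> \<rho> ^ n * (real n * lp_norm p \<mu> (\<lambda>x. T_pow n u x / of_real \<rho> ^ n))"
        using lp_space_scale(2)[OF p An_lp, of "of_real \<rho> ^ n"] rho_pos
        unfolding T_eq[symmetric] by (simp add: norm_power mult_left_mono mult.left_commute)
      also have "\<dots> \<le> \<rho> ^ n * (K * lp_norm p \<mu> u)"
        using inverse_at_growth_rate_step[OF u, of n] rho_pos unfolding K_def by (intro mult_left_mono) auto
      also have "\<dots> \<le> \<rho> ^ n * (real n / 2 * lp_norm p \<mu> u)"
        using n rho_pos lp_norm_nonneg[of p \<mu> u] by (intro mult_left_mono mult_right_mono) auto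
      finally have le: "lp_norm p \<mu> (T_pow n u) \<le> 1/2 * \<rho> ^ n * lp_norm p \<mu> u"
        using n0 by simp
      have "transfer (p *\<^sub>R \<phi>) n f = ennreal (lp_norm p \<mu> (T_pow n u) powr p)"
        using nn_integral_T_pow[of n u] nn_integral_lp_space[OF p T_pow_lp_space[OF u], of n]
        by (simp add: u_norm)
      also have "\<dots> \<le> ennreal ((1/2 * \<rho> ^ n * lp_norm p \<mu> u) powr p)"
        using le p by (intro ennreal_leI powr_mono2) (auto simp: lp_norm_nonneg)
      also have "\<dots> = ennreal ((1/2 * \<rho> ^ n) powr p) * ennreal (lp_norm p \<mu> u powr p)"
        using rho_pos lp_norm_nonneg[of p \<mu> u] by (subst powr_mult) (auto simp: ennreal_mult)
      also have "ennreal (lp_norm p \<mu> u powr p) = (\<integral>\<^sup>+x. ennreal (f x) \<partial>\<mu>)"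
        using nn_integral_lp_space[OF p u] by (simp add: u_norm)
      finally show ?thesis .
    qed
  qed
  define s where "s = growth_rate (p *\<^sub>R \<phi>) - p * ln 2 / real n"
  have "(1/2 * \<rho> ^ n) powr p = exp (real n * s)"
  proof -
    have "ln (1/2 * \<rho> ^ n) = real n * (growth_rate (p *\<^sub>R \<phi>) / p) - ln 2"
      using rho_pos by (simp add: ln_mult ln_div ln_realpow rho)
    then have "p * ln (1/2 * \<rho> ^ n) = real n * s"
      unfolding s_def using n0 p by (simp only:) (simp add: right_diff_distrib)
    then show ?thesis using rho_pos by (simp add: powr_def)
  qed
  with step have "growth_bound (p *\<^sub>R \<phi>) s"
    by (intro growth_bound_from_step[OF n0]) simp
  then have "growth_rate (p *\<^sub>R \<phi>) \<le> s" by (rule growth_rate_le)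
  then show False using p n0 by (simp add: s_def divide_le_0_iff mult_le_0_iff not_le)
qed

end

lemma growth_rate_in_lp_spectrum: "of_real (exp (growth_rate (p *\<^sub>R \<phi>) / p)) \<in> lp_spectrum p \<mu> T"
proof (rule ccontr)
  define \<rho> where "\<rho> = exp (growth_rate (p *\<^sub>R \<phi>) / p)"
  assume "\<not> ?thesis"
  then obtain S where S: "lp_operator p \<mu> S"
    "\<And>u. u \<in> lp_space p \<mu> \<Longrightarrow> AE x in \<mu>. S (\<lambda>y. of_real \<rho> * u y - T u y) x = u x"
    "\<And>u. u \<in> lp_space p \<mu> \<Longrightarrow> AE x in \<mu>. of_real \<rho> * S u x - T (S u) x = u x"
    by (auto simp: lp_spectrum_def \<rho>_def)
  from S(1) obtain C where C: "\<And>u. u \<in> lp_space p \<mu> \<Longrightarrow> lp_norm p \<mu> (S u) \<le> C * lp_norm p \<mu> u"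
    unfolding lp_operator_def by blast
  have "lp_norm p \<mu> (S u) \<le> max C 1 * lp_norm p \<mu> u" if "u \<in> lp_space p \<mu>" for u
    using C[OF that] mult_right_mono[of C "max C 1" "lp_norm p \<mu> u"] lp_norm_nonneg[of p \<mu> u] by simp
  with S show False
    by (intro inverse_at_growth_rate_False[OF \<rho>_def, of S "max C 1"]) (auto simp: lp_operator_def)
qed

theorem log_spectral_radius_eq_growth_rate:
  "log_spectral_radius p \<mu> \<alpha> \<phi> = growth_rate (p *\<^sub>R \<phi>) / p"
proof -
  have "lp_spectral_radius p \<mu> T = exp (growth_rate (p *\<^sub>R \<phi>) / p)"
    unfolding lp_spectral_radius_def
  proof (rule cSup_eq_maximum)
    show "exp (growth_rate (p *\<^sub>R \<phi>) / p) \<in> norm ` lp_spectrum p \<mu> T"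
      by (rule image_eqI[OF _ growth_rate_in_lp_spectrum]) simp
  qed (use lp_spectrum_norm_le in auto)
  then show ?thesis by (simp add: log_spectral_radius_def)
qed

end

end

section \<open>The cumulant generating function and its biconjugate\<close>

lemma ext_ln_mono: "x \<le> y \<Longrightarrow> ext_ln x \<le> ext_ln y"
  by (cases x; cases y) (auto simp: ext_ln_def ennreal_eq_0_iff ln_mono top_unique)

lemma ext_ln_ennreal: "0 < r \<Longrightarrow> ext_ln (ennreal r) = ereal (ln r)"
  by (simp add: ext_ln_def ennreal_eq_0_iff)

lemma ext_ln_le_ereal_iff: "ext_ln x \<le> ereal y \<longleftrightarrow> x \<le> ennreal (exp y)"
proof (cases x)
  case (real r)
  show ?thesis
  proof (cases "r = 0")
    case False
    then have r: "0 < r" using real by simp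
    then have "ln r \<le> y \<longleftrightarrow> r \<le> exp y" by (metis exp_le_cancel_iff exp_ln)
    then show ?thesis using r real by (simp add: ext_ln_ennreal)
  qed (simp add: real ext_ln_def)
next
  case top
  then show ?thesis by (simp add: ext_ln_def top_unique)
qed

locale nat_random_variable = prob_space \<Omega> for \<Omega> :: "'b measure" +
  fixes X :: "'b \<Rightarrow> nat"
  assumes X_measurable [measurable]: "X \<in> measurable \<Omega> (count_space UNIV)"
begin

definition weight :: "nat \<Rightarrow> real" where
  "weight n = prob {\<omega> \<in> space \<Omega>. X \<omega> = n}"

lemma weight_nonneg: "0 \<le> weight n" by (simp add: weight_def)

lemma mgf_eq_suminf: "mgf \<Omega> X t = (\<Sum>n. ennreal (weight n * exp (t * real n)))"
proof -
  have "mgf \<Omega> X t = (\<integral>\<^sup>+n. ennreal (exp (t * real n)) \<partial>distr \<Omega> (count_space UNIV) X)"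
    unfolding mgf_def by (subst nn_integral_distr) auto
  also have "\<dots> = (\<integral>\<^sup>+\<omega>. (\<Sum>n. ennreal (exp (t * real n)) * indicator {\<omega> \<in> space \<Omega>. X \<omega> = n} \<omega>) \<partial>\<Omega>)"
  proof (subst nn_integral_distr, simp, simp, rule nn_integral_cong)
    fix \<omega> assume "\<omega> \<in> space \<Omega>"
    then have "(\<Sum>n. ennreal (exp (t * real n)) * indicator {\<omega> \<in> space \<Omega>. X \<omega> = n} \<omega>)
        = (\<Sum>n\<in>{X \<omega>}. ennreal (exp (t * real n)) * indicator {\<omega> \<in> space \<Omega>. X \<omega> = n} \<omega>)"
      by (intro suminf_finite) auto
    then show "ennreal (exp (t * real (X \<omega>)))
        = (\<Sum>n. ennreal (exp (t * real n)) * indicator {\<omega> \<in> space \<Omega>. X \<omega> = n} \<omega>)"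
      using \<open>\<omega> \<in> space \<Omega>\<close> by simp
  qed
  also have "\<dots> = (\<Sum>n. \<integral>\<^sup>+\<omega>. ennreal (exp (t * real n)) * indicator {\<omega> \<in> space \<Omega>. X \<omega> = n} \<omega> \<partial>\<Omega>)"
    by (rule nn_integral_suminf) measurable
  also have "\<dots> = (\<Sum>n. ennreal (weight n * exp (t * real n)))"
    by (simp add: nn_integral_cmult_indicator emeasure_eq_measure weight_def ennreal_mult mult.commute)
  finally show ?thesis .
qed

lemma mgf_mono: "s \<le> t \<Longrightarrow> mgf \<Omega> X s \<le> mgf \<Omega> X t"
  unfolding mgf_def by (intro nn_integral_mono ennreal_leI) (auto intro: mult_right_mono)

lemma mgf_0: "mgf \<Omega> X 0 = 1"
  by (simp add: mgf_def emeasure_space_1)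

lemma mgf_pos: "0 < mgf \<Omega> X t"
proof -
  have "mgf \<Omega> X t \<noteq> 0"
    unfolding mgf_def by (subst nn_integral_0_iff_AE) (auto simp: ennreal_eq_0_iff not_le AE_False)
  then show ?thesis by (simp add: zero_less_iff_neq_zero)
qed

lemma ln_mgf_mono: "s \<le> t \<Longrightarrow> ln_mgf \<Omega> X s \<le> ln_mgf \<Omega> X t"
  unfolding ln_mgf_def by (intro ext_ln_mono mgf_mono)

lemma ln_mgf_0: "ln_mgf \<Omega> X 0 = 0"
  by (simp add: ln_mgf_def mgf_0 ext_ln_def)

lemma ln_mgf_not_MInf: "ln_mgf \<Omega> X t \<noteq> - \<infinity>"
  using mgf_pos[of t] by (simp add: ln_mgf_def ext_ln_def)

lemma cramer_transform_upper: "ereal (a * t) - ln_mgf \<Omega> X t \<le> cramer_transform \<Omega> X a"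
  unfolding cramer_transform_def convex_conjugate_def by (intro SUP_upper) simp

lemma cramer_transform_nonneg: "0 \<le> cramer_transform \<Omega> X a"
  using cramer_transform_upper[of a 0] by (simp add: ln_mgf_0 zero_ereal_def)

text \<open>\<open>X\<close> is nonnegative, so that \<open>ln_mgf\<close> is bounded above on the negative half-line.\<close>

lemma effective_domain_cramer_nonneg:
  assumes "a \<in> effective_domain (cramer_transform \<Omega> X)"
  shows "0 \<le> a"
proof (rule ccontr)
  assume neg: "\<not> 0 \<le> a"
  have fin: "cramer_transform \<Omega> X a < \<infinity>" using assms by (simp add: effective_domain_def)
  then obtain c where c: "cramer_transform \<Omega> X a = ereal c"
    using cramer_transform_nonneg[of a] by (cases "cramer_transform \<Omega> X a") auto
  have c0: "0 \<le> c" using cramer_transform_nonneg[of a] c by simp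
  define t where "t = (c + 1) / a"
  have "t \<le> 0" using neg c0 by (simp add: t_def divide_nonneg_neg)
  then have "ln_mgf \<Omega> X t \<le> 0" using ln_mgf_mono[of t 0] by (simp add: ln_mgf_0)
  then have "ereal (a * t) - 0 \<le> ereal (a * t) - ln_mgf \<Omega> X t" by (intro ereal_minus_mono) auto
  also have "\<dots> \<le> ereal c" using cramer_transform_upper[of a t] by (simp add: c)
  finally show False using neg by (simp add: t_def)
qed

text \<open>
  The truncated function \<open>ln (\<Sum>n<N. p\<^sub>n exp (n t))\<close> lies above its tangent at \<open>t\<^sub>0\<close>
  (Jensen's inequality for the exponential). As it lies below \<open>ln_mgf\<close>, its tangents are affine
  minorants of \<open>ln_mgf\<close>, even where the latter is infinite.
\<close>

lemma truncated_ln_mgf_tangent: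
  fixes t0 :: real and N :: nat
  defines "M \<equiv> (\<Sum>n<N. weight n * exp (t0 * real n))"
  assumes M: "0 < M"
  shows "\<exists>a. a \<in> effective_domain (cramer_transform \<Omega> X)
    \<and> ereal (ln M) \<le> ereal (a * t0) - cramer_transform \<Omega> X a"
proof -
  define v where "v n = weight n * exp (t0 * real n) / M" for n
  define a where "a = (\<Sum>n<N. v n * real n)"
  have v: "0 \<le> v n" for n using M by (simp add: v_def weight_nonneg)
  have sum_v: "(\<Sum>n<N. v n) = 1"
    using M by (simp add: v_def M_def flip: sum_divide_distrib)
  have minorant: "ereal (ln M + a * (t - t0)) \<le> ln_mgf \<Omega> X t" for t
  proof -
    define s where "s = t - t0"
    have "exp (a * s) = exp (a * s) * (\<Sum>n<N. v n * (1 + (real n * s - a * s)))"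
    proof -
      \<comment> \<open>\<open>a\<close> is the mean of the weights \<open>v\<close>, so that the linear terms cancel.\<close>
      have "(\<Sum>n<N. v n * (1 + (real n * s - a * s))) = (\<Sum>n<N. v n * (1 - a * s) + s * (v n * real n))"
        by (simp add: algebra_simps)
      also have "\<dots> = (\<Sum>n<N. v n) * (1 - a * s) + s * a"
        unfolding sum.distrib sum_distrib_right[symmetric] sum_distrib_left[symmetric] by (simp add: a_def)
      finally have "(\<Sum>n<N. v n * (1 + (real n * s - a * s))) = (\<Sum>n<N. v n) * (1 - a * s) + s * a" .
      then show ?thesis by (simp add: sum_v)
    qed
    also have "\<dots> = (\<Sum>n<N. v n * (exp (a * s) * (1 + (real n * s - a * s))))"
      by (simp add: sum_distrib_left mult_ac)
    also have "\<dots> \<le> (\<Sum>n<N. v n * exp (real n * s))"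
    proof (intro sum_mono mult_left_mono v)
      fix n
      have "exp (a * s) * (1 + (real n * s - a * s)) \<le> exp (a * s) * exp (real n * s - a * s)"
        by (intro mult_left_mono exp_ge_add_one_self) auto
      then show "exp (a * s) * (1 + (real n * s - a * s)) \<le> exp (real n * s)"
        by (simp flip: exp_add)
    qed
    finally have "M * exp (a * s) \<le> M * (\<Sum>n<N. v n * exp (real n * s))"
      using M by simp
    also have "\<dots> = (\<Sum>n<N. weight n * exp (t * real n))"
      using M by (simp add: v_def s_def sum_distrib_left algebra_simps exp_diff exp_add)
    finally have le: "M * exp (a * s) \<le> (\<Sum>n<N. weight n * exp (t * real n))" .
    have "ennreal (M * exp (a * s)) \<le> (\<Sum>n<N. ennreal (weight n * exp (t * real n)))"
      using le by (simp add: weight_nonneg ennreal_leI)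
    also have "\<dots> \<le> mgf \<Omega> X t"
      unfolding mgf_eq_suminf by (intro sum_le_suminf) auto
    finally have "ext_ln (ennreal (M * exp (a * s))) \<le> ln_mgf \<Omega> X t"
      unfolding ln_mgf_def by (rule ext_ln_mono)
    then show ?thesis
      using M by (simp add: ext_ln_ennreal ln_mult s_def)
  qed
  have le: "cramer_transform \<Omega> X a \<le> ereal (a * t0 - ln M)"
    unfolding cramer_transform_def convex_conjugate_def
  proof (rule SUP_least)
    fix t
    show "ereal (a * t) - ln_mgf \<Omega> X t \<le> ereal (a * t0 - ln M)"
      using minorant[of t] by (cases "ln_mgf \<Omega> X t") (auto simp: algebra_simps)
  qed
  show ?thesis
  proof (intro exI conjI)
    show "a \<in> effective_domain (cramer_transform \<Omega> X)"
      using le by (auto simp: effective_domain_def intro: le_less_trans)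
    show "ereal (ln M) \<le> ereal (a * t0) - cramer_transform \<Omega> X a"
      using le by (cases "cramer_transform \<Omega> X a") auto
  qed
qed

text \<open>Fenchel--Moreau for the cumulant generating function, including the points where it is infinite.\<close>

theorem ln_mgf_le_biconjugate:
  "ln_mgf \<Omega> X t \<le> (SUP a\<in>effective_domain (cramer_transform \<Omega> X). ereal (a * t) - cramer_transform \<Omega> X a)"
  (is "_ \<le> ?s")
proof (cases ?s)
  case PInf
  then show ?thesis by simp
next
  case MInf
  define M where "M N = (\<Sum>n<N. weight n * exp (t * real n))" for N :: nat
  have M0: "0 \<le> M N" for N unfolding M_def by (intro sum_nonneg) (simp add: weight_nonneg)
  have "M N = 0" for N
  proof (rule ccontr)
    assume "M N \<noteq> 0"
    then have "0 < M N" using M0[of N] by simp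
    from truncated_ln_mgf_tangent[OF this[unfolded M_def]] obtain a
      where a: "a \<in> effective_domain (cramer_transform \<Omega> X)"
        "ereal (ln (M N)) \<le> ereal (a * t) - cramer_transform \<Omega> X a" unfolding M_def by blast
    have "ereal (ln (M N)) \<le> ?s" using a by (meson SUP_upper order_trans)
    with MInf show False by simp
  qed
  then have "(\<Sum>n<N. ennreal (weight n * exp (t * real n))) \<le> 0" for N
    by (simp add: M_def weight_nonneg)
  then have "mgf \<Omega> X t \<le> 0"
    unfolding mgf_eq_suminf by (intro suminf_le_const) auto
  then show ?thesis using mgf_pos[of t] by simp
next
  case (real r)
  have "(\<Sum>n<N. ennreal (weight n * exp (t * real n))) \<le> ennreal (exp r)" for N
  proof -
    define M where "M = (\<Sum>n<N. weight n * exp (t * real n))"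
    have M0: "0 \<le> M" unfolding M_def by (intro sum_nonneg) (simp add: weight_nonneg)
    have "M \<le> exp r"
    proof (cases "M = 0")
      case False
      then have M: "0 < M" using M0 by simp
      from truncated_ln_mgf_tangent[OF M[unfolded M_def]] obtain a
        where a: "a \<in> effective_domain (cramer_transform \<Omega> X)"
          "ereal (ln M) \<le> ereal (a * t) - cramer_transform \<Omega> X a" unfolding M_def by blast
      have "ereal (ln M) \<le> ?s" using a by (meson SUP_upper order_trans)
      then have "ln M \<le> r" using real by simp
      then show ?thesis using M by (metis exp_le_cancel_iff exp_ln)
    qed simp
    then show ?thesis by (simp add: M_def weight_nonneg ennreal_leI)
  qed
  then have "mgf \<Omega> X t \<le> ennreal (exp r)"
    unfolding mgf_eq_suminf by (intro suminf_le_const) auto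
  then show ?thesis unfolding real ln_mgf_def ext_ln_le_ereal_iff .
qed

text \<open>
  As \<open>t\<close> tends to minus infinity every term of the series but the one for \<open>n = 0\<close> vanishes.
\<close>

lemma INF_ln_mgf: "(INF t. ln_mgf \<Omega> X t) = ext_ln (ennreal (weight 0))"
proof (rule antisym)
  have "weight 0 = weight 0 * exp (t * real 0)" for t by simp
  then have "ennreal (weight 0) \<le> mgf \<Omega> X t" for t
    unfolding mgf_eq_suminf
    using sum_le_suminf[of "\<lambda>n. ennreal (weight n * exp (t * real n))" "{0}"] by simp
  then show "ext_ln (ennreal (weight 0)) \<le> (INF t. ln_mgf \<Omega> X t)"
    unfolding ln_mgf_def by (intro INF_greatest ext_ln_mono)
  have bound: "mgf \<Omega> X t \<le> ennreal (weight 0 + exp t)" if "t \<le> 0" for t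
  proof -
    have "mgf \<Omega> X t \<le> (\<integral>\<^sup>+\<omega>. indicator {\<omega> \<in> space \<Omega>. X \<omega> = 0} \<omega> + ennreal (exp t) \<partial>\<Omega>)"
      unfolding mgf_def
    proof (rule nn_integral_mono)
      fix \<omega> assume "\<omega> \<in> space \<Omega>"
      moreover have "exp (t * real (X \<omega>)) \<le> exp t" if "X \<omega> \<noteq> 0"
        using \<open>t \<le> 0\<close> that mult_left_mono_neg[of 1 "real (X \<omega>)" t] by simp
      ultimately show "ennreal (exp (t * real (X \<omega>)))
          \<le> indicator {\<omega> \<in> space \<Omega>. X \<omega> = 0} \<omega> + ennreal (exp t)"
        by (cases "X \<omega> = 0") (auto simp: ennreal_leI)
    qed
    also have "\<dots> = ennreal (weight 0 + exp t)"
      by (subst nn_integral_add) (simp_all add: emeasure_eq_measure weight_def prob_space)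
    finally show ?thesis .
  qed
  show "(INF t. ln_mgf \<Omega> X t) \<le> ext_ln (ennreal (weight 0))"
  proof (rule ereal_le_real)
    fix y assume y: "ext_ln (ennreal (weight 0)) \<le> ereal y"
    have w: "weight 0 \<le> exp y" using y by (simp add: ext_ln_le_ereal_iff)
    show "(INF t. ln_mgf \<Omega> X t) \<le> ereal y"
    proof (rule ereal_le_epsilon2)
      fix e :: real assume e: "0 < e"
      define d where "d = exp (y + e) - exp y"
      have d: "0 < d" using e by (simp add: d_def)
      define t where "t = min 0 (ln d)"
      have "exp t \<le> d" using d unfolding t_def by (metis exp_le_cancel_iff exp_ln min.cobounded2)
      then have "mgf \<Omega> X t \<le> ennreal (exp (y + e))"
        using bound[of t] w by (intro order_trans[OF bound] ennreal_leI) (auto simp: t_def d_def)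
      then have "ln_mgf \<Omega> X t \<le> ereal (y + e)" by (simp add: ln_mgf_def ext_ln_le_ereal_iff)
      then show "(INF t. ln_mgf \<Omega> X t) \<le> ereal y + ereal e"
        by (intro INF_lower2[of t]) auto
    qed
  qed
qed

end

section \<open>Invariant subgradients and the variational principle\<close>

lemma total_mass_invariant_probs:
  assumes "\<nu> \<in> invariant_probs \<alpha>"
  shows "total_mass \<nu> = 1"
proof -
  from assms obtain m where m: "m \<in> invariant_prob_measures \<alpha>" "\<nu> = dual_of_measure m"
    by (auto simp: invariant_probs_def)
  then interpret prob_space m by (simp add: invariant_prob_measures_def)
  have "sets m = sets borel"
    using m(1) by (simp add: invariant_prob_measures_def regular_borel_measure_def)
  from dual_of_measure_apply[OF finite_measure_axioms this] show ?thesis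
    by (simp add: m(2) total_mass_def const_bcontfun.rep_eq prob_space)
qed

locale compact_measure_preserving_map = measure_preserving_map \<mu> \<alpha>
  for \<mu> :: "'a::t2_space measure" and \<alpha> +
  assumes compact_space: "compact (UNIV :: 'a set)"
begin

lemma apply_Bcontfun:
  assumes "continuous_on UNIV f"
  shows "apply_bcontfun (Bcontfun f :: 'a \<Rightarrow>\<^sub>C real) = f"
proof (rule Bcontfun_inverse)
  have "bounded (range f)"
    using compact_continuous_image[OF assms compact_space] by (rule compact_imp_bounded)
  then show "f \<in> bcontfun" using assms by (simp add: bcontfun_def)
qed

text \<open>
  Each structural property of the growth rate constrains its subgradients: monotonicity makes them
  positive, translation by constants gives them mass one, and insensitivity to coboundaries makes
  them invariant. The Riesz representation then identifies them with invariant probabilities.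
\<close>

lemma growth_rate_ex_invariant_subgradient:
  "\<exists>\<nu>\<in>invariant_probs \<alpha>. \<forall>h. growth_rate \<phi> + blinfun_apply \<nu> h \<le> growth_rate (\<phi> + h)"
proof -
  from convex_ex_subgradient[OF growth_rate_convex, of \<phi>] obtain l
    where l: "linear l" "\<And>h. growth_rate \<phi> + l h \<le> growth_rate (\<phi> + h)" by blast
  have l_nonneg: "0 \<le> l h" if "\<And>x. 0 \<le> apply_bcontfun h x" for h
  proof -
    have "growth_rate (\<phi> + - h) \<le> growth_rate \<phi>" using that by (intro growth_rate_mono) simp
    then have "l (- h) \<le> 0" using l(2)[of "- h"] by simp
    then show ?thesis using linear_neg[OF l(1)] by simp
  qed
  have l_const: "l (const_bcontfun 1) = 1"
  proof (rule antisym)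
    show "l (const_bcontfun 1) \<le> 1"
      using l(2)[of "const_bcontfun 1"] by (simp add: growth_rate_add_const)
    have "const_bcontfun (- 1) = - (const_bcontfun 1 :: 'a \<Rightarrow>\<^sub>C real)"
      by (rule bcontfun_eqI) (simp add: const_bcontfun.rep_eq)
    then have "l (const_bcontfun (- 1)) = - l (const_bcontfun 1)"
      by (simp only: linear_neg[OF l(1)])
    then show "1 \<le> l (const_bcontfun 1)"
      using l(2)[of "const_bcontfun (- 1)"] growth_rate_add_const[of \<phi> "- 1"] by linarith
  qed
  have l_coboundary: "l h = 0"
    if h: "\<And>x. apply_bcontfun h x = apply_bcontfun \<psi> (\<alpha> x) - apply_bcontfun \<psi> x" for h \<psi>
  proof -
    have "l h \<le> 0" using l(2)[of h] growth_rate_add_coboundary[of h \<psi> \<phi>] h by simp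
    moreover have "l (- h) \<le> 0"
      using l(2)[of "- h"] growth_rate_add_coboundary[of "- h" "- \<psi>" \<phi>] h by simp
    ultimately show ?thesis using linear_neg[OF l(1)] by simp
  qed
  define I where "I f = l (Bcontfun f)" for f
  interpret positive_functional I
  proof
    show "compact (UNIV :: 'a set)" by (rule compact_space)
    show "I (\<lambda>x. f x + g x) = I f + I g" if "continuous_on UNIV f" "continuous_on UNIV g" for f g
    proof -
      have "Bcontfun (\<lambda>x. f x + g x) = (Bcontfun f + Bcontfun g :: 'a \<Rightarrow>\<^sub>C real)"
        using that by (intro bcontfun_eqI) (simp add: apply_Bcontfun continuous_on_add)
      then show ?thesis by (simp add: I_def linear_add[OF l(1)])
    qed
    show "I (\<lambda>x. c * f x) = c * I f" if "continuous_on UNIV f" for f c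
    proof -
      have "Bcontfun (\<lambda>x. c * f x) = (c *\<^sub>R Bcontfun f :: 'a \<Rightarrow>\<^sub>C real)"
        using that by (intro bcontfun_eqI) (simp add: apply_Bcontfun continuous_on_mult_left)
      then show ?thesis by (simp add: I_def linear_scale[OF l(1)])
    qed
    show "0 \<le> I f" if "continuous_on UNIV f" "\<And>x. 0 \<le> f x" for f
      unfolding I_def using that by (intro l_nonneg) (simp add: apply_Bcontfun)
  qed
  have inv: "I (\<lambda>x. f (\<alpha> x)) = I f" if f: "continuous_on UNIV f" for f
  proof -
    have f\<alpha>: "continuous_on UNIV (\<lambda>x. f (\<alpha> x))"
      by (rule continuous_on_compose2[OF f continuous]) simp
    have "l (Bcontfun (\<lambda>x. f (\<alpha> x)) - Bcontfun f) = 0"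
      by (rule l_coboundary[of _ "Bcontfun f"]) (simp add: apply_Bcontfun[OF f] apply_Bcontfun[OF f\<alpha>])
    then show ?thesis by (simp add: I_def linear_diff[OF l(1)])
  qed
  have apply_I: "I (apply_bcontfun h) = l h" for h
    by (simp add: I_def apply_bcontfun_inverse)
  have "prob_space representing_measure"
  proof (rule prob_spaceI)
    have "I (\<lambda>x. 1) = 1"
      using apply_I[of "const_bcontfun 1"] l_const by (simp add: const_bcontfun.rep_eq)
    then show "emeasure representing_measure (space representing_measure) = 1"
      by (simp add: emeasure_open open_content_UNIV)
  qed
  moreover have "distr representing_measure borel \<alpha> = representing_measure"
    by (rule distr_representing_measure[OF continuous inv])
  ultimately have "dual_of_measure representing_measure \<in> invariant_probs \<alpha>"
    using regular_representing_measure by (simp add: invariant_probs_def invariant_prob_measures_def)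
  moreover have "blinfun_apply (dual_of_measure representing_measure) h = l h" for h
    by (simp add: dual_of_measure_apply[OF finite_representing_measure] integral_representing_measure apply_I)
  ultimately show ?thesis using l(2) by (intro bexI[of _ "dual_of_measure representing_measure"]) simp_all
qed

context
  fixes p :: real
  assumes p: "1 \<le> p"
begin

lemma log_spectral_radius_add_const:
  "log_spectral_radius p \<mu> \<alpha> (\<phi> + const_bcontfun c) = log_spectral_radius p \<mu> \<alpha> \<phi> + c"
proof -
  have "p *\<^sub>R (\<phi> + const_bcontfun c) = p *\<^sub>R \<phi> + const_bcontfun (p * c)"
    by (rule bcontfun_eqI) (simp add: const_bcontfun.rep_eq algebra_simps)
  then show ?thesis
    using p by (simp add: log_spectral_radius_eq_growth_rate[OF p] growth_rate_add_const add_divide_distrib)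
qed

lemma log_spectral_radius_ex_invariant_subgradient:
  "\<exists>\<nu>\<in>invariant_probs \<alpha>. \<forall>\<psi>. log_spectral_radius p \<mu> \<alpha> \<phi> + (blinfun_apply \<nu> \<psi> - blinfun_apply \<nu> \<phi>)
     \<le> log_spectral_radius p \<mu> \<alpha> \<psi>"
proof -
  from growth_rate_ex_invariant_subgradient[of "p *\<^sub>R \<phi>"] obtain \<nu> where \<nu>: "\<nu> \<in> invariant_probs \<alpha>"
    "\<And>h. growth_rate (p *\<^sub>R \<phi>) + blinfun_apply \<nu> h \<le> growth_rate (p *\<^sub>R \<phi> + h)" by blast
  have "log_spectral_radius p \<mu> \<alpha> \<phi> + (blinfun_apply \<nu> \<psi> - blinfun_apply \<nu> \<phi>) \<le> log_spectral_radius p \<mu> \<alpha> \<psi>" for \<psi>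
  proof -
    have "growth_rate (p *\<^sub>R \<phi>) + p * (blinfun_apply \<nu> \<psi> - blinfun_apply \<nu> \<phi>) \<le> growth_rate (p *\<^sub>R \<psi>)"
      using \<nu>(2)[of "p *\<^sub>R \<psi> - p *\<^sub>R \<phi>"] by (simp add: blinfun.diff_right blinfun.scaleR_right algebra_simps)
    then have "(growth_rate (p *\<^sub>R \<phi>) + p * (blinfun_apply \<nu> \<psi> - blinfun_apply \<nu> \<phi>)) / p \<le> growth_rate (p *\<^sub>R \<psi>) / p"
      using p by (intro divide_right_mono) auto
    then show ?thesis
      using p by (simp add: log_spectral_radius_eq_growth_rate[OF p] add_divide_distrib)
  qed
  with \<nu>(1) show ?thesis by blast
qed

text \<open>
  The Legendre transform of the logarithmic spectral radius depends on \<open>p\<close> only by the factor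
  \<open>1 / p\<close>, because passing from \<open>L^1\<close> to \<open>L^p\<close> rescales the argument and the value of the growth rate.
\<close>

lemma conjugate_log_spectral_radius:
  assumes a: "0 \<le> a"
  shows "ereal (1 / p) * ereal a * t_entropy \<mu> \<alpha> \<nu>
    = (SUP \<phi>. ereal (a * (blinfun_apply \<nu> \<phi> - log_spectral_radius p \<mu> \<alpha> \<phi>)))"
proof -
  have t: "t_entropy \<mu> \<alpha> \<nu> = (SUP \<phi>. ereal (blinfun_apply \<nu> \<phi> - growth_rate \<phi>))"
    using log_spectral_radius_eq_growth_rate[of 1] by (simp add: t_entropy_def convex_conjugate_def)
  have "ereal (1 / p) * ereal a * t_entropy \<mu> \<alpha> \<nu>
      = (SUP \<phi>. ereal (a / p) * ereal (blinfun_apply \<nu> \<phi> - growth_rate \<phi>))"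
    using a p unfolding t by (simp add: Sup_ereal_mult_left' image_image)
  also have "\<dots> = (SUP \<phi>. ereal (a / p) * ereal (blinfun_apply \<nu> (p *\<^sub>R \<phi>) - growth_rate (p *\<^sub>R \<phi>)))"
  proof -
    have surj_eq: "range (\<lambda>\<phi> :: 'a \<Rightarrow>\<^sub>C real. p *\<^sub>R \<phi>) = UNIV"
      using p by (intro surjI[of _ "\<lambda>\<phi>. (1 / p) *\<^sub>R \<phi>"]) simp
    have "range (\<lambda>\<phi>. ereal (a / p) * ereal (blinfun_apply \<nu> \<phi> - growth_rate \<phi>))
      = range (\<lambda>\<phi>. ereal (a / p) * ereal (blinfun_apply \<nu> (p *\<^sub>R \<phi>) - growth_rate (p *\<^sub>R \<phi>)))"
      by (subst (1) surj_eq[symmetric]) (simp only: image_image)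
    then show ?thesis by simp
  qed
  also have "\<dots> = (SUP \<phi>. ereal (a * (blinfun_apply \<nu> \<phi> - log_spectral_radius p \<mu> \<alpha> \<phi>)))"
    using p by (intro SUP_cong refl)
      (simp add: log_spectral_radius_eq_growth_rate[OF p] blinfun.scaleR_right field_simps)
  finally show ?thesis .
qed

context
  fixes \<Omega> :: "'b measure" and X :: "'b \<Rightarrow> nat"
  assumes X: "nat_random_variable \<Omega> X"
begin

interpretation nat_random_variable \<Omega> X by (rule X)

lemma lambda_hat_eq: "lambda_hat \<Omega> X p \<mu> \<alpha> \<phi> = ln_mgf \<Omega> X (log_spectral_radius p \<mu> \<alpha> \<phi>)"
  by (auto simp: lambda_hat_def effective_domain_def)

lemma lambda_hat_conj_eq:
  "lambda_hat_conj \<Omega> X p \<mu> \<alpha> \<nu>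
    = (SUP \<phi>. ereal (blinfun_apply \<nu> \<phi>) - ln_mgf \<Omega> X (log_spectral_radius p \<mu> \<alpha> \<phi>))"
  by (simp add: lambda_hat_conj_def convex_conjugate_def lambda_hat_eq)

text \<open>
  Writing \<open>\<phi> = \<psi> + t - \<lambda>(\<psi>)\<close>, the values of \<open>\<lambda>(\<phi>) = t\<close> and of \<open>\<nu>(\<psi>) - \<lambda>(\<psi>)\<close> can be prescribed
  independently, so that the supremum over \<open>\<phi>\<close> splits into a sum of two suprema.
\<close>

lemma lambda_hat_conj_scaleR:
  assumes \<nu>: "\<nu> \<in> invariant_probs \<alpha>" and a: "0 \<le> a"
  shows "lambda_hat_conj \<Omega> X p \<mu> \<alpha> (a *\<^sub>R \<nu>)
    = ereal (1 / p) * ereal a * t_entropy \<mu> \<alpha> \<nu> + cramer_transform \<Omega> X a"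
proof (rule antisym)
  define D where "D \<phi> = a * (blinfun_apply \<nu> \<phi> - log_spectral_radius p \<mu> \<alpha> \<phi>)" for \<phi>
  have conj: "ereal (1 / p) * ereal a * t_entropy \<mu> \<alpha> \<nu> = (SUP \<phi>. ereal (D \<phi>))"
    unfolding D_def by (rule conjugate_log_spectral_radius[OF a])
  have split: "ereal (blinfun_apply (a *\<^sub>R \<nu>) \<phi>) - ln_mgf \<Omega> X (log_spectral_radius p \<mu> \<alpha> \<phi>)
      = ereal (D \<phi>) + (ereal (a * log_spectral_radius p \<mu> \<alpha> \<phi>) - ln_mgf \<Omega> X (log_spectral_radius p \<mu> \<alpha> \<phi>))" for \<phi>
    by (cases "ln_mgf \<Omega> X (log_spectral_radius p \<mu> \<alpha> \<phi>)") (auto simp: D_def blinfun.scaleR_left algebra_simps)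
  show "lambda_hat_conj \<Omega> X p \<mu> \<alpha> (a *\<^sub>R \<nu>)
      \<le> ereal (1 / p) * ereal a * t_entropy \<mu> \<alpha> \<nu> + cramer_transform \<Omega> X a"
    unfolding lambda_hat_conj_eq conj split
    by (intro SUP_least add_mono cramer_transform_upper) (auto intro: SUP_upper)
  have "ereal (D \<phi>) + (ereal (a * t) - ln_mgf \<Omega> X t) \<le> lambda_hat_conj \<Omega> X p \<mu> \<alpha> (a *\<^sub>R \<nu>)" for \<phi> t
  proof -
    define \<psi> where "\<psi> = \<phi> + const_bcontfun (t - log_spectral_radius p \<mu> \<alpha> \<phi>)"
    have lam: "log_spectral_radius p \<mu> \<alpha> \<psi> = t" by (simp add: \<psi>_def log_spectral_radius_add_const)
    have "const_bcontfun c = c *\<^sub>R (const_bcontfun 1 :: 'a \<Rightarrow>\<^sub>C real)" for c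
      by (rule bcontfun_eqI) (simp add: const_bcontfun.rep_eq)
    then have "blinfun_apply \<nu> (const_bcontfun c) = c" for c
      using total_mass_invariant_probs[OF \<nu>] by (metis blinfun.scaleR_right mult.right_neutral real_scaleR_def total_mass_def)
    then have D: "D \<psi> = D \<phi>" by (simp add: D_def lam) (simp add: \<psi>_def blinfun.add_right)
    have "ereal (blinfun_apply (a *\<^sub>R \<nu>) \<psi>) - ln_mgf \<Omega> X (log_spectral_radius p \<mu> \<alpha> \<psi>)
        \<le> lambda_hat_conj \<Omega> X p \<mu> \<alpha> (a *\<^sub>R \<nu>)"
      unfolding lambda_hat_conj_eq by (rule SUP_upper) simp
    then show ?thesis unfolding split unfolding lam D .
  qed
  then have *: "(SUP t. ereal (D \<phi>) + (ereal (a * t) - ln_mgf \<Omega> X t)) \<le> lambda_hat_conj \<Omega> X p \<mu> \<alpha> (a *\<^sub>R \<nu>)" for \<phi>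
    by (intro SUP_least)
  have "ereal (D \<phi>) + cramer_transform \<Omega> X a \<le> lambda_hat_conj \<Omega> X p \<mu> \<alpha> (a *\<^sub>R \<nu>)" for \<phi>
    using *[of \<phi>] unfolding cramer_transform_def convex_conjugate_def
    by (subst (asm) SUP_ereal_add_right) auto
  then have "(SUP \<phi>. ereal (D \<phi>) + cramer_transform \<Omega> X a) \<le> lambda_hat_conj \<Omega> X p \<mu> \<alpha> (a *\<^sub>R \<nu>)"
    by (intro SUP_least)
  then show "ereal (1 / p) * ereal a * t_entropy \<mu> \<alpha> \<nu> + cramer_transform \<Omega> X a
      \<le> lambda_hat_conj \<Omega> X p \<mu> \<alpha> (a *\<^sub>R \<nu>)"
    unfolding conj using cramer_transform_nonneg[of a] by (subst (asm) SUP_ereal_add_left) auto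
qed

lemma lambda_hat_conj_0: "lambda_hat_conj \<Omega> X p \<mu> \<alpha> 0 = - ext_ln (ennreal (weight 0))"
proof -
  have "log_spectral_radius p \<mu> \<alpha> (0 + const_bcontfun (t - log_spectral_radius p \<mu> \<alpha> 0)) = t" for t
    by (subst log_spectral_radius_add_const) simp
  then have "surj (log_spectral_radius p \<mu> \<alpha>)"
    by (rule surjI)
  then have "range (\<lambda>\<phi>. ln_mgf \<Omega> X (log_spectral_radius p \<mu> \<alpha> \<phi>)) = range (ln_mgf \<Omega> X)"
    by (metis image_image)
  then have "(INF \<phi>. ln_mgf \<Omega> X (log_spectral_radius p \<mu> \<alpha> \<phi>)) = ext_ln (ennreal (weight 0))"
    by (simp add: INF_ln_mgf)
  then show ?thesis
    by (simp add: lambda_hat_conj_eq ereal_SUP_uminus_eq flip: zero_ereal_def)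
qed

text \<open>
  An invariant subgradient \<open>\<nu>\<close> of the logarithmic spectral radius at \<open>\<phi>\<close> serves for all slopes \<open>a\<close> at
  once, which reduces the variational principle to the biconjugate of the cumulant generating function.
\<close>

lemma lambda_hat_variational_principle:
  "lambda_hat \<Omega> X p \<mu> \<alpha> \<phi>
    = (SUP \<nu>\<in>M_hat \<Omega> X \<alpha>. ereal (blinfun_apply \<nu> \<phi>) - lambda_hat_conj \<Omega> X p \<mu> \<alpha> \<nu>)"
proof (rule antisym)
  let ?l = "log_spectral_radius p \<mu> \<alpha>"
  show "(SUP \<nu>\<in>M_hat \<Omega> X \<alpha>. ereal (blinfun_apply \<nu> \<phi>) - lambda_hat_conj \<Omega> X p \<mu> \<alpha> \<nu>) \<le> lambda_hat \<Omega> X p \<mu> \<alpha> \<phi>"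
  proof (rule SUP_least)
    fix \<nu>
    have "ereal (blinfun_apply \<nu> \<phi>) - ln_mgf \<Omega> X (?l \<phi>) \<le> lambda_hat_conj \<Omega> X p \<mu> \<alpha> \<nu>"
      unfolding lambda_hat_conj_eq by (intro SUP_upper) simp
    then show "ereal (blinfun_apply \<nu> \<phi>) - lambda_hat_conj \<Omega> X p \<mu> \<alpha> \<nu> \<le> lambda_hat \<Omega> X p \<mu> \<alpha> \<phi>"
      unfolding lambda_hat_eq using ln_mgf_not_MInf[of "?l \<phi>"]
      by (cases "ln_mgf \<Omega> X (?l \<phi>)"; cases "lambda_hat_conj \<Omega> X p \<mu> \<alpha> \<nu>") auto
  qed
  from log_spectral_radius_ex_invariant_subgradient[of \<phi>] obtain \<nu>
    where \<nu>: "\<nu> \<in> invariant_probs \<alpha>" "\<And>\<psi>. ?l \<phi> + (blinfun_apply \<nu> \<psi> - blinfun_apply \<nu> \<phi>) \<le> ?l \<psi>" by blast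
  have "ereal (a * ?l \<phi>) - cramer_transform \<Omega> X a
      \<le> (SUP \<nu>\<in>M_hat \<Omega> X \<alpha>. ereal (blinfun_apply \<nu> \<phi>) - lambda_hat_conj \<Omega> X p \<mu> \<alpha> \<nu>)"
    if a: "a \<in> effective_domain (cramer_transform \<Omega> X)" for a
  proof -
    have a0: "0 \<le> a" by (rule effective_domain_cramer_nonneg[OF a])
    obtain c where c: "cramer_transform \<Omega> X a = ereal c"
      using a cramer_transform_nonneg[of a]
      by (cases "cramer_transform \<Omega> X a") (auto simp: effective_domain_def)
    have "lambda_hat_conj \<Omega> X p \<mu> \<alpha> (a *\<^sub>R \<nu>) \<le> ereal (a * (blinfun_apply \<nu> \<phi> - ?l \<phi>) + c)"
      unfolding lambda_hat_conj_eq
    proof (rule SUP_least)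
      fix \<psi>
      have "a * blinfun_apply \<nu> \<psi> \<le> a * (blinfun_apply \<nu> \<phi> - ?l \<phi> + ?l \<psi>)"
        using \<nu>(2)[of \<psi>] a0 by (intro mult_left_mono) auto
      then show "ereal (blinfun_apply (a *\<^sub>R \<nu>) \<psi>) - ln_mgf \<Omega> X (?l \<psi>) \<le> ereal (a * (blinfun_apply \<nu> \<phi> - ?l \<phi>) + c)"
        using cramer_transform_upper[of a "?l \<psi>"] ln_mgf_not_MInf[of "?l \<psi>"] unfolding c
        by (cases "ln_mgf \<Omega> X (?l \<psi>)") (auto simp: blinfun.scaleR_left algebra_simps)
    qed
    then have "ereal (a * ?l \<phi>) - cramer_transform \<Omega> X a
        \<le> ereal (blinfun_apply (a *\<^sub>R \<nu>) \<phi>) - lambda_hat_conj \<Omega> X p \<mu> \<alpha> (a *\<^sub>R \<nu>)"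
      unfolding c by (cases "lambda_hat_conj \<Omega> X p \<mu> \<alpha> (a *\<^sub>R \<nu>)") (auto simp: blinfun.scaleR_left algebra_simps)
    also have "\<dots> \<le> (SUP \<nu>\<in>M_hat \<Omega> X \<alpha>. ereal (blinfun_apply \<nu> \<phi>) - lambda_hat_conj \<Omega> X p \<mu> \<alpha> \<nu>)"
      using \<nu>(1) a by (intro SUP_upper) (auto simp: M_hat_def)
    finally show ?thesis .
  qed
  then show "lambda_hat \<Omega> X p \<mu> \<alpha> \<phi>
      \<le> (SUP \<nu>\<in>M_hat \<Omega> X \<alpha>. ereal (blinfun_apply \<nu> \<phi>) - lambda_hat_conj \<Omega> X p \<mu> \<alpha> \<nu>)"
    unfolding lambda_hat_eq by (intro order_trans[OF ln_mgf_le_biconjugate] SUP_least)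
qed

end

end

end

theorem proposition2p8:
  fixes \<Omega> :: "'b measure" and X :: "'b \<Rightarrow> nat" and q :: "nat \<Rightarrow> real"
    and \<mu> :: "'a::t2_space measure" and \<alpha> :: "'a \<Rightarrow> 'a" and p :: real
  assumes "prob_space \<Omega>"
    and "X \<in> measurable \<Omega> (count_space UNIV)"
    and "\<And>n. q n = measure \<Omega> {\<omega> \<in> space \<Omega>. X \<omega> = n}"
    and "compact (UNIV :: 'a set)"
    and "sets \<mu> = sets borel"
    and "\<exists>A\<in>sets \<mu>. 0 < emeasure \<mu> A \<and> emeasure \<mu> A < \<infinity>"
    and "continuous_on UNIV \<alpha>"
    and "distr \<mu> borel \<alpha> = \<mu>"
    and "1 \<le> p"
  shows "(\<forall>\<phi> :: 'a \<Rightarrow>\<^sub>C real.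
            lambda_hat \<Omega> X p \<mu> \<alpha> \<phi> =
              (SUP \<nu>\<in>M_hat \<Omega> X \<alpha>.
                 ereal (blinfun_apply \<nu> \<phi>) - lambda_hat_conj \<Omega> X p \<mu> \<alpha> \<nu>))
       \<and> (\<forall>\<nu>\<in>M_hat \<Omega> X \<alpha>. total_mass \<nu> > 0 \<longrightarrow>
            lambda_hat_conj \<Omega> X p \<mu> \<alpha> \<nu> =
              ereal (1 / p) * ereal (total_mass \<nu>) * t_entropy \<mu> \<alpha> (\<nu> /\<^sub>R total_mass \<nu>)
              + cramer_transform \<Omega> X (total_mass \<nu>))
       \<and> (\<forall>\<nu>\<in>M_hat \<Omega> X \<alpha>. total_mass \<nu> = 0 \<longrightarrow> \<nu> = 0)
       \<and> lambda_hat_conj \<Omega> X p \<mu> \<alpha> 0 = - ext_ln (ennreal (q 0))"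
proof -
  interpret compact_measure_preserving_map \<mu> \<alpha>
    by unfold_locales (use assms in auto)
  have X: "nat_random_variable \<Omega> X"
    using assms(1,2) by (simp add: nat_random_variable_def nat_random_variable_axioms_def)
  interpret nat_random_variable \<Omega> X by (rule X)
  note p = assms(9)
  have M_hat: "\<exists>a \<nu>'. \<nu>' \<in> invariant_probs \<alpha> \<and> 0 \<le> a \<and> \<nu> = a *\<^sub>R \<nu>' \<and> total_mass \<nu> = a"
    if "\<nu> \<in> M_hat \<Omega> X \<alpha>" for \<nu>
  proof -
    from that obtain a \<nu>' where \<nu>: "\<nu> = a *\<^sub>R \<nu>'" "\<nu>' \<in> invariant_probs \<alpha>"
      "a \<in> effective_domain (cramer_transform \<Omega> X)" by (auto simp: M_hat_def)
    have "total_mass \<nu> = a"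
      using total_mass_invariant_probs[OF \<nu>(2)] by (simp add: \<nu>(1) total_mass_def blinfun.scaleR_left)
    then show ?thesis using \<nu> effective_domain_cramer_nonneg by blast
  qed
  have "lambda_hat_conj \<Omega> X p \<mu> \<alpha> \<nu> = ereal (1 / p) * ereal (total_mass \<nu>) * t_entropy \<mu> \<alpha> (\<nu> /\<^sub>R total_mass \<nu>)
      + cramer_transform \<Omega> X (total_mass \<nu>)" if "\<nu> \<in> M_hat \<Omega> X \<alpha>" "total_mass \<nu> > 0" for \<nu>
  proof -
    from M_hat[OF that(1)] obtain a \<nu>'
      where \<nu>: "\<nu>' \<in> invariant_probs \<alpha>" "0 \<le> a" "\<nu> = a *\<^sub>R \<nu>'" and mass: "total_mass \<nu> = a"
      by blast
    have normalized: "(a *\<^sub>R \<nu>') /\<^sub>R a = \<nu>'" using that(2) by (simp add: mass)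
    show ?thesis
      unfolding mass unfolding \<nu>(3) normalized by (rule lambda_hat_conj_scaleR[OF p X \<nu>(1,2)])
  qed
  moreover have "\<nu> = 0" if "\<nu> \<in> M_hat \<Omega> X \<alpha>" "total_mass \<nu> = 0" for \<nu>
    using M_hat[OF that(1)] that(2) by (metis scaleR_zero_left)
  moreover have "lambda_hat_conj \<Omega> X p \<mu> \<alpha> 0 = - ext_ln (ennreal (q 0))"
    using lambda_hat_conj_0[OF p X] by (simp add: assms(3) weight_def)
  ultimately show ?thesis
    using lambda_hat_variational_principle[OF p X] by blast
qed

end
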